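(* For every pair of positive integers $p, q$ satisfying $$\frac{1}{p}+\frac{1}{q}<\frac{1}{2},$$ there exists a $q$-regular $p$-gon in the hyperbolic plane $\mathbb{H}^2$. In particular, every such polygon is the prototile of a regular tiling of $\mathbb{H}^2$.
   Context: $\mathbb{H}^2$ is the hyperbolic plane, with its standard complete metric of constant curvature. A polygon in $\mathbb{H}^2$ is a bounded region together with its bounding circuit, the latter being a closed polygonal chain of finitely many geodesic segments. A $q$-regular $p$-gon is a regular polygon with $p$ sides (all sides of equal length and all inner angles equal) such that every inner angle has magnitude $\frac{2\pi}{q}$. A tiling (tessellation) $\mathcal{T}$ of $\mathbb{H}^2$ is a subdivision of $\mathbb{H}^2$ into polygons, called tiles, which cover $\mathbb{H}^2$ and have pairwise disjoint interiors. Tilings are assumed to be edge-to-edge: any two distinct tiles are either disjoint, or share exactly one point which is a vertex of both, or share a segment which is an edge of both. The tiling $\mathcal{T}$ is symmetric if for any two tiles $t,\tau$ there is an isometry $g$ of $\mathbb{H}^2$ which maps $\mathcal{T}$ to itself and satisfies $g\cdot t=\tau$. In a symmetric tiling all tiles are congruent to a single polygon, called the prototile. A symmetric tiling is regular if its prototile is a regular polygon. *)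

theory Defs
  imports "HOL-Analysis.Analysis"
begin

section \<open>The hyperbolic plane (Poincare disc model, curvature -1)\<close>

definition hyp_plane :: "complex set" where
  "hyp_plane = ball 0 1"

text \<open>This is the distance of the Riemannian metric 4 |dz|^2 / (1 - |z|^2)^2. It induces the
  Euclidean topology on the open unit disc, so the library notions \<^const>\<open>interior\<close> and
  \<^const>\<open>inside\<close> may be used for subsets of the disc.\<close>

definition hyp_dist :: "complex \<Rightarrow> complex \<Rightarrow> real" where
  "hyp_dist z w =
     arcosh (1 + 2 * (cmod (z - w))\<^sup>2 / ((1 - (cmod z)\<^sup>2) * (1 - (cmod w)\<^sup>2)))"

text \<open>Orientation-reversing isometries are included. Values off the disc are irrelevant.\<close>

definition hyp_isometry :: "(complex \<Rightarrow> complex) \<Rightarrow> bool" where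
  "hyp_isometry g \<longleftrightarrow> bij_betw g hyp_plane hyp_plane \<and>
     (\<forall>x\<in>hyp_plane. \<forall>y\<in>hyp_plane. hyp_dist (g x) (g y) = hyp_dist x y)"

text \<open>The hyperbolic plane is uniquely geodesic, so the points lying metrically between a and b
  form the geodesic segment joining them.\<close>

definition geodesic_segment :: "complex \<Rightarrow> complex \<Rightarrow> complex set" where
  "geodesic_segment a b = {x \<in> hyp_plane. hyp_dist a x + hyp_dist x b = hyp_dist a b}"

section \<open>Polygons\<close>

definition side :: "complex list \<Rightarrow> nat \<Rightarrow> complex set" where
  "side vs i = geodesic_segment (vs ! i) (vs ! (Suc i mod length vs))"

text \<open>Simple closed geodesic chains, listed by their vertices in cyclic order. The last clause
  says that the chain really has a corner at each vertex (no vertex lies in the middle of a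
  straight side), so that the vertices and edges are determined by the set of points.\<close>

definition polygonal_circuit :: "complex list \<Rightarrow> bool" where
  "polygonal_circuit vs \<longleftrightarrow>
     3 \<le> length vs \<and> distinct vs \<and> set vs \<subseteq> hyp_plane \<and>
     (\<forall>i<length vs. \<forall>j<length vs. i \<noteq> j \<longrightarrow>
        side vs i \<inter> side vs j \<subseteq>
          {vs ! i, vs ! (Suc i mod length vs)} \<inter> {vs ! j, vs ! (Suc j mod length vs)}) \<and>
     (\<forall>i<length vs. vs ! (Suc i mod length vs)
        \<notin> geodesic_segment (vs ! i) (vs ! (Suc (Suc i) mod length vs)))"

definition circuit_points :: "complex list \<Rightarrow> complex set" where
  "circuit_points vs = (\<Union>i<length vs. side vs i)"

definition polygon_of :: "complex list \<Rightarrow> complex set" where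
  "polygon_of vs = circuit_points vs \<union> inside (circuit_points vs)"

definition hyp_polygon :: "complex set \<Rightarrow> bool" where
  "hyp_polygon P \<longleftrightarrow> (\<exists>vs. polygonal_circuit vs \<and> P = polygon_of vs)"

definition polygon_vertices :: "complex set \<Rightarrow> complex set" where
  "polygon_vertices P = {v. \<exists>vs. polygonal_circuit vs \<and> P = polygon_of vs \<and> v \<in> set vs}"

definition polygon_edges :: "complex set \<Rightarrow> complex set set" where
  "polygon_edges P =
     {e. \<exists>vs i. polygonal_circuit vs \<and> P = polygon_of vs \<and> i < length vs \<and> e = side vs i}"

text \<open>After moving v to the centre of the disc by an isometry, geodesics through it are Euclidean
  diameters and hyperbolic angles are Euclidean angles. The inner angle is \<open>\<theta>\<close> if
  P is then, near the centre, a circular sector of opening \<open>\<theta>\<close>. This measures the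
  angle on the side of the region, so reflex angles are told apart from their complements.\<close>

definition has_inner_angle :: "complex set \<Rightarrow> complex \<Rightarrow> real \<Rightarrow> bool" where
  "has_inner_angle P v \<theta> \<longleftrightarrow> v \<in> hyp_plane \<and> 0 < \<theta> \<and> \<theta> < 2 * pi \<and>
     (\<exists>g r. hyp_isometry g \<and> g v = 0 \<and> 0 < r \<and> r < 1 \<and>
        g ` P \<inter> ball 0 r =
          {of_real s * cis t | s t. 0 \<le> s \<and> s < r \<and> 0 \<le> t \<and> t \<le> \<theta>})"

definition regular_polygon_with :: "nat \<Rightarrow> real \<Rightarrow> complex set \<Rightarrow> bool" where
  "regular_polygon_with p \<theta> P \<longleftrightarrow>
     (\<exists>vs. polygonal_circuit vs \<and> length vs = p \<and> P = polygon_of vs \<and>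
        (\<exists>l. \<forall>i<p. hyp_dist (vs ! i) (vs ! (Suc i mod p)) = l) \<and>
        (\<forall>v\<in>set vs. has_inner_angle P v \<theta>))"

definition regular_polygon :: "complex set \<Rightarrow> bool" where
  "regular_polygon P \<longleftrightarrow> (\<exists>p \<theta>. regular_polygon_with p \<theta> P)"

definition q_regular_p_gon :: "nat \<Rightarrow> nat \<Rightarrow> complex set \<Rightarrow> bool" where
  "q_regular_p_gon q p P \<longleftrightarrow> regular_polygon_with p (2 * pi / real q) P"

section \<open>Tilings\<close>

definition edge_to_edge :: "complex set set \<Rightarrow> bool" where
  "edge_to_edge T \<longleftrightarrow> (\<forall>t\<in>T. \<forall>u\<in>T. t \<noteq> u \<longrightarrow>
     t \<inter> u = {} \<or>
     (\<exists>v \<in> polygon_vertices t \<inter> polygon_vertices u. t \<inter> u = {v}) \<or>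
     (\<exists>e \<in> polygon_edges t \<inter> polygon_edges u. t \<inter> u = e))"

definition tiling :: "complex set set \<Rightarrow> bool" where
  "tiling T \<longleftrightarrow>
     (\<forall>t\<in>T. hyp_polygon t) \<and> \<Union>T = hyp_plane \<and>
     (\<forall>t\<in>T. \<forall>u\<in>T. t \<noteq> u \<longrightarrow> interior t \<inter> interior u = {}) \<and>
     edge_to_edge T"

definition symmetric_tiling :: "complex set set \<Rightarrow> bool" where
  "symmetric_tiling T \<longleftrightarrow> tiling T \<and>
     (\<forall>t\<in>T. \<forall>u\<in>T. \<exists>g. hyp_isometry g \<and> (\<lambda>s. g ` s) ` T = T \<and> g ` t = u)"

definition prototile :: "complex set \<Rightarrow> complex set set \<Rightarrow> bool" where
  "prototile P T \<longleftrightarrow> hyp_polygon P \<and> (\<forall>t\<in>T. \<exists>g. hyp_isometry g \<and> g ` P = t)"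

definition regular_tiling :: "complex set set \<Rightarrow> bool" where
  "regular_tiling T \<longleftrightarrow> symmetric_tiling T \<and> (\<exists>P. prototile P T \<and> regular_polygon P)"

end

theory Submission
  imports Defs
begin

text \<open>The proof has three parts: a standard regular polygon with the right angle exists, every
  \<open>q\<close>-regular \<open>p\<close>-gon is an isometric image of such a standard polygon, and the images of a
  standard polygon under a triangle group tile the plane.

  All metric computations are done on the hyperboloid. A point \<open>z\<close> of the disc is sent to the
  Lorentz unit vector with time part \<open>hT z\<close> and space part \<open>hX z\<close>; then \<open>cosh (hyp_dist z w)\<close> is the
  Lorentz product, isometries act linearly, and the points of a geodesic segment are the nonnegative
  linear combinations of its end points that lie on the hyperboloid (\<open>geodesic_segment_iff_lorentz\<close>).
  So convexity arguments become linear inequalities.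

  The standard \<open>p\<close>-gon has its vertices at the \<open>p\<close> rotations of a point at Euclidean distance \<open>R\<close>
  from the centre. It is an intersection of \<open>p\<close> half-planes, which is what identifies the inside of
  its boundary circuit (\<open>polygon_of_verts\<close>), and its inner angle is twice an explicit \<open>half_angle\<close>.
  Letting \<open>R\<close> vary, \<open>half_angle\<close> takes every value between \<open>0\<close> and \<open>pi / 2 - pi / p\<close>; the hypothesis
  on \<open>p\<close> and \<open>q\<close> says that \<open>pi / q\<close> is one of them.

  For the second part, let \<open>P\<close> have equal sides and equal inner angles below \<open>pi\<close>. At each vertex
  the region is a sector bounded by the two sides (\<open>corner_sector\<close>), and along a side the region
  stays on one side (\<open>same_side\<close>); hence the circuit turns by the same angle in the same direction
  at every vertex. Then the direct isometry that moves the first side to the second one shifts the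
  whole vertex sequence. It fixes the centre of mass of the vertices, so after centring it is a
  rotation by a \<open>p\<close>-th root of unity \<open>u\<close>. If \<open>u\<close> were not the smallest rotation in either direction,
  two sides would cross as in a star polygon (\<open>rotation_orbit_turn\<close>); so \<open>P\<close> is standard
  (\<open>regular_polygon_is_standard\<close>).

  For the third part, cut the polygon along its mirror lines into \<open>2 * p\<close> triangles with angles
  \<open>pi / p\<close>, \<open>pi / 2\<close>, \<open>pi / q\<close>, and let \<open>W\<close> be generated by the reflections in the three sides of one of
  them, the chamber. That distinct images of the open chamber are disjoint is the geometric core. It
  is obtained from the argument of Tits for Coxeter groups: by induction on word length, an element
  of \<open>W\<close> either keeps the chamber on the positive side of a given mirror or is shortened by that
  reflection (\<open>tits_lemma\<close>). The induction only uses the action of the three dihedral groups generated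
  by two of the reflections, and these are controlled by the sines of multiples of \<open>pi / p\<close>,
  \<open>pi / 2\<close> and \<open>pi / q\<close>. Since the orbit of a chamber point is therefore locally finite, each point of
  the plane has a translate that is nearest to that chamber point, and this translate lies in the
  closed chamber (\<open>chambers_cover\<close>). Finally two closed chambers meet only in points fixed by the
  element of \<open>W\<close> relating them (\<open>closed_chamber_strict\<close>), and from this one reads off that two tiles
  meet in nothing, in a common vertex or in a common edge (\<open>tiles_meet\<close>).\<close>


section \<open>Hyperboloid coordinates\<close>

lemma hyp_plane_iff: "z \<in> hyp_plane \<longleftrightarrow> cmod z < 1"
  by (simp add: hyp_plane_def dist_norm)

lemma one_minus_cmod2_pos: "z \<in> hyp_plane \<Longrightarrow> 0 < 1 - (cmod z)\<^sup>2"
  by (simp add: hyp_plane_iff abs_square_less_1)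

text \<open>\<open>hT\<close> and \<open>hX\<close> are the time and space parts of the point of the hyperboloid \<open>T^2 - |X|^2 = 1\<close>,
  \<open>T > 0\<close>, that stereographic projection assigns to a point of the disc.\<close>

definition hT :: "complex \<Rightarrow> real" where
  "hT z = (1 + (cmod z)\<^sup>2) / (1 - (cmod z)\<^sup>2)"

definition hX :: "complex \<Rightarrow> complex" where
  "hX z = 2 * z / of_real (1 - (cmod z)\<^sup>2)"

lemma hX_Re: "Re (hX z) = 2 * Re z / (1 - (cmod z)\<^sup>2)"
  and hX_Im: "Im (hX z) = 2 * Im z / (1 - (cmod z)\<^sup>2)"
  unfolding hX_def by (simp_all only: Re_divide_of_real Im_divide_of_real) simp_all

lemma hX_0 [simp]: "hX 0 = 0" and hT_0 [simp]: "hT 0 = 1"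
  by (simp_all add: hX_def hT_def)

lemma hT_hX_unit:
  assumes "z \<in> hyp_plane"
  shows "(hT z)\<^sup>2 = 1 + (cmod (hX z))\<^sup>2"
proof -
  have "1 - (cmod z)\<^sup>2 \<noteq> 0" using one_minus_cmod2_pos[OF assms] by simp
  moreover have "(cmod (hX z))\<^sup>2 = (2 * cmod z / (1 - (cmod z)\<^sup>2))\<^sup>2"
    unfolding hX_def norm_divide norm_of_real norm_mult using one_minus_cmod2_pos[OF assms] by simp
  ultimately show ?thesis
    unfolding hT_def by (simp add: divide_simps) (simp add: power2_eq_square algebra_simps)
qed

lemma hT_ge_1: "z \<in> hyp_plane \<Longrightarrow> 1 \<le> hT z"
  using one_minus_cmod2_pos[of z] by (simp add: hT_def)

lemma hX_inj:
  assumes "z \<in> hyp_plane" "w \<in> hyp_plane" "hX z = hX w"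
  shows "z = w"
proof -
  have "(hT z)\<^sup>2 = (hT w)\<^sup>2" using hT_hX_unit assms by simp
  then have T: "hT z = hT w"
    using hT_ge_1 assms by (metis abs_of_nonneg order_trans power2_eq_iff_nonneg zero_le_one)
  have a: "0 < 1 - (cmod z)\<^sup>2" "0 < 1 - (cmod w)\<^sup>2" using one_minus_cmod2_pos assms by auto
  then have "(cmod z)\<^sup>2 = (cmod w)\<^sup>2" using T by (simp add: hT_def field_simps)
  moreover have "complex_of_real (1 - (cmod w)\<^sup>2) \<noteq> 0" using a by (metis less_irrefl of_real_eq_0_iff)
  ultimately show ?thesis using assms(3) unfolding hX_def by (simp add: divide_simps)
qed

text \<open>The hyperboloid is the isometric picture of the disc: the hyperbolic cosine of the distance is
  the Lorentz product. All later distance computations go through this formula.\<close>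

lemma cosh_hyp_dist:
  assumes "z \<in> hyp_plane" "w \<in> hyp_plane"
  shows "cosh (hyp_dist z w) = hT z * hT w - Re (hX z * cnj (hX w))"
proof -
  let ?a = "1 - (cmod z)\<^sup>2" and ?b = "1 - (cmod w)\<^sup>2"
  have p: "0 < ?a" "0 < ?b" using assms one_minus_cmod2_pos by auto
  have "cosh (hyp_dist z w) = 1 + 2 * (cmod (z - w))\<^sup>2 / (?a * ?b)"
    unfolding hyp_dist_def using p by (intro cosh_arcosh_real) simp
  also have "\<dots> = (?a * ?b + 2 * (cmod (z - w))\<^sup>2) / (?a * ?b)"
    using p by (simp add: add_divide_distrib)
  also have "?a * ?b + 2 * (cmod (z - w))\<^sup>2
      = (1 + (cmod z)\<^sup>2) * (1 + (cmod w)\<^sup>2) - 4 * (Re z * Re w + Im z * Im w)"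
    by (simp add: cmod_power2) (simp add: power2_eq_square algebra_simps)
  also have "\<dots> / (?a * ?b) = hT z * hT w - Re (hX z * cnj (hX w))"
    unfolding hT_def using p by (simp add: hX_Re hX_Im divide_simps)
  finally show ?thesis .
qed

lemma hyp_dist_nonneg: "z \<in> hyp_plane \<Longrightarrow> w \<in> hyp_plane \<Longrightarrow> 0 \<le> hyp_dist z w"
  unfolding hyp_dist_def using one_minus_cmod2_pos[of z] one_minus_cmod2_pos[of w]
  by (simp add: arcosh_nonneg_real)

lemma hyp_dist_commute: "hyp_dist z w = hyp_dist w z"
  unfolding hyp_dist_def by (simp add: norm_minus_commute mult.commute)

text \<open>Distances are compared through rational expressions, because \<open>arcosh\<close> is injective on the values
  that occur.\<close>

lemma hyp_dist_eq_iff: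
  assumes "z \<in> hyp_plane" "w \<in> hyp_plane" "z' \<in> hyp_plane" "w' \<in> hyp_plane"
  shows "hyp_dist z w = hyp_dist z' w' \<longleftrightarrow>
    (cmod (z - w))\<^sup>2 / ((1 - (cmod z)\<^sup>2) * (1 - (cmod w)\<^sup>2)) =
    (cmod (z' - w'))\<^sup>2 / ((1 - (cmod z')\<^sup>2) * (1 - (cmod w')\<^sup>2))"
    (is "_ \<longleftrightarrow> ?d = ?d'")
proof -
  have "0 \<le> ?d" "0 \<le> ?d'" using assms one_minus_cmod2_pos by (auto simp: less_imp_le)
  then have "arcosh (1 + 2 * ?d) = arcosh (1 + 2 * ?d') \<longleftrightarrow> ?d = ?d'"
    by (metis add_left_cancel cosh_arcosh_real le_add_same_cancel1 mult_eq_0_iff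
        mult_left_cancel zero_le_mult_iff zero_neq_numeral zero_le_numeral)
  then show ?thesis unfolding hyp_dist_def by simp
qed

lemma hyp_dist_eq_0_iff:
  assumes "z \<in> hyp_plane" "w \<in> hyp_plane"
  shows "hyp_dist z w = 0 \<longleftrightarrow> z = w"
proof -
  have "hyp_dist z w = hyp_dist z z \<longleftrightarrow> z = w"
    unfolding hyp_dist_eq_iff[OF assms assms(1) assms(1)]
    using one_minus_cmod2_pos[of z] one_minus_cmod2_pos[of w] assms by auto
  then show ?thesis by (simp add: hyp_dist_def)
qed

lemma hyp_dist_0_eq_iff:
  assumes "z \<in> hyp_plane" "w \<in> hyp_plane"
  shows "hyp_dist 0 z = hyp_dist 0 w \<longleftrightarrow> cmod z = cmod w"
proof -
  have p: "0 < 1 - (cmod z)\<^sup>2" "0 < 1 - (cmod w)\<^sup>2" using assms one_minus_cmod2_pos by auto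
  have "hyp_dist 0 z = hyp_dist 0 w \<longleftrightarrow> (cmod z)\<^sup>2 = (cmod w)\<^sup>2"
    by (subst hyp_dist_eq_iff) (use assms p in \<open>auto simp: hyp_plane_iff field_simps\<close>)
  then show ?thesis by (simp add: power2_eq_iff_nonneg)
qed

section \<open>Isometries\<close>

lemma hyp_isometry_in: "hyp_isometry g \<Longrightarrow> z \<in> hyp_plane \<Longrightarrow> g z \<in> hyp_plane"
  unfolding hyp_isometry_def bij_betw_def by blast

lemma hyp_isometry_dist:
  "hyp_isometry g \<Longrightarrow> x \<in> hyp_plane \<Longrightarrow> y \<in> hyp_plane \<Longrightarrow> hyp_dist (g x) (g y) = hyp_dist x y"
  unfolding hyp_isometry_def by blast

lemma hyp_isometry_eq_iff:
  "hyp_isometry g \<Longrightarrow> x \<in> hyp_plane \<Longrightarrow> y \<in> hyp_plane \<Longrightarrow> g x = g y \<longleftrightarrow> x = y"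
  unfolding hyp_isometry_def bij_betw_def inj_on_def by blast

lemma hyp_isometry_cong:
  "(\<And>z. z \<in> hyp_plane \<Longrightarrow> g z = h z) \<Longrightarrow> hyp_isometry g \<longleftrightarrow> hyp_isometry h"
  unfolding hyp_isometry_def by (auto cong: bij_betw_cong)

lemma hyp_isometry_compose:
  assumes "hyp_isometry g" "hyp_isometry h"
  shows "hyp_isometry (g \<circ> h)"
  using assms hyp_isometry_in[of h] unfolding hyp_isometry_def
  by (auto intro: bij_betw_trans)

lemma hyp_isometry_id: "hyp_isometry id"
  by (simp add: hyp_isometry_def)

lemma hyp_isometryI:
  assumes "\<And>z. z \<in> hyp_plane \<Longrightarrow> g z \<in> hyp_plane" "\<And>z. z \<in> hyp_plane \<Longrightarrow> h z \<in> hyp_plane"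
    and "\<And>z. z \<in> hyp_plane \<Longrightarrow> h (g z) = z" "\<And>z. z \<in> hyp_plane \<Longrightarrow> g (h z) = z"
    and "\<And>x y. x \<in> hyp_plane \<Longrightarrow> y \<in> hyp_plane \<Longrightarrow> hyp_dist (g x) (g y) = hyp_dist x y"
  shows "hyp_isometry g"
  unfolding hyp_isometry_def using assms
  by (auto intro!: bij_betw_byWitness[where f' = h])

lemma hyp_isometry_inverse:
  assumes "hyp_isometry g"
  obtains h where "hyp_isometry h" "\<And>z. z \<in> hyp_plane \<Longrightarrow> h (g z) = z"
    "\<And>z. z \<in> hyp_plane \<Longrightarrow> g (h z) = z"
proof
  let ?h = "inv_into hyp_plane g"
  have b: "bij_betw g hyp_plane hyp_plane" using assms by (simp add: hyp_isometry_def)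
  show l: "?h (g z) = z" if "z \<in> hyp_plane" for z using b that by (simp add: bij_betw_inv_into_left)
  show r: "g (?h z) = z" if "z \<in> hyp_plane" for z using b that by (simp add: bij_betw_inv_into_right)
  have hin: "?h z \<in> hyp_plane" if "z \<in> hyp_plane" for z
    using b that by (metis bij_betw_def inv_into_into)
  show "hyp_isometry ?h"
  proof (rule hyp_isometryI[where h = g])
    fix x y assume "x \<in> hyp_plane" "y \<in> hyp_plane"
    then show "hyp_dist (?h x) (?h y) = hyp_dist x y"
      using hyp_isometry_dist[OF assms hin hin, of x y] r by simp
  qed (use l r hin hyp_isometry_in[OF assms] in auto)
qed

lemma hyp_isometry_cnj: "hyp_isometry cnj"
proof (rule hyp_isometryI[where h = cnj])
  fix x y :: complex
  have "cmod (cnj x - cnj y) = cmod (x - y)" by (metis complex_cnj_diff complex_mod_cnj)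
  then show "hyp_dist (cnj x) (cnj y) = hyp_dist x y" by (simp add: hyp_dist_def)
qed (auto simp: hyp_plane_iff)

lemma hyp_isometry_rotation:
  assumes "cmod u = 1"
  shows "hyp_isometry (\<lambda>z. u * z)"
proof (rule hyp_isometryI[where h = "\<lambda>z. cnj u * z"])
  have [simp]: "cnj u * (u * z) = z" "u * (cnj u * z) = z" for z
    using assms complex_norm_square[of u] by (simp_all add: mult.assoc[symmetric] mult.commute)
  show "cnj u * (u * z) = z" "u * (cnj u * z) = z" for z by simp_all
  fix x y :: complex
  have "cmod (u * x - u * y) = cmod (x - y)"
    using assms by (metis mult.left_neutral norm_mult right_diff_distrib)
  then show "hyp_dist (u * x) (u * y) = hyp_dist x y" by (simp add: hyp_dist_def norm_mult assms)
qed (auto simp: hyp_plane_iff norm_mult assms)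

text \<open>The isometry without rotational part that moves \<open>a\<close> to the centre; its inverse is \<open>Mob (- a)\<close>.\<close>

definition Mob :: "complex \<Rightarrow> complex \<Rightarrow> complex" where
  "Mob a z = (z - a) / (1 - cnj a * z)"

lemma Mob_denom:
  assumes "a \<in> hyp_plane" "z \<in> hyp_plane"
  shows "1 - cnj a * z \<noteq> 0"
proof
  assume "1 - cnj a * z = 0"
  then have "cmod (cnj a * z) = 1" by (metis eq_iff_diff_eq_0 norm_one)
  moreover have "cmod a * cmod z < 1" using assms
    by (metis hyp_plane_iff mult_strict_mono' norm_ge_zero mult_1)
  ultimately show False by (simp add: norm_mult)
qed

lemma Mob_self [simp]: "Mob a a = 0" and Mob_zero [simp]: "Mob 0 z = z"
  and Mob_at_0: "Mob a 0 = - a"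
  by (simp_all add: Mob_def)

lemma cmod_Mob:
  assumes "a \<in> hyp_plane" "z \<in> hyp_plane"
  shows "1 - (cmod (Mob a z))\<^sup>2
    = (1 - (cmod a)\<^sup>2) * (1 - (cmod z)\<^sup>2) / (cmod (1 - cnj a * z))\<^sup>2"
proof -
  have p: "0 < (cmod (1 - cnj a * z))\<^sup>2" using Mob_denom[OF assms] by simp
  have "(cmod (1 - cnj a * z))\<^sup>2 - (cmod (z - a))\<^sup>2 = (1 - (cmod a)\<^sup>2) * (1 - (cmod z)\<^sup>2)"
    by (simp add: cmod_power2) (simp add: power2_eq_square algebra_simps)
  then show ?thesis using p unfolding Mob_def norm_divide power_divide
    by (simp add: field_simps)
qed

lemma Mob_in: 
  assumes "a \<in> hyp_plane" "z \<in> hyp_plane" shows "Mob a z \<in> hyp_plane"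
proof -
  have "0 < 1 - (cmod (Mob a z))\<^sup>2"
    unfolding cmod_Mob[OF assms] using assms one_minus_cmod2_pos Mob_denom by simp
  then show ?thesis by (simp add: hyp_plane_iff power_less_one_iff)
qed

lemma minus_in_hyp_plane [simp]: "- a \<in> hyp_plane \<longleftrightarrow> a \<in> hyp_plane"
  by (simp add: hyp_plane_iff)

lemma cnj_in_hyp_plane [simp]: "cnj a \<in> hyp_plane \<longleftrightarrow> a \<in> hyp_plane"
  by (simp add: hyp_plane_iff)

lemma zero_in_hyp_plane [simp]: "0 \<in> hyp_plane"
  by (simp add: hyp_plane_iff)

lemma Mob_inverse:
  assumes "a \<in> hyp_plane" "z \<in> hyp_plane"
  shows "Mob (- a) (Mob a z) = z"
proof -
  have d: "1 - cnj a * z \<noteq> 0" "1 - cnj a * a \<noteq> 0" using Mob_denom assms by auto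
  have "Mob a z + a = z * (1 - cnj a * a) / (1 - cnj a * z)"
    unfolding Mob_def using d by (simp add: field_simps)
  moreover have "1 + cnj a * Mob a z = (1 - cnj a * a) / (1 - cnj a * z)"
    unfolding Mob_def using d by (simp add: field_simps)
  ultimately show ?thesis unfolding Mob_def[of "-a"] using d by simp
qed

lemma Mob_diff:
  assumes "a \<in> hyp_plane" "z \<in> hyp_plane" "w \<in> hyp_plane"
  shows "Mob a z - Mob a w
    = (z - w) * of_real (1 - (cmod a)\<^sup>2) / ((1 - cnj a * z) * (1 - cnj a * w))"
proof -
  have d: "1 - cnj a * z \<noteq> 0" "1 - cnj a * w \<noteq> 0" using Mob_denom assms by auto
  have "of_real (1 - (cmod a)\<^sup>2) = 1 - a * cnj a"
    using complex_norm_square[of a] by simp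
  then show ?thesis unfolding Mob_def using d by (simp add: field_simps)
qed

lemma Mob_dist:
  assumes "a \<in> hyp_plane" "z \<in> hyp_plane" "w \<in> hyp_plane"
  shows "hyp_dist (Mob a z) (Mob a w) = hyp_dist z w"
proof -
  have d: "cmod (1 - cnj a * z) \<noteq> 0" "cmod (1 - cnj a * w) \<noteq> 0" using Mob_denom assms by auto
  have p: "0 < 1 - (cmod a)\<^sup>2" using one_minus_cmod2_pos assms by auto
  have q: "0 < 1 - (cmod z)\<^sup>2" "0 < 1 - (cmod w)\<^sup>2" using one_minus_cmod2_pos assms by auto
  have m: "cmod (Mob a z - Mob a w)
    = cmod (z - w) * (1 - (cmod a)\<^sup>2) / (cmod (1 - cnj a * z) * cmod (1 - cnj a * w))"
    unfolding Mob_diff[OF assms] norm_divide norm_mult norm_of_real using p by simp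
  have A: "(m * p / (d * e))\<^sup>2 / (p * q / d\<^sup>2 * (p * r / e\<^sup>2)) = m\<^sup>2 / (q * r)"
    if "d \<noteq> 0" "e \<noteq> 0" "p \<noteq> 0" "q \<noteq> 0" "r \<noteq> 0" for m p d e q r :: real
    using that by (simp add: divide_simps power2_eq_square)
  show ?thesis
    apply (subst hyp_dist_eq_iff)
    using assms Mob_in apply auto[4]
    unfolding cmod_Mob[OF assms(1,2)] cmod_Mob[OF assms(1,3)] m
    using A[OF d, of "1 - (cmod a)\<^sup>2" "1 - (cmod z)\<^sup>2" "1 - (cmod w)\<^sup>2"] p q by simp
qed

lemma hyp_isometry_Mob: "a \<in> hyp_plane \<Longrightarrow> hyp_isometry (Mob a)"
  by (rule hyp_isometryI[where h = "Mob (- a)"])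
    (use Mob_in[of a] Mob_in[of "-a"] Mob_inverse[of a] Mob_inverse[of "-a"] Mob_dist in auto)

text \<open>An isometry that fixes the centre preserves Euclidean norms, hence, by the distance formula,
  Euclidean distances and inner products. Such a map is determined by the images of \<open>1/2\<close> and
  \<open>i/2\<close>: the first fixes the rotation \<open>u\<close>, and the second is then \<open>u * i/2\<close> or its opposite.\<close>

lemma isometry_fixing_0:
  assumes g: "hyp_isometry g" and g0: "g 0 = 0"
  obtains u where "cmod u = 1"
    "(\<forall>z\<in>hyp_plane. g z = u * z) \<or> (\<forall>z\<in>hyp_plane. g z = u * cnj z)"
proof -
  have gin: "g z \<in> hyp_plane" if "z \<in> hyp_plane" for z using hyp_isometry_in[OF g that] .
  \<comment> \<open>The distance from the centre is a function of the Euclidean norm.\<close>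
  have nrm: "cmod (g z) = cmod z" if "z \<in> hyp_plane" for z
    using hyp_isometry_dist[OF g zero_in_hyp_plane that] g0 that gin[OF that]
    by (simp add: hyp_dist_0_eq_iff)
  have inn: "inner (g z) (g w) = inner z w" if "z \<in> hyp_plane" "w \<in> hyp_plane" for z w
  proof -
    have "hyp_dist (g z) (g w) = hyp_dist z w" using hyp_isometry_dist[OF g] that by blast
    then have "(cmod (g z - g w))\<^sup>2 = (cmod (z - w))\<^sup>2"
      unfolding hyp_dist_eq_iff[OF gin[OF that(1)] gin[OF that(2)] that] nrm[OF that(1)] nrm[OF that(2)]
      using one_minus_cmod2_pos[OF that(1)] one_minus_cmod2_pos[OF that(2)] by auto
    then show ?thesis
      using nrm[OF that(1)] nrm[OF that(2)] by (simp add: dot_norm_neg)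
  qed
  define u where "u = 2 * g (1/2)"
  define e where "e = 2 * cnj u * g (\<i>/2)"
  have H: "1/2 \<in> hyp_plane" "\<i>/2 \<in> hyp_plane" by (simp_all add: hyp_plane_iff norm_divide)
  have u: "cmod u = 1" using nrm[OF H(1)] by (simp add: u_def norm_mult norm_divide)
  have uu: "u * cnj u = 1" using u complex_norm_square[of u] by simp
  have Re: "Re (cnj u * g z) = Re z" if "z \<in> hyp_plane" for z
    using inn[OF H(1) that] by (simp add: u_def inner_complex_def)
  have e1: "Re e = 0" using Re[OF H(2)] by (simp add: e_def)
  have "cmod e = 1" using nrm[OF H(2)] u by (simp add: e_def norm_mult norm_divide)
  then have e2: "\<bar>Im e\<bar> = 1" using e1 by (simp add: cmod_def)
  have Im: "Im e * Im (cnj u * g z) = Im z" if "z \<in> hyp_plane" for z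
  proof -
    have "Re (cnj e * (cnj u * g z)) = 2 * Re (cnj (g (\<i>/2)) * g z)"
    proof -
      have "cnj e * (cnj u * g z) = 2 * (cnj (g (\<i>/2)) * g z) * (u * cnj u)"
        by (simp add: e_def mult_ac)
      then have "cnj e * (cnj u * g z) = of_real 2 * (cnj (g (\<i>/2)) * g z)" by (simp add: uu)
      then show ?thesis by (simp only: Re_complex_of_real times_complex.sel(1) Im_complex_of_real mult_zero_left diff_zero)
    qed
    also have "\<dots> = Im z" using inn[OF H(2) that] by (simp add: inner_complex_def)
    finally show ?thesis using e1 by simp
  qed
  have gz: "g z = u * (cnj u * g z)" for z by (simp add: mult.assoc[symmetric] uu)
  from e2 have "Im e = 1 \<or> Im e = -1" by linarith
  then show ?thesis
  proof
    assume "Im e = 1"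
    then have "cnj u * g z = z" if "z \<in> hyp_plane" for z
      using Re[OF that] Im[OF that] by (simp add: complex_eq_iff)
    then show ?thesis using that[of u] u gz by metis
  next
    assume "Im e = -1"
    then have "cnj u * g z = cnj z" if "z \<in> hyp_plane" for z
      using Re[OF that] Im[OF that] by (simp add: complex_eq_iff)
    then show ?thesis using that[of u] u gz by metis
  qed
qed

text \<open>Moving the image of the centre back to the centre reduces to isometries fixing the centre. What
  matters about the explicit form is that it is continuous.\<close>

lemma isometry_form:
  assumes g: "hyp_isometry g"
  obtains u a where "cmod u = 1" "a \<in> hyp_plane"
    "(\<forall>z\<in>hyp_plane. g z = Mob a (u * z)) \<or> (\<forall>z\<in>hyp_plane. g z = Mob a (u * cnj z))"
proof -
  let ?b = "g 0"
  have b: "?b \<in> hyp_plane" using g by (simp add: hyp_isometry_in)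
  have "hyp_isometry (Mob ?b \<circ> g)" using g b by (intro hyp_isometry_compose hyp_isometry_Mob)
  then obtain u where u: "cmod u = 1"
    "(\<forall>z\<in>hyp_plane. (Mob ?b \<circ> g) z = u * z) \<or> (\<forall>z\<in>hyp_plane. (Mob ?b \<circ> g) z = u * cnj z)"
    by (rule isometry_fixing_0) auto
  have "g z = Mob (- ?b) ((Mob ?b \<circ> g) z)" if "z \<in> hyp_plane" for z
    using Mob_inverse b hyp_isometry_in[OF g that] by simp
  then show ?thesis using that[of u "- ?b"] u b by (metis minus_in_hyp_plane)
qed

lemma continuous_on_Mob: "a \<in> hyp_plane \<Longrightarrow> continuous_on hyp_plane (Mob a)"
  unfolding Mob_def using Mob_denom by (intro continuous_intros) auto

lemma hyp_isometry_continuous: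
  assumes "hyp_isometry g"
  shows "continuous_on hyp_plane g"
proof -
  obtain u a where ua: "cmod u = 1" "a \<in> hyp_plane"
    "(\<forall>z\<in>hyp_plane. g z = Mob a (u * z)) \<or> (\<forall>z\<in>hyp_plane. g z = Mob a (u * cnj z))"
    using isometry_form[OF assms] by blast
  have c: "continuous_on hyp_plane (\<lambda>z. Mob a (h z))"
    if "continuous_on hyp_plane h" "\<And>z. z \<in> hyp_plane \<Longrightarrow> h z \<in> hyp_plane" for h
    by (rule continuous_on_compose2[OF continuous_on_Mob[OF ua(2)] that(1)]) (use that in auto)
  have "continuous_on hyp_plane (\<lambda>z. Mob a (u * z))" "continuous_on hyp_plane (\<lambda>z. Mob a (u * cnj z))"
    by (rule c; (intro continuous_intros)?; use ua(1) in \<open>simp add: hyp_plane_iff norm_mult\<close>)+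
  with ua(3) show ?thesis by (auto cong: continuous_on_cong)
qed


section \<open>Lorentz coordinates and geodesic segments\<close>

text \<open>The isometries act on hyperboloid coordinates by linear maps. This lemma and the next one give the
  linear map of \<open>Mob a\<close>.\<close>

lemma hT_Mob:
  assumes "a \<in> hyp_plane" "z \<in> hyp_plane"
  shows "hT (Mob a z) = hT a * hT z - Re (hX a * cnj (hX z))"
  using cosh_hyp_dist[OF assms] cosh_hyp_dist[OF zero_in_hyp_plane Mob_in[OF assms]]
    Mob_dist[OF assms(1) assms(1) assms(2)] by simp

lemma hX_Mob:
  assumes "a \<in> hyp_plane" "z \<in> hyp_plane"
  shows "hX (Mob a z) = (hX z + a\<^sup>2 * cnj (hX z) - 2 * a * of_real (hT z)) / of_real (1 - (cmod a)\<^sup>2)"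
proof -
  define A where "A = 1 - a * cnj a"
  define B where "B = 1 - z * cnj z"
  define C where "C = 1 - cnj a * z"
  have C: "C \<noteq> 0" using Mob_denom[OF assms] by (simp add: C_def)
  have A: "of_real (1 - (cmod a)\<^sup>2) = A" and B: "of_real (1 - (cmod z)\<^sup>2) = B"
    using complex_norm_square[of a] complex_norm_square[of z] by (simp_all add: A_def B_def)
  have nz: "A \<noteq> 0" "B \<noteq> 0"
    using A B one_minus_cmod2_pos assms by (metis less_irrefl of_real_eq_0_iff)+
  have CC: "of_real ((cmod C)\<^sup>2) = C * cnj C" using complex_norm_square[of C] by simp
  have T: "of_real (hT z) = (1 + z * cnj z) / B"
    unfolding hT_def using complex_norm_square[of z] B by simp
  have Z: "hX z = 2 * z / B" unfolding hX_def B ..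
  have cB: "cnj B = B" by (simp add: B_def mult.commute)
  have "hX (Mob a z) = 2 * ((z - a) / C) / (A * B / (C * cnj C))"
    unfolding hX_def cmod_Mob[OF assms] of_real_divide of_real_mult A B
    unfolding Mob_def C_def[symmetric] CC ..
  also have "\<dots> = 2 * (z - a) * cnj C / (A * B)" using C nz by (simp add: divide_simps)
  also have "\<dots> = (2 * z / B + a\<^sup>2 * cnj (2 * z / B) - 2 * a * ((1 + z * cnj z) / B)) / A"
    using nz by (simp add: cB C_def divide_simps) (simp add: algebra_simps power2_eq_square)
  finally show ?thesis unfolding A T Z .
qed

text \<open>Linear dependence of Lorentz vectors. It is invariant under isometries, while the Euclidean
  position of the points is not.\<close>

definition lorentz_comb :: "real \<Rightarrow> real \<Rightarrow> complex \<Rightarrow> complex \<Rightarrow> complex \<Rightarrow> bool" where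
  "lorentz_comb s t a b z \<longleftrightarrow> hT z = s * hT a + t * hT b \<and> hX z = of_real s * hX a + of_real t * hX b"

lemma lorentz_comb_Mob:
  assumes "c \<in> hyp_plane" "a \<in> hyp_plane" "b \<in> hyp_plane" "z \<in> hyp_plane" "lorentz_comb s t a b z"
  shows "lorentz_comb s t (Mob c a) (Mob c b) (Mob c z)"
  using assms(5) unfolding lorentz_comb_def
  by (simp add: hT_Mob hX_Mob assms algebra_simps add_divide_distrib diff_divide_distrib)

text \<open>For \<open>x\<close> between the centre and \<open>b\<close> the defining equation says that the hyperbolic cosine of
  \<open>hyp_dist x b\<close> is that of a difference; by the addition theorem this is equality in the
  Cauchy-Schwarz inequality.\<close>

lemma geodesic_segment_0:
  assumes b: "b \<in> hyp_plane"
  shows "geodesic_segment 0 b = closed_segment 0 b"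
proof -
  have mono: "hyp_dist 0 x \<le> hyp_dist 0 y \<longleftrightarrow> cmod x \<le> cmod y"
    if "x \<in> hyp_plane" "y \<in> hyp_plane" for x y
  proof -
    have p: "0 < 1 - (cmod x)\<^sup>2" "0 < 1 - (cmod y)\<^sup>2" using that one_minus_cmod2_pos by auto
    have "hyp_dist 0 x \<le> hyp_dist 0 y \<longleftrightarrow> cosh (hyp_dist 0 x) \<le> cosh (hyp_dist 0 y)"
      using hyp_dist_nonneg that by (simp add: cosh_real_nonneg_le_iff)
    also have "\<dots> \<longleftrightarrow> hT x \<le> hT y" using that by (simp add: cosh_hyp_dist)
    also have "\<dots> \<longleftrightarrow> (cmod x)\<^sup>2 \<le> (cmod y)\<^sup>2" unfolding hT_def using p
      by (simp add: divide_simps) (simp add: algebra_simps)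
    finally show ?thesis by (simp add: abs_le_square_iff[symmetric])
  qed
  have sinh: "sinh (hyp_dist 0 x) = cmod (hX x)" if "x \<in> hyp_plane" for x
  proof -
    have "(sinh (hyp_dist 0 x))\<^sup>2 = (cmod (hX x))\<^sup>2"
      using cosh_hyp_dist[OF zero_in_hyp_plane that] hT_hX_unit[OF that]
      by (simp add: sinh_square_eq)
    then show ?thesis using hyp_dist_nonneg[OF zero_in_hyp_plane that]
      by (simp add: power2_eq_iff_nonneg)
  qed
  have "x \<in> geodesic_segment 0 b \<longleftrightarrow> cmod x \<le> cmod b \<and> inner x b = cmod x * cmod b" (is "?l \<longleftrightarrow> ?r")
    if x: "x \<in> hyp_plane" for x
  proof -
    let ?u = "hyp_dist 0 x" and ?v = "hyp_dist 0 b" and ?w = "hyp_dist x b"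
    have p: "0 < 1 - (cmod x)\<^sup>2" "0 < 1 - (cmod b)\<^sup>2" using x b one_minus_cmod2_pos by auto
    have w: "0 \<le> ?w" using hyp_dist_nonneg x b by blast
    have hX: "cmod (hX y) = 2 * cmod y / (1 - (cmod y)\<^sup>2)" if "0 < 1 - (cmod y)\<^sup>2" for y
      unfolding hX_def norm_divide norm_of_real norm_mult using that by simp
    have "?w = ?v - ?u \<longleftrightarrow> inner x b = cmod x * cmod b" if "?u \<le> ?v"
    proof -
      have "?w = ?v - ?u \<longleftrightarrow> cosh ?w = cosh (?v - ?u)"
        using that w by (metis arcosh_cosh_real diff_ge_0_iff_ge)
      also have "\<dots> \<longleftrightarrow> Re (hX x * cnj (hX b)) = cmod (hX b) * cmod (hX x)"
        unfolding cosh_diff cosh_hyp_dist[OF x b] sinh[OF x] sinh[OF b]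
        using cosh_hyp_dist[OF zero_in_hyp_plane x] cosh_hyp_dist[OF zero_in_hyp_plane b] by auto
      also have "\<dots> \<longleftrightarrow> inner x b = cmod x * cmod b"
      proof -
        define c where "c = 4 / ((1 - (cmod x)\<^sup>2) * (1 - (cmod b)\<^sup>2))"
        have "c \<noteq> 0" using p by (simp add: c_def)
        moreover have "Re (hX x * cnj (hX b)) = c * inner x b"
          using p by (simp add: hX_Re hX_Im inner_complex_def c_def divide_simps)
        moreover have "cmod (hX b) * cmod (hX x) = c * (cmod x * cmod b)"
          using p by (simp add: hX c_def mult.commute)
        ultimately show ?thesis by simp
      qed
      finally show ?thesis .
    qed
    moreover have "?l \<longleftrightarrow> ?u \<le> ?v \<and> ?w = ?v - ?u"
      unfolding geodesic_segment_def using x w by auto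
    ultimately show ?thesis using mono[OF x b] by blast
  qed
  note main = this
  have cs: "closed_segment 0 b \<subseteq> hyp_plane"
    using b convex_ball unfolding hyp_plane_def by (intro closed_segment_subset) auto
  show ?thesis
  proof (intro equalityI subsetI)
    fix x assume x: "x \<in> geodesic_segment 0 b"
    then have xD: "x \<in> hyp_plane" by (simp add: geodesic_segment_def)
    have le: "cmod x \<le> cmod b" and eq: "inner x b = cmod x * cmod b" using main[OF xD] x by auto
    from eq have e: "cmod x *\<^sub>R b = cmod b *\<^sub>R x" by (simp add: norm_cauchy_schwarz_eq)
    show "x \<in> closed_segment 0 b"
    proof (cases "b = 0")
      case True then show ?thesis using le by simp
    next
      case False
      then have "x = (cmod x / cmod b) *\<^sub>R b" using e
        by (metis divide_inverse_commute norm_eq_zero scaleR_one scaleR_scaleR right_inverse mult.commute)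
      then show ?thesis unfolding in_segment using le False
        by (intro exI[of _ "cmod x / cmod b"]) (simp add: divide_simps)
    qed
  next
    fix x assume x: "x \<in> closed_segment 0 b"
    then obtain u where u: "x = u *\<^sub>R b" "0 \<le> u" "u \<le> 1" unfolding in_segment by auto
    have "cmod x \<le> cmod b" using u by (simp add: mult_left_le_one_le)
    moreover have "inner x b = cmod x * cmod b" using u by (simp add: power2_norm_eq_inner[symmetric] power2_eq_square)
    ultimately show "x \<in> geodesic_segment 0 b" using main[of x] x cs by blast
  qed
qed

lemma geodesic_segment_subset: "geodesic_segment a b \<subseteq> hyp_plane"
  by (auto simp: geodesic_segment_def)

lemma geodesic_segment_isometry:
  assumes g: "hyp_isometry g" and a: "a \<in> hyp_plane" and b: "b \<in> hyp_plane"
  shows "geodesic_segment (g a) (g b) = g ` geodesic_segment a b"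
proof -
  have "g x \<in> geodesic_segment (g a) (g b) \<longleftrightarrow> x \<in> geodesic_segment a b" if "x \<in> hyp_plane" for x
    unfolding geodesic_segment_def using that hyp_isometry_in[OF g] hyp_isometry_dist[OF g] a b by auto
  note iff = this
  show ?thesis
  proof (intro equalityI subsetI)
    fix y assume y: "y \<in> geodesic_segment (g a) (g b)"
    then have "y \<in> g ` hyp_plane"
      using g geodesic_segment_subset by (auto simp: hyp_isometry_def bij_betw_def)
    then show "y \<in> g ` geodesic_segment a b" using iff y by (auto intro: imageI)
  next
    fix y assume "y \<in> g ` geodesic_segment a b"
    then show "y \<in> geodesic_segment (g a) (g b)"
      using iff subsetD[OF geodesic_segment_subset, of _ a b] by auto
  qed
qed

text \<open>The linear description of geodesic segments. Moving \<open>a\<close> to the centre reduces it to radial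
  segments, where it is a computation with one real parameter; linearity of the isometries carries
  it back.\<close>

lemma geodesic_segment_iff_lorentz:
  assumes a: "a \<in> hyp_plane" and b: "b \<in> hyp_plane" and z: "z \<in> hyp_plane"
  shows "z \<in> geodesic_segment a b \<longleftrightarrow> (\<exists>s t. 0 \<le> s \<and> 0 \<le> t \<and> lorentz_comb s t a b z)"
proof -
  let ?z = "Mob a z" and ?b = "Mob a b"
  have D: "?z \<in> hyp_plane" "?b \<in> hyp_plane" using a b z Mob_in by auto
  note iso = hyp_isometry_Mob[OF a]
  have "z \<in> geodesic_segment a b \<longleftrightarrow> ?z \<in> geodesic_segment 0 ?b"
    using geodesic_segment_isometry[OF iso a b] geodesic_segment_subset[of a b] z
    by (auto simp: hyp_isometry_eq_iff[OF iso] subset_eq)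
  also have "\<dots> \<longleftrightarrow> (\<exists>s t. 0 \<le> s \<and> 0 \<le> t \<and> lorentz_comb s t 0 ?b ?z)"
  proof
    assume "?z \<in> geodesic_segment 0 ?b"
    then obtain u where u: "?z = of_real u * ?b" "0 \<le> u" "u \<le> 1"
      unfolding geodesic_segment_0[OF D(2)] in_segment by (auto simp: scaleR_conv_of_real)
    have p: "0 < 1 - (cmod ?z)\<^sup>2" "0 < 1 - (cmod ?b)\<^sup>2" using D one_minus_cmod2_pos by auto
    define t where "t = u * (1 - (cmod ?b)\<^sup>2) / (1 - (cmod ?z)\<^sup>2)"
    have t0: "0 \<le> t" using u p by (simp add: t_def)
    have c: "hX ?z = of_real t * hX ?b"
      unfolding complex_eq_iff using p by (simp add: hX_Re hX_Im t_def u(1))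
    have zb: "(cmod ?z)\<^sup>2 \<le> (cmod ?b)\<^sup>2"
      using u by (simp add: norm_mult mult_left_le_one_le)
    have t1: "t \<le> 1"
    proof -
      have "u * (1 - (cmod ?b)\<^sup>2) \<le> 1 * (1 - (cmod ?b)\<^sup>2)" using u p by (intro mult_right_mono) auto
      also have "\<dots> \<le> 1 - (cmod ?z)\<^sup>2" using zb by simp
      finally have "u * (1 - (cmod ?b)\<^sup>2) \<le> 1 - (cmod ?z)\<^sup>2" .
      then show ?thesis using p by (simp add: t_def)
    qed
    have "t * hT ?b \<le> hT ?z"
    proof (rule power2_le_imp_le)
      have "(t * hT ?b)\<^sup>2 = t\<^sup>2 + (cmod (hX ?z))\<^sup>2"
        using t0 by (simp add: power_mult_distrib hT_hX_unit[OF D(2)] c norm_mult algebra_simps)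
      also have "t\<^sup>2 \<le> 1" using t0 t1 by (simp add: power_le_one)
      finally show "(t * hT ?b)\<^sup>2 \<le> (hT ?z)\<^sup>2" by (simp add: hT_hX_unit[OF D(1)])
      show "0 \<le> hT ?z" using hT_ge_1[OF D(1)] by simp
    qed
    then show "\<exists>s t. 0 \<le> s \<and> 0 \<le> t \<and> lorentz_comb s t 0 ?b ?z"
      using t0 c by (intro exI[of _ "hT ?z - t * hT ?b"] exI[of _ t]) (simp add: lorentz_comb_def)
  next
    assume "\<exists>s t. 0 \<le> s \<and> 0 \<le> t \<and> lorentz_comb s t 0 ?b ?z"
    then obtain s t where st: "0 \<le> s" "0 \<le> t" "hT ?z = s + t * hT ?b" "hX ?z = of_real t * hX ?b"
      by (auto simp: lorentz_comb_def)
    have p: "0 < 1 - (cmod ?z)\<^sup>2" "0 < 1 - (cmod ?b)\<^sup>2" using D one_minus_cmod2_pos by auto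
    have "(s + t * hT ?b)\<^sup>2 = 1 + t\<^sup>2 * (cmod (hX ?b))\<^sup>2"
      using hT_hX_unit[OF D(1)] st by (simp add: norm_mult power_mult_distrib)
    then have "s\<^sup>2 + 2 * s * t * hT ?b + t\<^sup>2 = 1"
      using hT_hX_unit[OF D(2)] by (simp add: power2_sum power_mult_distrib algebra_simps)
    moreover have "0 \<le> 2 * s * t * hT ?b" using st hT_ge_1[OF D(2)] by simp
    ultimately have "t\<^sup>2 \<le> 1" using zero_le_power2[of s] by linarith
    then have t1: "t \<le> 1" by (simp add: abs_square_le_1)
    define u where "u = t * (1 - (cmod ?z)\<^sup>2) / (1 - (cmod ?b)\<^sup>2)"
    have u0: "0 \<le> u" using st p by (simp add: u_def)
    have zu: "?z = of_real u * ?b"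
    proof -
      have "Re (hX ?z) = t * Re (hX ?b)" "Im (hX ?z) = t * Im (hX ?b)" using st by auto
      then show ?thesis unfolding hX_Re hX_Im complex_eq_iff using p by (simp add: u_def field_simps)
    qed
    have "cmod (hX ?z) \<le> cmod (hX ?b)" using st t1 by (simp add: norm_mult mult_left_le_one_le)
    then have "(hT ?z)\<^sup>2 \<le> (hT ?b)\<^sup>2" using hT_hX_unit[OF D(2)] hT_hX_unit[OF D(1)] by simp
    then have "hT ?z \<le> hT ?b" by (rule power2_le_imp_le) (use hT_ge_1[OF D(2)] in linarith)
    then have "(cmod ?z)\<^sup>2 \<le> (cmod ?b)\<^sup>2" unfolding hT_def using p
      by (simp add: divide_simps) (simp add: algebra_simps)
    then have "cmod ?z \<le> cmod ?b" by (simp add: abs_le_square_iff[symmetric])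
    moreover have "cmod ?z = u * cmod ?b" using u0 by (subst zu) (simp add: norm_mult)
    ultimately have "u * cmod ?b \<le> 1 * cmod ?b" by simp
    then have "?b = 0 \<or> u \<le> 1" by (metis mult_le_cancel_right norm_le_zero_iff not_le)
    then show "?z \<in> geodesic_segment 0 ?b"
      unfolding geodesic_segment_0[OF D(2)] in_segment
      using zu u0 by (auto simp: scaleR_conv_of_real)
  qed
  also have "\<dots> \<longleftrightarrow> (\<exists>s t. 0 \<le> s \<and> 0 \<le> t \<and> lorentz_comb s t a b z)"
    using lorentz_comb_Mob[OF a a b z] lorentz_comb_Mob[of "-a" 0 ?b ?z] D a
      Mob_inverse[OF a b] Mob_inverse[OF a z] Mob_at_0[of "-a"]
    by (metis Mob_self add.inverse_inverse minus_in_hyp_plane zero_in_hyp_plane)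
  finally show ?thesis .
qed

lemma compact_geodesic_segment:
  assumes "a \<in> hyp_plane" "b \<in> hyp_plane"
  shows "compact (geodesic_segment a b)"
proof -
  have a: "- a \<in> hyp_plane" using assms by simp
  have "geodesic_segment a b = Mob (- a) ` geodesic_segment 0 (Mob a b)"
    using geodesic_segment_isometry[OF hyp_isometry_Mob[OF a] zero_in_hyp_plane, of "Mob a b"]
      Mob_in assms Mob_inverse[OF assms] Mob_at_0[of "-a"] by simp
  moreover have "compact (geodesic_segment 0 (Mob a b))"
    using geodesic_segment_0[of "Mob a b"] Mob_in assms by simp
  ultimately show ?thesis
    using continuous_on_subset[OF continuous_on_Mob[OF a] geodesic_segment_subset]
      compact_continuous_image by metis
qed

lemma geodesic_segment_endpoints:
  "a \<in> hyp_plane \<Longrightarrow> b \<in> hyp_plane \<Longrightarrow> a \<in> geodesic_segment a b \<and> b \<in> geodesic_segment a b"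
  by (simp add: geodesic_segment_def hyp_dist_def)

text \<open>Every future timelike vector is a positive multiple of a point of the hyperboloid. This is how
  points are constructed from linear data: midpoints, crossing points and centres of mass.\<close>

lemma timelike_direction:
  fixes T :: real and Z :: complex
  assumes "cmod Z < T"
  obtains z k where "z \<in> hyp_plane" "0 < k" "T = k * hT z" "Z = of_real k * hX z"
proof -
  define k where "k = sqrt (T\<^sup>2 - (cmod Z)\<^sup>2)"
  have T: "0 < T" using assms norm_ge_zero[of Z] by linarith
  have "(cmod Z)\<^sup>2 < T\<^sup>2" using assms by (simp add: power_strict_mono)
  then have k: "0 < k" "k\<^sup>2 = T\<^sup>2 - (cmod Z)\<^sup>2" by (auto simp: k_def)
  define z where "z = Z / of_real (T + k)"
  have nz: "(cmod z)\<^sup>2 = (T - k) / (T + k)"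
  proof -
    have "(cmod z)\<^sup>2 = (cmod Z)\<^sup>2 / (T + k)\<^sup>2"
      unfolding z_def norm_divide power_divide norm_of_real using T k by simp
    also have "(cmod Z)\<^sup>2 = (T - k) * (T + k)" using k by (simp add: power2_eq_square algebra_simps)
    finally show ?thesis using T k by (simp add: power2_eq_square)
  qed
  have z: "1 - (cmod z)\<^sup>2 = 2 * k / (T + k)" using T k by (simp add: nz field_simps)
  have zD: "z \<in> hyp_plane"
  proof -
    have "0 < 1 - (cmod z)\<^sup>2" unfolding z using T k by simp
    then show ?thesis by (simp add: hyp_plane_iff power_less_one_iff)
  qed
  have "T = k * hT z" unfolding hT_def z nz using T k by (simp add: divide_simps)
  moreover have "Z = of_real k * hX z"
    unfolding hX_def z using T k by (simp add: z_def complex_eq_iff Re_divide_of_real Im_divide_of_real)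
  ultimately show ?thesis using that zD k by blast
qed


section \<open>Polygons under isometries\<close>

lemma open_hyp_plane: "open hyp_plane"
  by (simp add: hyp_plane_def)

lemma compact_in_smaller_disc:
  assumes "compact S" "S \<subseteq> hyp_plane"
  obtains r where "r < 1" "S \<subseteq> cball 0 r"
proof (cases "S = {}")
  case True then show ?thesis using that[of 0] by simp
next
  case False
  have "continuous_on S cmod" by (intro continuous_intros)
  then obtain x where x: "x \<in> S" "\<And>y. y \<in> S \<Longrightarrow> cmod y \<le> cmod x"
    using continuous_attains_sup[OF assms(1) False] by blast
  show ?thesis
    by (rule that[of "cmod x"]) (use x assms in \<open>auto simp: hyp_plane_iff dist_norm\<close>)
qed

lemma inside_subset_hyp_plane:
  assumes "S \<subseteq> hyp_plane" shows "inside S \<subseteq> hyp_plane"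
  using outside_subset_convex[of "hyp_plane" S] assms inside_Int_outside[of S]
  unfolding hyp_plane_def by blast

text \<open>\<^const>\<open>inside\<close> is defined by components of the complement in the whole complex plane, on which
  isometries of the disc do not act. For a compact set in the disc it can be expressed by components
  inside the disc: boundedness becomes containment in a compact subset of the disc, and this
  condition is invariant under homeomorphisms of the disc.\<close>

lemma inside_iff_component_in_compact:
  assumes S: "compact S" "S \<subseteq> hyp_plane" and x: "x \<in> hyp_plane - S"
  shows "x \<in> inside S \<longleftrightarrow>
    (\<exists>K. compact K \<and> K \<subseteq> hyp_plane \<and> connected_component_set (hyp_plane - S) x \<subseteq> K)"
proof
  assume xi: "x \<in> inside S"
  obtain r where r: "r < 1" "S \<subseteq> cball 0 r" using compact_in_smaller_disc[OF S] .
  have "inside S \<subseteq> cball 0 r"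
    using outside_subset_convex[OF convex_cball r(2)] inside_Int_outside[of S] by blast
  moreover have "connected_component_set (hyp_plane - S) x \<subseteq> inside S"
  proof
    fix y assume "y \<in> connected_component_set (hyp_plane - S) x"
    then have "connected_component (- S) x y"
      using connected_component_of_subset[of "hyp_plane - S" x y "- S"] by auto
    then show "y \<in> inside S" using inside_same_component xi by metis
  qed
  moreover have "cball (0::complex) r \<subseteq> hyp_plane" using r by (auto simp: hyp_plane_iff)
  ultimately show "\<exists>K. compact K \<and> K \<subseteq> hyp_plane \<and> connected_component_set (hyp_plane - S) x \<subseteq> K"
    by (intro exI[of _ "cball 0 r"]) auto
next
  let ?W = "connected_component_set (hyp_plane - S) x"
  let ?U = "connected_component_set (- S) x"
  assume "\<exists>K. compact K \<and> K \<subseteq> hyp_plane \<and> ?W \<subseteq> K"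
  then obtain K where K: "compact K" "K \<subseteq> hyp_plane" "?W \<subseteq> K" by blast
  \<comment> \<open>The component \<open>?W\<close> in the disc is also relatively closed in the complement of \<open>S\<close>, because it
    stays in the compact \<open>K\<close>; so it is the whole component \<open>?U\<close>.\<close>
  have oD: "open (hyp_plane - S)" using S open_hyp_plane compact_imp_closed by blast
  have oW: "open ?W" by (rule open_connected_component[OF oD])
  have "openin (top_of_set (hyp_plane - S)) (hyp_plane - S - ?W)"
    using openin_diff[OF openin_subtopology_self closedin_connected_component[of "hyp_plane - S" x]] .
  then have oV: "open (hyp_plane - S - ?W)" using oD openin_open_eq by blast
  have oK: "open (- K)" using K compact_imp_closed by auto
  have "?U \<subseteq> ?W \<union> ((hyp_plane - S - ?W) \<union> - K)"
    using K connected_component_subset[of "- S" x] by blast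
  moreover have "?W \<inter> ((hyp_plane - S - ?W) \<union> - K) = {}" using K by blast
  moreover have "x \<in> ?W \<inter> ?U" using x by simp
  ultimately have "((hyp_plane - S - ?W) \<union> - K) \<inter> ?U = {}"
    using connectedD[OF connected_connected_component[of "- S" x] oW open_Un[OF oV oK]] by blast
  with \<open>?U \<subseteq> ?W \<union> _\<close> have "?U \<subseteq> K" using K by blast
  then have "bounded ?U" using K compact_imp_bounded bounded_subset by blast
  then show "x \<in> inside S" using x by (simp add: inside_def)
qed

lemma inside_isometry_subset:
  assumes g: "hyp_isometry g" and S: "compact S" "S \<subseteq> hyp_plane"
  shows "g ` inside S \<subseteq> inside (g ` S)"
proof
  obtain h where h: "hyp_isometry h" "\<And>z. z \<in> hyp_plane \<Longrightarrow> h (g z) = z"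
    "\<And>z. z \<in> hyp_plane \<Longrightarrow> g (h z) = z" using hyp_isometry_inverse[OF g] by metis
  note cg = hyp_isometry_continuous[OF g] and ch = hyp_isometry_continuous[OF h(1)]
  fix y assume "y \<in> g ` inside S"
  then obtain x where x: "x \<in> inside S" "y = g x" by blast
  have xD: "x \<in> hyp_plane - S" using x inside_subset_hyp_plane[OF S(2)] inside_no_overlap[of S] by blast
  have gS: "compact (g ` S)" "g ` S \<subseteq> hyp_plane"
    using S cg hyp_isometry_in[OF g] by (auto intro: compact_continuous_image continuous_on_subset)
  have *: "g z \<in> hyp_plane - g ` S" if "z \<in> hyp_plane - S" for z
    using that hyp_isometry_in[OF g] hyp_isometry_eq_iff[OF g] S by blast
  have **: "h z \<in> hyp_plane - S" if "z \<in> hyp_plane - g ` S" for z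
    using that hyp_isometry_in[OF h(1)] h(3)[of z] by (metis Diff_iff imageI)
  have "homeomorphism (hyp_plane - S) (hyp_plane - g ` S) g h"
    unfolding homeomorphism_def
    using * ** h cg ch
    by (auto intro: continuous_on_subset simp: image_iff) (metis Diff_iff image_iff)+
  then have C: "connected_component_set (hyp_plane - g ` S) (g x)
      = g ` connected_component_set (hyp_plane - S) x"
    using connected_component_set_homeomorphism xD by blast
  obtain K where K: "compact K" "K \<subseteq> hyp_plane" "connected_component_set (hyp_plane - S) x \<subseteq> K"
    using inside_iff_component_in_compact[OF S xD] x by blast
  have "compact (g ` K)" "g ` K \<subseteq> hyp_plane"
    using K cg hyp_isometry_in[OF g] by (auto intro: compact_continuous_image continuous_on_subset)
  then show "y \<in> inside (g ` S)"
    unfolding x(2) inside_iff_component_in_compact[OF gS *[OF xD]] C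
    using K(3) by (intro exI[of _ "g ` K"]) (simp add: image_mono)
qed

lemma inside_isometry:
  assumes g: "hyp_isometry g" and S: "compact S" "S \<subseteq> hyp_plane"
  shows "inside (g ` S) = g ` inside S"
proof
  obtain h where h: "hyp_isometry h" "\<And>z. z \<in> hyp_plane \<Longrightarrow> h (g z) = z"
    "\<And>z. z \<in> hyp_plane \<Longrightarrow> g (h z) = z" using hyp_isometry_inverse[OF g] by metis
  have gS: "compact (g ` S)" "g ` S \<subseteq> hyp_plane"
    using S hyp_isometry_continuous[OF g] hyp_isometry_in[OF g]
    by (auto intro: compact_continuous_image continuous_on_subset)
  have "h ` g ` S = S" using h(2) S by (force simp: image_iff)
  then have "h ` inside (g ` S) \<subseteq> inside S" using inside_isometry_subset[OF h(1) gS] by simp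
  then show "inside (g ` S) \<subseteq> g ` inside S"
  proof (intro subsetI)
    fix y assume "h ` inside (g ` S) \<subseteq> inside S" and y: "y \<in> inside (g ` S)"
    then have "h y \<in> inside S" by blast
    moreover have "y = g (h y)" using h(3) y inside_subset_hyp_plane[OF gS(2)] by auto
    ultimately show "y \<in> g ` inside S" by blast
  qed
qed (rule inside_isometry_subset[OF assms])

lemma nth_Suc_mod_in:
  "set vs \<subseteq> hyp_plane \<Longrightarrow> i < length vs \<Longrightarrow> vs ! i \<in> hyp_plane \<and> vs ! (Suc i mod length vs) \<in> hyp_plane"
  by (metis bot_nat_0.not_eq_extremum less_nat_zero_code mod_less_divisor nth_mem subsetD)

lemma side_isometry:
  assumes "hyp_isometry g" "set vs \<subseteq> hyp_plane" "i < length vs"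
  shows "side (map g vs) i = g ` side vs i"
proof -
  have "Suc i mod length vs < length vs" using assms(3) by (intro mod_less_divisor) auto
  then show ?thesis unfolding side_def
    using geodesic_segment_isometry[OF assms(1)] nth_Suc_mod_in[OF assms(2,3)] assms(3) by simp
qed

lemma side_subset: "side vs i \<subseteq> hyp_plane"
  by (simp add: side_def geodesic_segment_subset)

lemma compact_side: "set vs \<subseteq> hyp_plane \<Longrightarrow> i < length vs \<Longrightarrow> compact (side vs i)"
  unfolding side_def using compact_geodesic_segment nth_Suc_mod_in by blast

lemma circuit_points_subset: "circuit_points vs \<subseteq> hyp_plane"
  unfolding circuit_points_def using side_subset by blast

lemma compact_circuit_points: "set vs \<subseteq> hyp_plane \<Longrightarrow> compact (circuit_points vs)"
  unfolding circuit_points_def using compact_side by (intro compact_UN) auto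

lemma circuit_points_isometry:
  assumes "hyp_isometry g" "set vs \<subseteq> hyp_plane"
  shows "circuit_points (map g vs) = g ` circuit_points vs"
  unfolding circuit_points_def using side_isometry[OF assms] by (auto simp: image_UN)

lemma polygon_of_isometry:
  assumes "hyp_isometry g" "set vs \<subseteq> hyp_plane"
  shows "polygon_of (map g vs) = g ` polygon_of vs"
  unfolding polygon_of_def circuit_points_isometry[OF assms]
  using inside_isometry[OF assms(1) compact_circuit_points circuit_points_subset] assms
  by (simp add: image_Un)

lemma polygon_of_subset: "polygon_of vs \<subseteq> hyp_plane"
  unfolding polygon_of_def using circuit_points_subset inside_subset_hyp_plane by blast

lemma polygonal_circuit_subset: "polygonal_circuit vs \<Longrightarrow> set vs \<subseteq> hyp_plane"
  by (simp add: polygonal_circuit_def)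

text \<open>All notions of the definition of a polygon are metric or topological, so isometries preserve them;
  this lemma and the following ones record it for circuits, vertices, edges and angles.\<close>

lemma polygonal_circuit_isometry:
  assumes g: "hyp_isometry g" and vs: "polygonal_circuit vs"
  shows "polygonal_circuit (map g vs)"
proof -
  let ?n = "length vs"
  have D: "set vs \<subseteq> hyp_plane" and n: "3 \<le> ?n" using vs by (auto simp: polygonal_circuit_def)
  have inj: "inj_on g hyp_plane" using g by (simp add: hyp_isometry_def bij_betw_def)
  have lt: "j mod ?n < ?n" for j using n by (intro mod_less_divisor) linarith
  have sI: "side (map g vs) i \<inter> side (map g vs) j = g ` (side vs i \<inter> side vs j)"
    if "i < ?n" "j < ?n" for i j
    using side_isometry[OF g D] that side_subset inj_on_image_Int[OF inj] by metis
  have "side (map g vs) i \<inter> side (map g vs) j \<subseteq>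
      {map g vs ! i, map g vs ! (Suc i mod ?n)} \<inter> {map g vs ! j, map g vs ! (Suc j mod ?n)}"
    if ij: "i < ?n" "j < ?n" "i \<noteq> j" for i j
  proof -
    have "side vs i \<inter> side vs j \<subseteq> {vs ! i, vs ! (Suc i mod ?n)} \<inter> {vs ! j, vs ! (Suc j mod ?n)}"
      using vs ij unfolding polygonal_circuit_def by blast
    then have "g ` (side vs i \<inter> side vs j) \<subseteq> g ` {vs ! i, vs ! (Suc i mod ?n)} \<inter> g ` {vs ! j, vs ! (Suc j mod ?n)}"
      by blast
    then show ?thesis unfolding sI[OF ij(1,2)] using ij lt by simp
  qed
  moreover have "map g vs ! (Suc i mod ?n) \<notin> geodesic_segment (map g vs ! i) (map g vs ! (Suc (Suc i) mod ?n))"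
    if i: "i < ?n" for i
  proof -
    have "vs ! (Suc i mod ?n) \<notin> geodesic_segment (vs ! i) (vs ! (Suc (Suc i) mod ?n))"
      using vs i unfolding polygonal_circuit_def by blast
    moreover have in': "vs ! (j mod ?n) \<in> hyp_plane" for j using D lt nth_mem by blast
    ultimately have "g (vs ! (Suc i mod ?n)) \<notin> g ` geodesic_segment (vs ! i) (vs ! (Suc (Suc i) mod ?n))"
      using inj_on_image_mem_iff[OF inj in' geodesic_segment_subset] by blast
    then show ?thesis
      using geodesic_segment_isometry[OF g, of "vs ! i" "vs ! (Suc (Suc i) mod ?n)"] in' lt i in'[of i]
      by (simp del: in' add: in'[of "Suc (Suc i)"])
  qed
  moreover have "distinct (map g vs)"
    using vs inj D by (auto simp: polygonal_circuit_def distinct_map intro: inj_on_subset)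
  ultimately show ?thesis unfolding polygonal_circuit_def
    using n D hyp_isometry_in[OF g] by auto
qed

lemma hyp_polygon_isometry: "hyp_isometry g \<Longrightarrow> hyp_polygon P \<Longrightarrow> hyp_polygon (g ` P)"
  unfolding hyp_polygon_def
  using polygonal_circuit_isometry polygon_of_isometry polygonal_circuit_subset by metis

lemma polygon_vertices_isometry:
  assumes "hyp_isometry g" "v \<in> polygon_vertices P"
  shows "g v \<in> polygon_vertices (g ` P)"
proof -
  obtain vs where "polygonal_circuit vs" "P = polygon_of vs" "v \<in> set vs"
    using assms(2) by (auto simp: polygon_vertices_def)
  then have "polygonal_circuit (map g vs) \<and> g ` P = polygon_of (map g vs) \<and> g v \<in> set (map g vs)"
    using assms(1) polygonal_circuit_isometry polygon_of_isometry polygonal_circuit_subset by simp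
  then show ?thesis unfolding polygon_vertices_def by blast
qed

lemma polygon_edges_isometry:
  assumes "hyp_isometry g" "e \<in> polygon_edges P"
  shows "g ` e \<in> polygon_edges (g ` P)"
proof -
  obtain vs i where "polygonal_circuit vs" "P = polygon_of vs" "i < length vs" "e = side vs i"
    using assms(2) by (auto simp: polygon_edges_def)
  then have "polygonal_circuit (map g vs) \<and> g ` P = polygon_of (map g vs) \<and>
      i < length (map g vs) \<and> g ` e = side (map g vs) i"
    using assms(1) polygonal_circuit_isometry polygon_of_isometry polygonal_circuit_subset side_isometry
    by simp
  then show ?thesis unfolding polygon_edges_def by blast
qed

lemma has_inner_angle_isometry:
  assumes h: "hyp_isometry h" and P: "P \<subseteq> hyp_plane" and a: "has_inner_angle P v \<theta>"
  shows "has_inner_angle (h ` P) (h v) \<theta>"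
proof -
  obtain g r where g: "hyp_isometry g" "g v = 0" "0 < r" "r < 1"
    "g ` P \<inter> ball 0 r = {of_real s * cis t | s t. 0 \<le> s \<and> s < r \<and> 0 \<le> t \<and> t \<le> \<theta>}"
    and v: "v \<in> hyp_plane" "0 < \<theta>" "\<theta> < 2 * pi"
    using a unfolding has_inner_angle_def by blast
  obtain k where k: "hyp_isometry k" "\<And>z. z \<in> hyp_plane \<Longrightarrow> k (h z) = z"
    using hyp_isometry_inverse[OF h] by metis
  have "(g \<circ> k) ` h ` P = g ` P" using k(2) P by (simp add: image_comp[symmetric] image_image subset_iff cong: image_cong)
  moreover have "hyp_isometry (g \<circ> k)" "(g \<circ> k) (h v) = 0"
    using hyp_isometry_compose g k v by auto
  moreover have "h v \<in> hyp_plane" using hyp_isometry_in h v by blast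
  ultimately show ?thesis unfolding has_inner_angle_def using g v
    by (intro conjI exI[of _ "g \<circ> k"] exI[of _ r]) simp_all
qed


section \<open>Reflection systems and Tits' lemma\<close>

text \<open>Words in the generators, acting by composition. Group elements are the resulting functions, so
  relations between words are equalities of functions.\<close>

fun act :: "('i \<Rightarrow> 'a \<Rightarrow> 'a) \<Rightarrow> 'i list \<Rightarrow> 'a \<Rightarrow> 'a" where
  "act r [] = id"
| "act r (s # ws) = r s \<circ> act r ws"

lemma act_append: "act r (xs @ ys) = act r xs \<circ> act r ys"
  by (induction xs) (auto simp: o_assoc)

text \<open>The alternating words \<open>s t s \<dots>\<close> of length \<open>k\<close>, which exhaust a dihedral group.\<close>

fun alt :: "('i \<Rightarrow> 'a \<Rightarrow> 'a) \<Rightarrow> 'i \<Rightarrow> 'i \<Rightarrow> nat \<Rightarrow> 'a \<Rightarrow> 'a" where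
  "alt r s t 0 = id"
| "alt r s t (Suc k) = r s \<circ> alt r t s k"

definition word_length :: "('i \<Rightarrow> 'a \<Rightarrow> 'a) \<Rightarrow> ('a \<Rightarrow> 'a) \<Rightarrow> nat" where
  "word_length r w = (LEAST n. \<exists>ws. length ws = n \<and> act r ws = w)"

text \<open>\<open>f s\<close> is a functional vanishing on the mirror of \<open>r s\<close> and positive on the side of the chamber; the
  rule \<open>f_other\<close> says that the mirrors of \<open>s\<close> and \<open>t\<close> make the angle \<open>pi / m s t\<close>. The group acts on
  \<open>X\<close>; outside \<open>X\<close> the generators are the identity, so that equality of group elements is equality
  of functions.\<close>

locale reflection_system =
  fixes r :: "'i \<Rightarrow> 'a \<Rightarrow> 'a" and f :: "'i \<Rightarrow> 'a \<Rightarrow> real" and m :: "'i \<Rightarrow> 'i \<Rightarrow> nat"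
    and X :: "'a set"
  assumes r_X: "x \<in> X \<Longrightarrow> r s x \<in> X"
    and r_outside: "x \<notin> X \<Longrightarrow> r s x = x"
    and separate: "x \<in> X \<Longrightarrow> y \<in> X \<Longrightarrow> (\<And>s. f s x = f s y) \<Longrightarrow> x = y"
    and f_self: "f s (r s x) = - f s x"
    and f_other: "s \<noteq> t \<Longrightarrow> f s (r t x) = f s x + 2 * cos (pi / m s t) * f t x"
    and m_ge_2: "s \<noteq> t \<Longrightarrow> 2 \<le> m s t"
    and m_sym: "m s t = m t s"
begin

lemma invol: "r s (r s x) = x"
proof (cases "x \<in> X")
  case True
  have "f t (r s (r s x)) = f t x" for t
    by (cases "t = s") (simp_all add: f_self f_other)
  then show ?thesis using separate[of "r s (r s x)" x] r_X True by blast
qed (simp add: r_outside)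

lemma mirror_fixed:
  assumes "f s x = 0" shows "r s x = x"
proof (cases "x \<in> X")
  case True
  have "f t (r s x) = f t x" for t
    using assms by (cases "t = s") (simp_all add: f_self f_other)
  then show ?thesis using separate[of "r s x" x] r_X True by blast
qed (simp add: r_outside)

lemma alt_X: "alt r s t k x \<in> X \<longleftrightarrow> x \<in> X"
proof -
  have "r s x \<in> X \<longleftrightarrow> x \<in> X" for s x using r_X r_outside by metis
  then show ?thesis by (induction k arbitrary: s t) simp_all
qed

text \<open>In polar coordinates for the pair \<open>(f s, f t)\<close> the two reflections are those of a sector of opening
  \<open>\<theta>\<close>, and an alternating word of length \<open>k\<close> carries the sector to the one between the angles \<open>k \<theta>\<close>
  and \<open>(k + 1) \<theta>\<close>. The parity of \<open>k\<close> decides whether the image is traversed forwards or backwards.\<close>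

lemma dihedral_coefficients:
  assumes "s \<noteq> t"
  defines "\<theta> \<equiv> pi / m s t"
  shows "sin \<theta> * f s (alt r t s k x) =
    (if even k then sin ((real k + 1) * \<theta>) * f s x + sin (real k * \<theta>) * f t x
     else sin ((real k + 1) * \<theta>) * f t x + sin (real k * \<theta>) * f s x)"
  using assms(1) unfolding \<theta>_def
proof (induction k arbitrary: s t rule: induct_nat_012)
  case 0
  then show ?case by simp
next
  case 1
  have "sin (2 * (pi / m s t)) = 2 * sin (pi / m s t) * cos (pi / m s t)" by (rule sin_double)
  then show ?case using f_other[OF 1] by (simp add: algebra_simps)
next
  case (ge2 k)
  define \<theta> where "\<theta> = pi / m s t"
  have \<theta>': "\<theta> = pi / m t s" by (simp add: \<theta>_def m_sym)
  have trig: "sin (a + \<theta>) = 2 * cos \<theta> * sin a - sin (a - \<theta>)" for a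
    by (simp add: sin_add sin_diff)
  have t2: "sin ((real (Suc (Suc k)) + 1) * \<theta>)
      = 2 * cos \<theta> * sin ((real (Suc k) + 1) * \<theta>) - sin ((real k + 1) * \<theta>)"
    using trig[of "(real (Suc k) + 1) * \<theta>"] by (simp add: algebra_simps)
  have t1: "sin (real (Suc (Suc k)) * \<theta>)
      = 2 * cos \<theta> * sin (real (Suc k) * \<theta>) - sin (real k * \<theta>)"
    using trig[of "real (Suc k) * \<theta>"] by (simp add: algebra_simps)
  have "f s (alt r t s (Suc (Suc k)) x) = - f s (alt r t s k x) + 2 * cos \<theta> * f t (alt r s t (Suc k) x)"
    using ge2.prems by (simp add: f_other f_self \<theta>_def)
  then have "sin \<theta> * f s (alt r t s (Suc (Suc k)) x)
    = - (sin \<theta> * f s (alt r t s k x)) + 2 * cos \<theta> * (sin \<theta> * f t (alt r s t (Suc k) x))"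
    by (simp only: distrib_left mult_minus_right mult_ac)
  also have "sin \<theta> * f s (alt r t s k x) =
    (if even k then sin ((real k + 1) * \<theta>) * f s x + sin (real k * \<theta>) * f t x
     else sin ((real k + 1) * \<theta>) * f t x + sin (real k * \<theta>) * f s x)"
    using ge2.IH(1)[OF ge2.prems] by (simp add: \<theta>_def)
  also have "sin \<theta> * f t (alt r s t (Suc k) x) =
    (if even (Suc k) then sin ((real (Suc k) + 1) * \<theta>) * f t x + sin (real (Suc k) * \<theta>) * f s x
     else sin ((real (Suc k) + 1) * \<theta>) * f s x + sin (real (Suc k) * \<theta>) * f t x)"
    using ge2.IH(2)[of t s] ge2.prems by (simp add: \<theta>')
  finally show ?case unfolding \<theta>_def[symmetric] t2 t1
    by (cases "even k") (simp_all add: algebra_simps)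
qed

lemma sin_dihedral: "s \<noteq> t \<Longrightarrow> 0 < sin (pi / m s t)"
  using m_ge_2[of s t] by (intro sin_gt_zero) (simp_all add: divide_simps)

lemma f_braid:
  assumes st: "s \<noteq> t"
  shows "f s (alt r s t (m s t) x) = f s (alt r t s (m s t) x)"
proof -
  define \<theta> where "\<theta> = pi / m s t"
  obtain k where k: "m s t = Suc k" using m_ge_2[OF st] by (cases "m s t") auto
  have mt: "real (Suc k) * \<theta> = pi" unfolding \<theta>_def k by simp
  \<comment> \<open>At full length the angle is a half turn, where the sines simplify.\<close>
  have s0: "sin (real (Suc k) * \<theta>) = 0" unfolding mt by simp
  have "(real (Suc k) + 1) * \<theta> = pi + \<theta>" "real k * \<theta> = pi - \<theta>" using mt by (simp_all add: algebra_simps)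
  then have s1: "sin ((real (Suc k) + 1) * \<theta>) = - sin \<theta>" "sin (real k * \<theta>) = sin \<theta>" by simp_all
  have s2: "sin ((real k + 1) * \<theta>) = 0" using s0 by (simp add: add.commute)
  have "sin \<theta> * f s (alt r t s (Suc k) x) = (if even k then - sin \<theta> * f t x else - sin \<theta> * f s x)"
    using dihedral_coefficients[OF st, of "Suc k" x] unfolding \<theta>_def[symmetric] s0 s1 by simp
  moreover have "sin \<theta> * f s (alt r t s k x) = (if even k then sin \<theta> * f t x else sin \<theta> * f s x)"
    using dihedral_coefficients[OF st, of k x] unfolding \<theta>_def[symmetric] s1 s2 by simp
  moreover have "f s (alt r s t (Suc k) x) = - f s (alt r t s k x)" by (simp add: f_self)
  ultimately have "sin \<theta> * f s (alt r s t (Suc k) x) = sin \<theta> * f s (alt r t s (Suc k) x)" by auto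
  then show ?thesis unfolding k using sin_dihedral[OF st] by (simp add: \<theta>_def)
qed

text \<open>The span of \<open>f s\<close> and \<open>f t\<close> is nondegenerate, so \<open>f u\<close> can be corrected by an element of that span to
  a functional that both reflections leave invariant. Hence the braid relation, which holds for
  \<open>f s\<close> and \<open>f t\<close> by the sine formula, holds for every coordinate.\<close>

lemma f_braid_third:
  assumes st: "s \<noteq> t" and u: "u \<noteq> s" "u \<noteq> t"
  shows "f u (alt r s t (m s t) x) = f u (alt r t s (m s t) x)"
proof -
  define c where "c = cos (pi / m s t)"
  define c1 where "c1 = cos (pi / m u s)"
  define c2 where "c2 = cos (pi / m u t)"
  define d where "d = 1 - c\<^sup>2"
  have d: "d \<noteq> 0" using sin_dihedral[OF st] by (simp add: d_def c_def cos_squared_eq)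
  \<comment> \<open>The coefficients solve the two linear equations that express invariance of \<open>h\<close>.\<close>
  define a where "a = (c1 + c * c2) / d"
  define b where "b = (c2 + c * c1) / d"
  have ab: "c1 - a + b * c = 0" "c2 - b + a * c = 0"
    using d by (simp_all add: a_def b_def divide_simps) (simp_all add: d_def algebra_simps power2_eq_square)
  define h where "h y = f u y + a * f s y + b * f t y" for y
  have ct: "cos (pi / m t s) = c" by (simp add: c_def m_sym)
  have hs: "h (r s y) = h y" for y
  proof -
    have "h (r s y) = h y + 2 * (c1 - a + b * c) * f s y"
      using f_other[OF u(1), of y] f_other[of t s y] st f_self[of s y] unfolding h_def ct c1_def[symmetric]
      by (simp add: algebra_simps)
    then show ?thesis by (simp add: ab)
  qed
  have ht: "h (r t y) = h y" for y
  proof -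
    have "h (r t y) = h y + 2 * (c2 - b + a * c) * f t y"
      using f_other[OF u(2), of y] f_other[of s t y] st f_self[of t y]
      unfolding h_def c_def[symmetric] c2_def[symmetric] by (simp add: algebra_simps)
    then show ?thesis by (simp add: ab)
  qed
  have "h (alt r s t k y) = h y \<and> h (alt r t s k y) = h y" for k y
    by (induction k) (simp_all add: hs ht)
  then have "h (alt r s t (m s t) x) = h (alt r t s (m s t) x)" by simp
  moreover have "f t (alt r s t (m s t) x) = f t (alt r t s (m s t) x)"
    using f_braid[of t s x] st by (simp add: m_sym)
  ultimately show ?thesis using f_braid[OF st, of x] by (simp add: h_def)
qed

lemma braid:
  assumes st: "s \<noteq> t" shows "alt r s t (m s t) = alt r t s (m s t)"
proof
  fix x
  show "alt r s t (m s t) x = alt r t s (m s t) x"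
  proof (cases "x \<in> X")
    case True
    have "f u (alt r s t (m s t) x) = f u (alt r t s (m s t) x)" for u
      using f_braid[OF st, of x] f_braid[of t s x] f_braid_third[OF st, of u x] st
      by (cases "u = s"; cases "u = t") (simp_all add: m_sym[of t s])
    then show ?thesis using separate alt_X True by blast
  next
    case False
    then have "alt r s t k x = x" for s t k by (induction k arbitrary: s t) (simp_all add: r_outside)
    then show ?thesis by simp
  qed
qed

definition W :: "('a \<Rightarrow> 'a) set" where "W = range (act r)"

abbreviation "len \<equiv> word_length r"

lemma W_act: "act r ws \<in> W"
  by (simp add: W_def)

lemma W_cases: assumes "w \<in> W" obtains ws where "w = act r ws"
  using assms by (auto simp: W_def)

lemma r_r [simp]: "r s \<circ> r s = id" "r s \<circ> (r s \<circ> w) = w"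
  by (auto simp: fun_eq_iff invol)

lemma W_comp: assumes "v \<in> W" "w \<in> W" shows "v \<circ> w \<in> W"
proof -
  obtain xs ys where "v = act r xs" "w = act r ys" using assms W_cases by metis
  then show ?thesis by (simp only: act_append[symmetric] W_act)
qed

lemma W_id: "id \<in> W"
  using W_act[of "[]"] by simp

lemma W_generator: "r s \<in> W"
  using W_act[of "[s]"] by simp

lemma W_r: "w \<in> W \<Longrightarrow> r s \<circ> w \<in> W"
  by (rule W_comp[OF W_generator])

lemma act_rev: "act r (rev ws) (act r ws x) = x" "act r ws (act r (rev ws) x) = x"
  by (induction ws arbitrary: x) (simp_all add: act_append invol)

lemma W_inverse:
  assumes "w \<in> W" obtains w' where "w' \<in> W" "\<And>x. w' (w x) = x" "\<And>x. w (w' x) = x"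
proof -
  obtain ws where "w = act r ws" using assms W_cases by metis
  then show ?thesis using that[of "act r (rev ws)"] W_act act_rev by simp
qed

lemma len_le: "len (act r ws) \<le> length ws"
  unfolding word_length_def by (rule Least_le) auto

lemma len_attained:
  assumes "w \<in> W" obtains ws where "act r ws = w" "length ws = len w"
proof -
  obtain ws where "act r ws = w" using assms W_cases by metis
  then have "\<exists>n ws'. length ws' = n \<and> act r ws' = w" by blast
  from LeastI_ex[OF this] obtain ws' where "length ws' = len w" "act r ws' = w"
    unfolding word_length_def by blast
  then show ?thesis using that by blast
qed

lemma len_r: "w \<in> W \<Longrightarrow> len (r s \<circ> w) \<le> Suc (len w)"
proof -
  assume "w \<in> W"
  then obtain ws where "act r ws = w" "length ws = len w" using len_attained by metis
  then show ?thesis using len_le[of "s # ws"] by simp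
qed

lemma len_alt: "w \<in> W \<Longrightarrow> len (alt r s t k \<circ> w) \<le> k + len w \<and> alt r s t k \<circ> w \<in> W"
proof (induction k arbitrary: s t)
  case (Suc k)
  then have IH: "len (alt r t s k \<circ> w) \<le> k + len w" "alt r t s k \<circ> w \<in> W" by blast+
  have "alt r s t (Suc k) \<circ> w = r s \<circ> (alt r t s k \<circ> w)" by (simp add: o_assoc)
  moreover have "len (r s \<circ> (alt r t s k \<circ> w)) \<le> Suc k + len w"
    using len_r[OF IH(2), of s] IH(1) by linarith
  ultimately show ?case using W_r[OF IH(2), of s] by (simp only:)
qed simp

lemma len_first_letter:
  assumes "w \<in> W" "w \<noteq> id"
  obtains t v where "v \<in> W" "w = r t \<circ> v" "Suc (len v) = len w"
proof -
  obtain ws where ws: "act r ws = w" "length ws = len w" using len_attained assms by blast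
  with assms(2) obtain t vs where vs: "ws = t # vs" by (cases ws) auto
  then have w: "w = r t \<circ> act r vs" using ws by simp
  have "Suc (len (act r vs)) \<le> len w" using ws vs len_le[of vs] by simp
  moreover have "len w \<le> Suc (len (act r vs))" unfolding w by (rule len_r[OF W_act])
  ultimately show ?thesis using that[OF W_act w] by simp
qed

text \<open>Weak positivity on the closed chamber is carried along with strict positivity on the open one.
  This makes the statements about closed chambers available without a closure argument.\<close>

definition pos :: "('a \<Rightarrow> real) \<Rightarrow> bool" where
  "pos g \<longleftrightarrow> (\<forall>x. ((\<forall>s. 0 \<le> f s x) \<longrightarrow> 0 \<le> g x) \<and> ((\<forall>s. 0 < f s x) \<longrightarrow> 0 < g x))"

text \<open>Up to length \<open>m s t - 1\<close>, an alternating word beginning with \<open>t\<close> keeps the sector on the positive side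
  of \<open>s\<close>: the angles stay within a half turn, so both sines are nonnegative and one is positive.\<close>

lemma pos_alt:
  assumes st: "s \<noteq> t" and k: "k < m s t" and p: "pos (f s \<circ> w)" "pos (f t \<circ> w)"
  shows "pos (f s \<circ> (alt r t s k \<circ> w))"
proof -
  define \<theta> where "\<theta> = pi / m s t"
  have m: "2 \<le> m s t" using m_ge_2[OF st] .
  have \<theta>: "0 < \<theta>" "\<theta> < pi" unfolding \<theta>_def using m by (simp_all add: divide_simps)
  then have s0: "0 < sin \<theta>" by (simp add: sin_gt_zero)
  have le: "real j * \<theta> \<le> pi" if "j \<le> m s t" for j
    using that m by (simp add: \<theta>_def divide_simps)
  have lt: "real j * \<theta> < pi" if "j < m s t" for j
    using that m by (simp add: \<theta>_def divide_simps)
  define A where "A = sin ((real k + 1) * \<theta>)"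
  define B where "B = sin (real k * \<theta>)"
  have A: "0 \<le> A" using le[of "Suc k"] k \<theta> unfolding A_def by (intro sin_ge_zero) (simp_all add: algebra_simps)
  have B: "0 \<le> B" using le[of k] k \<theta> unfolding B_def by (intro sin_ge_zero) (simp_all add: algebra_simps)
  have AB: "0 < A \<or> 0 < B"
  proof (cases "k = 0")
    case True then show ?thesis using s0 by (simp add: A_def)
  next
    case False
    then have "0 < B" using lt[of k] k \<theta> unfolding B_def by (intro sin_gt_zero) auto
    then show ?thesis ..
  qed
  have eq: "sin \<theta> * f s (alt r t s k y) =
    (if even k then A * f s y + B * f t y else A * f t y + B * f s y)" for y
    using dihedral_coefficients[OF st, of k y] by (simp add: \<theta>_def A_def B_def)
  have "0 \<le> f s (alt r t s k y)" if "0 \<le> f s y" "0 \<le> f t y" for y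
  proof -
    have "0 \<le> sin \<theta> * f s (alt r t s k y)" unfolding eq using that A B by auto
    then show ?thesis using s0 by (simp add: zero_le_mult_iff)
  qed
  moreover have "0 < f s (alt r t s k y)" if "0 < f s y" "0 < f t y" for y
  proof -
    have "0 < A * f s y + B * f t y" "0 < A * f t y + B * f s y"
      using that A B AB by (auto intro: add_pos_nonneg add_nonneg_pos)
    then have "0 < sin \<theta> * f s (alt r t s k y)" unfolding eq by auto
    then show ?thesis using s0 by (simp add: zero_less_mult_iff)
  qed
  ultimately show ?thesis using p unfolding pos_def by auto
qed

text \<open>Multiplying an alternating word of length at most \<open>m a b\<close> by a letter again gives such a word, and
  one letter longer at most. Only for a word of full length is the braid relation used, to make it
  begin with the letter that cancels.\<close>

lemma r_alt_absorb:
  assumes ab: "a \<noteq> b" and k: "k \<le> m a b" and cd: "(c, d) = (a, b) \<or> (c, d) = (b, a)"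
  shows "\<exists>k' c' d'. k' \<le> m a b \<and> k' \<le> Suc k \<and> ((c', d') = (a, b) \<or> (c', d') = (b, a)) \<and>
    r a \<circ> alt r c d k = alt r c' d' k'"
proof -
  have down: "\<exists>k' c' d'. k' \<le> m a b \<and> k' \<le> Suc k \<and> ((c', d') = (a, b) \<or> (c', d') = (b, a)) \<and>
    r a \<circ> alt r a b (Suc j) = alt r c' d' k'" if "j \<le> k" for j
    using that k by (intro exI[of _ j] exI[of _ b] exI[of _ a]) simp
  have up: "r a \<circ> alt r b a k = alt r a b (Suc k)" by simp
  show ?thesis
  proof (cases k)
    case 0
    then show ?thesis using m_ge_2[OF ab]
      by (intro exI[of _ 1] exI[of _ a] exI[of _ b]) simp
  next
    case (Suc j)
    show ?thesis
    proof (cases "(c, d) = (a, b)")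
      case True
      then show ?thesis using down[of j] Suc by simp
    next
      case False
      then have cd': "c = b" "d = a" using cd by auto
      show ?thesis
      proof (cases "k = m a b")
        case True
        then have "alt r b a k = alt r a b (Suc j)" using braid[OF ab] Suc by simp
        then show ?thesis using down[of j] Suc cd' by simp
      next
        case False
        then show ?thesis using up cd' k by (intro exI[of _ "Suc k"] exI[of _ a] exI[of _ b]) simp
      qed
    qed
  qed
qed

text \<open>Tits' induction. The first conjunct: \<open>w\<close> maps the chamber to the positive side of the mirror of \<open>s\<close>,
  unless \<open>r s\<close> shortens \<open>w\<close>. The second conjunct splits off from \<open>w\<close> a factor in the dihedral group of
  \<open>s\<close> and \<open>t\<close>, with lengths adding up, such that the remaining factor maps the chamber to the sector
  of \<open>s\<close> and \<open>t\<close>. For \<open>w = r t \<circ> v\<close> the first conjunct follows from the second one for \<open>v\<close>, since then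
  only the dihedral group has to be understood; and the second conjunct for \<open>w\<close> follows from the
  first one for \<open>w\<close> by removing a letter that shortens \<open>w\<close>.\<close>

lemma tits_lemma:
  assumes "w \<in> W"
  shows "(\<forall>s. pos (f s \<circ> w) \<or> len (r s \<circ> w) < len w) \<and>
    (\<forall>s t. s \<noteq> t \<longrightarrow> (\<exists>k a b v. k \<le> m s t \<and> ((a, b) = (s, t) \<or> (a, b) = (t, s)) \<and> v \<in> W \<and>
       w = alt r a b k \<circ> v \<and> pos (f s \<circ> v) \<and> pos (f t \<circ> v) \<and> k + len v \<le> len w))"
    (is "(\<forall>s. ?P s w) \<and> (\<forall>s t. s \<noteq> t \<longrightarrow> ?Q s t w)")
  using assms
proof (induction "len w" arbitrary: w rule: less_induct)
  case less
  note W = less.prems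
  have IH: "?Q s t v" if "v \<in> W" "len v < len w" "s \<noteq> t" for s t v
    using less.hyps[OF that(2,1)] that(3) by blast
  have P: "?P s w" for s
  proof (cases "w = id")
    case True
    then show ?thesis by (simp add: pos_def)
  next
    case False
    then obtain t v where v: "v \<in> W" "w = r t \<circ> v" "Suc (len v) = len w"
      using len_first_letter[OF W] by metis
    show ?thesis
    proof (cases "s = t")
      case True
      then have "r s \<circ> w = v" using v by simp
      then have "len (r s \<circ> w) = len v" by (rule arg_cong)
      then have "len (r s \<circ> w) < len w" using v(3) by linarith
      then show ?thesis ..
    next
      case False
      then have ts: "t \<noteq> s" by simp
      have l: "len v < len w" using v(3) by linarith
      obtain k a b u where u: "k \<le> m t s" "(a, b) = (t, s) \<or> (a, b) = (s, t)" "u \<in> W"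
        "v = alt r a b k \<circ> u" "pos (f t \<circ> u)" "pos (f s \<circ> u)" "k + len u \<le> len v"
        using IH[OF v(1) l ts] by blast
      obtain k' c d where k': "k' \<le> m t s" "k' \<le> Suc k" "(c, d) = (t, s) \<or> (c, d) = (s, t)"
        "r t \<circ> alt r a b k = alt r c d k'"
        using r_alt_absorb[OF ts u(1,2)] by metis
      have w: "w = alt r c d k' \<circ> u" using v(2) u(4) k'(4) by (simp add: o_assoc)
      have case1: ?thesis if "alt r c d k' = alt r t s j" "j < m s t" for j
      proof -
        have "pos (f s \<circ> w)" using pos_alt[OF False that(2) u(6,5)] by (simp only: w that(1))
        then show ?thesis ..
      qed
      have case2: ?thesis if "alt r c d k' = alt r s t (Suc j)" "Suc j \<le> k'" for j
      proof -
        have "r s \<circ> w = alt r t s j \<circ> u" using w that(1) by (simp add: fun_eq_iff invol)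
        then have "len (r s \<circ> w) \<le> j + len u" using len_alt[OF u(3), of t s j] by (simp only:)
        also have "\<dots> < len w" using that(2) k'(2) u(7) v(3) by linarith
        finally show ?thesis ..
      qed
      show ?thesis
      proof (cases k')
        case 0
        then show ?thesis using case1[of 0] m_ge_2[OF False] by simp
      next
        case (Suc j)
        show ?thesis
        proof (cases "(c, d) = (s, t)")
          case True
          then show ?thesis using case2[of j] Suc by simp
        next
          case False
          then have cd: "c = t" "d = s" using k'(3) by auto
          show ?thesis
          proof (cases "k' = m s t")
            case True
            then have "alt r c d k' = alt r s t (Suc j)" using braid[of s t] ts cd Suc by simp
            then show ?thesis using case2[of j] Suc by simp
          next
            case False
            then show ?thesis using case1[of k'] cd k'(1) m_sym[of s t] by simp
          qed
        qed
      qed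
    qed
  qed
  have Q: "?Q s t w" if st: "s \<noteq> t" for s t
  proof (cases "pos (f s \<circ> w) \<and> pos (f t \<circ> w)")
    case True
    have e: "w = alt r s t 0 \<circ> w" "0 \<le> m s t" "0 + len w \<le> len w" by simp_all
    show ?thesis using e W True by blast
  next
    case False
    then obtain a b where ab: "(a, b) = (s, t) \<or> (a, b) = (t, s)" "\<not> pos (f a \<circ> w)" by auto
    have ne: "a \<noteq> b" using ab st by auto
    have mab: "m a b = m s t" using ab m_sym by auto
    have l: "len (r a \<circ> w) < len w" using P[of a] ab(2) by blast
    obtain k c d v where v: "k \<le> m a b" "(c, d) = (a, b) \<or> (c, d) = (b, a)" "v \<in> W"
      "r a \<circ> w = alt r c d k \<circ> v" "pos (f a \<circ> v)" "pos (f b \<circ> v)" "k + len v \<le> len (r a \<circ> w)"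
      using IH[OF W_r[OF W] l ne] by metis
    obtain k' c' d' where k': "k' \<le> m a b" "k' \<le> Suc k" "(c', d') = (a, b) \<or> (c', d') = (b, a)"
      "r a \<circ> alt r c d k = alt r c' d' k'"
      using r_alt_absorb[OF ne v(1,2)] by metis
    have "w = r a \<circ> (r a \<circ> w)" by simp
    also have "\<dots> = alt r c' d' k' \<circ> v" unfolding v(4) using k'(4) by (simp add: o_assoc)
    finally have "w = alt r c' d' k' \<circ> v" .
    moreover have "k' + len v \<le> len w" using k'(2) v(7) l by linarith
    moreover have "(c', d') = (s, t) \<or> (c', d') = (t, s)" using k'(3) ab by auto
    moreover have "pos (f s \<circ> v)" "pos (f t \<circ> v)" using v ab by auto
    moreover have "k' \<le> m s t" using k'(1) mab by simp
    ultimately show ?thesis using v(3) by blast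
  qed
  show ?case using P Q by blast
qed

lemma reduced_decomposition:
  assumes "w \<in> W" "w \<noteq> id"
  obtains s v where "v \<in> W" "w = r s \<circ> v" "len v < len w" "pos (f s \<circ> v)"
proof -
  obtain s v where v: "v \<in> W" "w = r s \<circ> v" "Suc (len v) = len w"
    using len_first_letter[OF assms] by metis
  then have "\<not> len (r s \<circ> v) < len v" by simp
  then have "pos (f s \<circ> v)" using tits_lemma[OF v(1)] by blast
  then show ?thesis using that v by simp
qed

lemma chamber_disjoint:
  assumes "w \<in> W" "\<And>s. 0 < f s x" "\<And>s. 0 < f s (w x)"
  shows "w = id"
proof (rule ccontr)
  assume "w \<noteq> id"
  then obtain s v where v: "w = r s \<circ> v" "pos (f s \<circ> v)" using reduced_decomposition assms(1) by metis
  then have "0 < f s (v x)" using assms(2) by (simp add: pos_def)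
  then show False using assms(3)[of s] v(1) f_self[of s "v x"] by simp
qed

text \<open>Peeling off the letters of a shortest word one at a time: the image point lies weakly on both sides
  of the first mirror, hence on it, so the first letter fixes it.\<close>

lemma closed_chamber_strict:
  assumes "w \<in> W" and x: "\<And>s. 0 \<le> f s x" and wx: "\<And>s. 0 \<le> f s (w x)"
  shows "w x = x \<and> (\<exists>ws. set ws \<subseteq> {s. f s x = 0} \<and> w = act r ws)"
  using assms(1) wx
proof (induction "len w" arbitrary: w rule: less_induct)
  case less
  show ?case
  proof (cases "w = id")
    case True
    then show ?thesis by (intro conjI exI[of _ "[]"]) auto
  next
    case False
    then obtain s v where v: "v \<in> W" "w = r s \<circ> v" "len v < len w" "pos (f s \<circ> v)"
      using reduced_decomposition less.prems(1) by metis
    then have "0 \<le> f s (v x)" using x by (simp add: pos_def)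
    moreover have "f s (w x) = - f s (v x)" using v(2) f_self by simp
    ultimately have 0: "f s (v x) = 0" using less.prems(2)[of s] by simp
    then have wv: "w x = v x" using mirror_fixed v(2) by simp
    then obtain ws where ws: "v x = x" "set ws \<subseteq> {s. f s x = 0}" "v = act r ws"
      using less.hyps[OF v(3,1)] less.prems(2) by auto
    then show ?thesis using wv 0 v(2) by (intro conjI exI[of _ "s # ws"]) auto
  qed
qed

end


section \<open>The standard regular polygon\<close>

text \<open>A ray from the origin meets the hyperboloid once.\<close>

lemma lorentz_comb_degenerate:
  assumes "a \<in> hyp_plane" "z \<in> hyp_plane" "0 \<le> s" "hT z = s * hT a" "hX z = of_real s * hX a"
  shows "z = a"
proof -
  have "(s * hT a)\<^sup>2 = 1 + s\<^sup>2 * (cmod (hX a))\<^sup>2"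
    using hT_hX_unit[OF assms(2)] assms(4,5) by (simp add: norm_mult power_mult_distrib)
  then have "s\<^sup>2 = 1" using hT_hX_unit[OF assms(1)] by (simp add: power_mult_distrib algebra_simps)
  then have "s = 1" using assms(3) by (simp add: power2_eq_1_iff)
  then show ?thesis using assms hX_inj by simp
qed

text \<open>Sectors with opening below \<open>pi\<close> are intersections of two half-planes; this form is stable under the
  coordinate changes below.\<close>

lemma sector_iff:
  assumes \<theta>: "0 < \<theta>" "\<theta> < pi"
  shows "{of_real s * cis t | s t. 0 \<le> s \<and> s < r \<and> 0 \<le> t \<and> t \<le> \<theta>}
    = {w. cmod w < r \<and> 0 \<le> Im w \<and> Im (w * cis (- \<theta>)) \<le> 0}" (is "?A = ?B")
proof (intro equalityI subsetI)
  fix w assume "w \<in> ?A"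
  then obtain s t where st: "w = of_real s * cis t" "0 \<le> s" "s < r" "0 \<le> t" "t \<le> \<theta>" by blast
  have "w * cis (- \<theta>) = of_real s * cis (t - \<theta>)"
    unfolding st(1) by (simp add: mult.assoc cis_mult)
  moreover have "0 \<le> sin t" using st \<theta> by (intro sin_ge_zero) auto
  moreover have "0 \<le> sin (\<theta> - t)" using st \<theta> by (intro sin_ge_zero) auto
  then have "sin (t - \<theta>) \<le> 0" by (metis minus_diff_eq neg_0_le_iff_le sin_minus)
  moreover have "Im w = s * sin t" "cmod w = s" unfolding st(1) using st(2) by (simp_all add: norm_mult)
  moreover have "Im (of_real s * cis (t - \<theta>)) = s * sin (t - \<theta>)" by simp
  ultimately show "w \<in> ?B" using st(2,3) by (simp only: mem_Collect_eq) (simp add: mult_nonneg_nonpos)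
next
  fix w assume w: "w \<in> ?B"
  define \<tau> where "\<tau> = Arg w"
  have w\<tau>: "w = of_real (cmod w) * cis \<tau>"
    unfolding \<tau>_def using rcis_cmod_Arg[of w] by (simp add: rcis_def)
  show "w \<in> ?A"
  proof (cases "w = 0")
    case True
    then show ?thesis using w \<theta> by (intro CollectI exI[of _ 0]) auto
  next
    case False
    then have m: "0 < cmod w" by simp
    have b: "- pi < \<tau>" "\<tau> \<le> pi" using Arg_bounded unfolding \<tau>_def by auto
    have "Im w = cmod w * sin \<tau>" by (subst w\<tau>) simp
    then have s: "0 \<le> sin \<tau>" using w m by (simp add: zero_le_mult_iff)
    have "w * cis (- \<theta>) = of_real (cmod w) * cis (\<tau> - \<theta>)"
      by (subst w\<tau>) (simp add: mult.assoc cis_mult)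
    then have "Im (w * cis (- \<theta>)) = cmod w * sin (\<tau> - \<theta>)" by simp
    moreover have "Im (w * cis (- \<theta>)) \<le> 0" using w by blast
    ultimately have s': "sin (\<tau> - \<theta>) \<le> 0" using m by (simp add: mult_le_0_iff)
    have "0 \<le> \<tau>"
    proof (rule ccontr)
      assume "\<not> 0 \<le> \<tau>"
      then have "0 < sin (- \<tau>)" using b by (intro sin_gt_zero) auto
      then show False using s by simp
    qed
    moreover have "\<tau> \<le> \<theta>"
    proof (rule ccontr)
      assume "\<not> \<tau> \<le> \<theta>"
      then have "0 < sin (\<tau> - \<theta>)" using b \<theta> by (intro sin_gt_zero) auto
      then show False using s' by simp
    qed
    ultimately show ?thesis using w w\<tau> by (intro CollectI exI[of _ "cmod w"] exI[of _ \<tau>]) auto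
  qed
qed

text \<open>The standard \<open>p\<close>-gon, parametrised by the Euclidean distance \<open>R\<close> of its vertices from the centre.
  Vertices and sides are indexed by all integers, periodically, which avoids reductions modulo \<open>p\<close>.\<close>

locale standard_polygon =
  fixes p :: nat and R :: real
  assumes p3: "3 \<le> p" and R0: "0 < R" and R1: "R < 1"
begin

text \<open>\<open>al\<close> is half the central angle of a side and \<open>apo\<close> is the apothem in the Klein model. The line
  \<open>gap k z = 0\<close> is the geodesic perpendicular to the direction \<open>2 k al\<close> at that Klein distance from the centre. \<open>gap\<close> is a
  polynomial and is defined on the whole plane; \<open>lgap\<close> is the same condition as a functional linear in
  hyperboloid coordinates, of the same sign on the disc.\<close>

definition al :: real where "al = pi / real p"
definition apo :: real where "apo = 2 * R / (1 + R\<^sup>2) * cos al"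
definition vert :: "int \<Rightarrow> complex" where "vert j = of_real R * cis (real_of_int (2 * j + 1) * al)"
definition verts :: "complex list" where "verts = map (\<lambda>j. vert (int j)) [0..<p]"
definition gap :: "int \<Rightarrow> complex \<Rightarrow> real" where
  "gap k z = apo * (1 + (cmod z)\<^sup>2) - 2 * Re (z * cis (- (real_of_int (2 * k) * al)))"
definition tile :: "complex set" where "tile = {z \<in> hyp_plane. \<forall>k. 0 \<le> gap k z}"
definition lgap :: "int \<Rightarrow> complex \<Rightarrow> real" where
  "lgap k z = apo * hT z - Re (hX z * cis (- (real_of_int (2 * k) * al)))"

lemma al: "0 < al" "al < pi / 2" "real p * al = pi"
  using p3 by (simp_all add: al_def divide_simps)

lemma sin_al: "0 < sin al" and cos_al: "0 < cos al" and sin_2al: "0 < sin (2 * al)"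
  using al by (auto intro!: sin_gt_zero cos_gt_zero)

lemma R2: "0 < 1 - R\<^sup>2" "0 < 1 + R\<^sup>2"
  using R0 R1 by (simp_all add: abs_square_less_1 add_pos_nonneg)

lemma apo: "0 < apo" 
  using R0 R2 cos_al by (simp add: apo_def)

lemma cis_period: "cis (x + real_of_int (2 * (int p * c)) * al) = cis x"
proof -
  have "real_of_int (2 * (int p * c)) * al = of_int c * (2 * pi)"
    using al(3) by (simp add: algebra_simps)
  then have "cis (real_of_int (2 * (int p * c)) * al) = 1"
    by (simp only: mult.commute[of "of_int c"]) (rule cis_multiple_2pi, simp)
  then show ?thesis by (simp only: cis_mult[symmetric] mult_1_right)
qed

lemma vert_period: "vert (j + int p * c) = vert j"
  using cis_period[of "real_of_int (2 * j + 1) * al" c]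
  by (simp add: vert_def algebra_simps)

lemma vert_mod: "vert (j mod int p) = vert j"
  using vert_period[of "j mod int p" "j div int p"] by (simp add: mult.commute)

lemma gap_period: "gap (k + int p * c) z = gap k z"
  using cis_period[of "- (real_of_int (2 * (k + int p * c)) * al)" c]
  by (simp add: gap_def algebra_simps)

lemma gap_mod: "gap (k mod int p) z = gap k z"
  using gap_period[of "k mod int p" "k div int p"] by (simp add: mult.commute)

lemma gap_lgap: "z \<in> hyp_plane \<Longrightarrow> gap k z = (1 - (cmod z)\<^sup>2) * lgap k z"
proof -
  assume "z \<in> hyp_plane"
  then have p: "0 < 1 - (cmod z)\<^sup>2" by (rule one_minus_cmod2_pos)
  have e: "Re (hX z * c) = 2 * Re (z * c) / (1 - (cmod z)\<^sup>2)" for c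
    by (simp add: hX_Re hX_Im diff_divide_distrib)
  have "D * (a * (b / D) - x / D) = a * b - x" if "0 < D" for D a b x :: real
    using that by (simp add: field_simps)
  from this[OF p] show ?thesis unfolding gap_def lgap_def hT_def e by simp
qed

lemma gap_sign:
  assumes "z \<in> hyp_plane"
  shows "0 \<le> gap k z \<longleftrightarrow> 0 \<le> lgap k z" "gap k z = 0 \<longleftrightarrow> lgap k z = 0"
  using one_minus_cmod2_pos[OF assms] gap_lgap[OF assms, of k]
  by (simp_all add: zero_le_mult_iff)

lemma lgap_comb: "lorentz_comb s t a b z \<Longrightarrow> lgap k z = s * lgap k a + t * lgap k b"
  by (simp add: lorentz_comb_def lgap_def algebra_simps)

lemma cmod_vert: "cmod (vert j) = R" using R0 by (simp add: vert_def norm_mult)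

lemma vert_in [simp]: "vert j \<in> hyp_plane"
  using cmod_vert R1 by (simp add: hyp_plane_iff)

lemma cos_diff_sin: "cos al - cos (real_of_int (2 * d + 1) * al)
   = 2 * sin (real_of_int (d + 1) * al) * sin (real_of_int d * al)"
proof -
  have "cos (x - y) - cos (x + y) = 2 * sin x * sin y" for x y :: real
    by (simp add: cos_diff cos_add)
  from this[of "real_of_int (d + 1) * al" "real_of_int d * al"] show ?thesis
    by (simp add: algebra_simps)
qed

text \<open>Of the directions with odd index, only two are as near to a given side direction as the end points
  of that side. This one inequality says that the vertices lie in the polygon, and its case of
  equality says on which side lines they lie.\<close>

lemma cos_odd:
  "cos (real_of_int (2 * d + 1) * al) \<le> cos al"
  "cos (real_of_int (2 * d + 1) * al) = cos al \<longleftrightarrow> int p dvd d \<or> int p dvd d + 1"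
proof -
  define e where "e = d mod int p"
  have p0: "0 < int p" using p3 by simp
  have e: "0 \<le> e" "e < int p" unfolding e_def using p0 by auto
  have "cis (real_of_int (2 * d + 1) * al) = cis (real_of_int (2 * e + 1) * al)"
  proof -
    have "2 * d + 1 = (2 * e + 1) + 2 * (int p * (d div int p))"
    proof -
      have "int p * (d div int p) + e = d" unfolding e_def by (rule mult_div_mod_eq)
      then show ?thesis by linarith
    qed
    then have "real_of_int (2 * d + 1) * al = real_of_int (2 * e + 1) * al + real_of_int (2 * (int p * (d div int p))) * al"
      by (simp only: of_int_add distrib_right)
    then show ?thesis by (simp only: cis_period)
  qed
  then have c: "cos (real_of_int (2 * d + 1) * al) = cos (real_of_int (2 * e + 1) * al)"
    by (metis cis.sel(1))
  have le: "real_of_int i * al \<le> pi" if "i \<le> int p" for i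
    using mult_right_mono[of "real_of_int i" "real p" al] that al by (simp flip: of_int_le_iff)
  have lt: "real_of_int i * al < pi" if "i < int p" for i
    using mult_strict_right_mono[of "real_of_int i" "real p" al] that al by (simp flip: of_int_less_iff)
  have s1: "0 \<le> sin (real_of_int (e + 1) * al)" "0 \<le> sin (real_of_int e * al)"
    using e le[of "e + 1"] le[of e] al by (auto intro!: sin_ge_zero)
  have s2: "sin (real_of_int (e + 1) * al) = 0 \<longleftrightarrow> e + 1 = int p"
  proof
    assume "sin (real_of_int (e + 1) * al) = 0"
    show "e + 1 = int p"
    proof (rule ccontr)
      assume "e + 1 \<noteq> int p"
      then have "0 < sin (real_of_int (e + 1) * al)" using e lt[of "e + 1"] al
        by (intro sin_gt_zero) auto
      then show False using \<open>sin (real_of_int (e + 1) * al) = 0\<close> by simp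
    qed
  next
    assume "e + 1 = int p"
    then show "sin (real_of_int (e + 1) * al) = 0" using al(3) by simp
  qed
  have s3: "sin (real_of_int e * al) = 0 \<longleftrightarrow> e = 0"
  proof
    assume "sin (real_of_int e * al) = 0"
    show "e = 0"
    proof (rule ccontr)
      assume "e \<noteq> 0"
      then have "0 < sin (real_of_int e * al)" using e lt[of e] al by (intro sin_gt_zero) auto
      then show False using \<open>sin (real_of_int e * al) = 0\<close> by simp
    qed
  qed simp
  show "cos (real_of_int (2 * d + 1) * al) \<le> cos al"
    using cos_diff_sin[of e] mult_nonneg_nonneg[OF s1] unfolding c by linarith
  have "cos (real_of_int (2 * d + 1) * al) = cos al \<longleftrightarrow> e = 0 \<or> e + 1 = int p"
    using cos_diff_sin[of e] s2 s3 unfolding c by auto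
  also have "e = 0 \<longleftrightarrow> int p dvd d" by (simp add: e_def dvd_eq_mod_eq_0)
  also have "e + 1 = int p \<longleftrightarrow> int p dvd d + 1"
  proof -
    have "int p dvd d + 1 \<longleftrightarrow> int p dvd e + 1"
      unfolding e_def by (metis dvd_eq_mod_eq_0 mod_add_left_eq)
    then show ?thesis using e zdvd_imp_le[of "int p" "e + 1"] by auto
  qed
  finally show "cos (real_of_int (2 * d + 1) * al) = cos al \<longleftrightarrow> int p dvd d \<or> int p dvd d + 1" .
qed

lemma hT_vert: "hT (vert j) = (1 + R\<^sup>2) / (1 - R\<^sup>2)"
  by (simp add: hT_def cmod_vert)

lemma hX_vert: "hX (vert j) = of_real (2 * R / (1 - R\<^sup>2)) * cis (real_of_int (2 * j + 1) * al)"
  unfolding hX_def cmod_vert by (simp add: vert_def)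

lemma lgap_vert: "lgap k (vert j) = 2 * R / (1 - R\<^sup>2) * (cos al - cos (real_of_int (2 * (j - k) + 1) * al))"
proof -
  have "hX (vert j) * cis (- (real_of_int (2 * k) * al))
      = of_real (2 * R / (1 - R\<^sup>2)) * cis (real_of_int (2 * (j - k) + 1) * al)"
    unfolding hX_vert by (simp only: mult.assoc cis_mult) (simp add: algebra_simps)
  moreover have "apo * hT (vert j) = 2 * R / (1 - R\<^sup>2) * cos al"
    using R2 by (simp add: apo_def hT_vert)
  ultimately show ?thesis unfolding lgap_def by (simp only: Re_complex_of_real times_complex.sel Im_complex_of_real cis.sel) (simp add: algebra_simps)
qed

lemma lgap_vert_sign:
  "0 \<le> lgap k (vert j)" "lgap k (vert j) = 0 \<longleftrightarrow> int p dvd j - k \<or> int p dvd j - k + 1"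
proof -
  have c: "0 < 2 * R / (1 - R\<^sup>2)" using R0 R2 by simp
  show "0 \<le> lgap k (vert j)" unfolding lgap_vert
    by (rule mult_nonneg_nonneg) (use c cos_odd(1)[of "j - k"] in auto)
  show "lgap k (vert j) = 0 \<longleftrightarrow> int p dvd j - k \<or> int p dvd j - k + 1"
    unfolding lgap_vert using c cos_odd(2)[of "j - k"] by auto
qed

lemma vert_in_tile: "vert j \<in> tile"
  using lgap_vert_sign by (simp add: tile_def gap_sign)

lemma tile_convex:
  assumes "a \<in> tile" "b \<in> tile"
  shows "geodesic_segment a b \<subseteq> tile"
proof
  fix z assume z: "z \<in> geodesic_segment a b"
  have D: "a \<in> hyp_plane" "b \<in> hyp_plane" "z \<in> hyp_plane"
    using assms z geodesic_segment_subset by (auto simp: tile_def)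
  then obtain s t where st: "0 \<le> s" "0 \<le> t" "lorentz_comb s t a b z"
    using z geodesic_segment_iff_lorentz by blast
  show "z \<in> tile" using assms D st lgap_comb[OF st(3)] by (simp add: tile_def gap_sign)
qed

lemma not_dvd: "\<not> int p dvd 1" "\<not> int p dvd 2" "\<not> int p dvd -1" "\<not> int p dvd -2"
  using p3 zdvd_imp_le[of "int p" 1] zdvd_imp_le[of "int p" 2] by auto

lemma vert_eq_iff: "vert i = vert j \<longleftrightarrow> int p dvd i - j"
proof
  assume "vert i = vert j"
  then have 1: "int p dvd i - (j + 1) \<or> int p dvd i - (j + 1) + 1" "int p dvd i - j \<or> int p dvd i - j + 1"
    using lgap_vert_sign(2)[of "j + 1" j] lgap_vert_sign(2)[of j j] lgap_vert_sign(2)[of "j + 1" i]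
      lgap_vert_sign(2)[of j i] by auto
  show "int p dvd i - j"
  proof (rule ccontr)
    assume "\<not> int p dvd i - j"
    then have "int p dvd i - j - 1" "int p dvd i - j + 1" using 1 by (simp_all add: algebra_simps)
    then have "int p dvd (i - j + 1) - (i - j - 1)" using dvd_diff by blast
    then show False using not_dvd by simp
  qed
next
  assume "int p dvd i - j"
  then obtain c where "i = j + int p * c" by (metis dvd_def diff_add_cancel add.commute)
  then show "vert i = vert j" using vert_period by simp
qed

definition vside :: "int \<Rightarrow> complex set" where "vside i = geodesic_segment (vert i) (vert (i + 1))"

lemma vside_mod: "vside (i mod int p) = vside i"
proof -
  have "vert (i mod int p + 1) = vert (i + 1)"
    by (metis mod_add_left_eq vert_mod)
  then show ?thesis by (simp add: vside_def vert_mod)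
qed

lemma verts_nth: "i < p \<Longrightarrow> verts ! i = vert (int i)"
  by (simp add: verts_def)

lemma length_verts [simp]: "length verts = p" by (simp add: verts_def)

lemma verts_mod: "verts ! (i mod p) = vert (int i)"
  using verts_nth[of "i mod p"] p3 vert_mod[of "int i"] by (simp add: zmod_int)

lemma side_verts: "i < p \<Longrightarrow> side verts i = vside (int i)"
  using verts_mod[of "Suc i"] by (simp add: side_def vside_def verts_nth add.commute)

lemma vside_lorentz:
  "z \<in> vside i \<longleftrightarrow> z \<in> hyp_plane \<and> (\<exists>s t. 0 \<le> s \<and> 0 \<le> t \<and> lorentz_comb s t (vert i) (vert (i + 1)) z)"
  unfolding vside_def using geodesic_segment_iff_lorentz geodesic_segment_subset vert_in by blast

lemma vside_subset_tile: "vside i \<subseteq> tile"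
  unfolding vside_def by (intro tile_convex vert_in_tile)

lemma lgap_vside: "z \<in> vside i \<Longrightarrow> lgap (i + 1) z = 0"
  using lgap_comb[of _ _ "vert i" "vert (i + 1)" z "i + 1"] lgap_vert_sign(2)[of "i + 1" i]
    lgap_vert_sign(2)[of "i + 1" "i + 1"] unfolding vside_lorentz by auto

text \<open>The inequalities of the two neighbouring side lines cut out of a side line exactly the segment
  between its two vertices.\<close>

lemma tile_lgap_0_vside:
  assumes z: "z \<in> tile" and 0: "lgap (i + 1) z = 0"
  shows "z \<in> vside i"
proof -
  define T0 where "T0 = (1 + R\<^sup>2) / (1 - R\<^sup>2)"
  define X0 where "X0 = 2 * R / (1 - R\<^sup>2)"
  have T0: "0 < T0" and X0: "0 < X0" using R0 R2 by (auto simp: T0_def X0_def)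
  have apo': "apo = X0 * cos al / T0" using R2 by (simp add: apo_def X0_def T0_def)
  have zD: "z \<in> hyp_plane" using z by (simp add: tile_def)
  define \<phi> where "\<phi> = real_of_int (2 * (i + 1)) * al"
  define X where "X = hX z * cis (- \<phi>)"
  have hX: "hX z = X * cis \<phi>" by (simp add: X_def mult.assoc cis_mult)
  have x: "Re X = apo * hT z" using 0 by (simp add: lgap_def X_def \<phi>_def)
  have nb: "0 \<le> lgap i z" "0 \<le> lgap (i + 2) z" using z zD by (auto simp: tile_def gap_sign)
  have e1: "hX z * cis (- (real_of_int (2 * i) * al)) = X * cis (2 * al)"
    unfolding X_def \<phi>_def by (simp add: mult.assoc cis_mult algebra_simps)
  have e2: "hX z * cis (- (real_of_int (2 * (i + 2)) * al)) = X * cis (- (2 * al))"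
    unfolding X_def \<phi>_def by (simp add: mult.assoc cis_mult algebra_simps)
  have s2: "sin (2 * al) = 2 * sin al * cos al" by (rule sin_double)
  have c2: "cos (2 * al) = 1 - 2 * (sin al)\<^sup>2" by (rule cos_double_sin)
  have "Re X * cos (2 * al) - Im X * sin (2 * al) \<le> Re X"
    "Re X * cos (2 * al) + Im X * sin (2 * al) \<le> Re X"
    using nb unfolding lgap_def e1 e2 x[symmetric] by simp_all
  then have "\<bar>Im X\<bar> * sin (2 * al) \<le> Re X * (1 - cos (2 * al))"
    by (cases "0 \<le> Im X") (simp_all add: algebra_simps)
  then have "(\<bar>Im X\<bar> * cos al) * (2 * sin al) \<le> (Re X * sin al) * (2 * sin al)"
    unfolding s2 c2 by (simp add: power2_eq_square algebra_simps)
  then have y: "\<bar>Im X\<bar> * cos al \<le> Re X * sin al" using sin_al by simp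
  also have "\<dots> = (X0 * sin al * hT z / T0) * cos al" by (simp add: x apo' mult_ac)
  finally have y': "\<bar>Im X\<bar> \<le> X0 * sin al * hT z / T0"
    by (rule mult_right_le_imp_le[OF _ cos_al])
  define s where "s = (hT z / T0 - Im X / (X0 * sin al)) / 2"
  define t where "t = (hT z / T0 + Im X / (X0 * sin al)) / 2"
  have "\<bar>Im X / (X0 * sin al)\<bar> \<le> hT z / T0"
    using y' X0 T0 sin_al by (simp add: abs_mult divide_simps mult_ac)
  then have "Im X / (X0 * sin al) \<le> hT z / T0" "- (Im X / (X0 * sin al)) \<le> hT z / T0"
    by (simp_all only: abs_le_iff)
  then have st: "0 \<le> s" "0 \<le> t" 
  proof -
    have "0 \<le> (a - x) / 2 \<and> 0 \<le> (a + x) / 2" if "x \<le> a" "- x \<le> a" for a x :: real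
      using that by auto
    from this[OF \<open>Im X / (X0 * sin al) \<le> hT z / T0\<close> \<open>- (Im X / (X0 * sin al)) \<le> hT z / T0\<close>]
    show "0 \<le> s" "0 \<le> t" unfolding s_def t_def by blast+
  qed
  have "lorentz_comb s t (vert i) (vert (i + 1)) z"
    unfolding lorentz_comb_def
  proof
    show "hT z = s * hT (vert i) + t * hT (vert (i + 1))"
      unfolding hT_vert T0_def[symmetric] using T0 by (simp add: s_def t_def field_simps)
    have v1: "hX (vert i) = of_real X0 * cis (- al) * cis \<phi>"
      unfolding hX_vert X0_def[symmetric] by (simp add: mult.assoc cis_mult \<phi>_def algebra_simps)
    have v2: "hX (vert (i + 1)) = of_real X0 * cis al * cis \<phi>"
      unfolding hX_vert X0_def[symmetric] by (simp add: mult.assoc cis_mult \<phi>_def algebra_simps)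
    have "X = of_real s * (of_real X0 * cis (- al)) + of_real t * (of_real X0 * cis al)"
    proof (rule complex_eqI)
      have "Re X = (s + t) * X0 * cos al" unfolding x apo' s_def t_def using T0 by (simp add: field_simps)
      then show "Re X = Re (of_real s * (of_real X0 * cis (- al)) + of_real t * (of_real X0 * cis al))"
        by (simp add: algebra_simps)
      have "Im X = (t - s) * X0 * sin al" unfolding s_def t_def using X0 sin_al by (simp add: field_simps)
      then show "Im X = Im (of_real s * (of_real X0 * cis (- al)) + of_real t * (of_real X0 * cis al))"
        by (simp add: algebra_simps)
    qed
    then show "hX z = of_real s * hX (vert i) + of_real t * hX (vert (i + 1))"
      unfolding v1 v2 hX by (simp add: algebra_simps)
  qed
  then show ?thesis using vside_lorentz zD st by blast
qed

text \<open>A point of both segments makes the functional of the first side vanish on a nonnegative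
  combination of the end points of the second one, so it vanishes at each end point that has a
  positive coefficient.\<close>

lemma vside_inter:
  assumes ij: "\<not> int p dvd i - j" and z: "z \<in> vside i" "z \<in> vside j"
  shows "z \<in> {vert i, vert (i + 1)} \<inter> {vert j, vert (j + 1)}"
proof -
  obtain s t where zD: "z \<in> hyp_plane" and st: "0 \<le> s" "0 \<le> t" "lorentz_comb s t (vert j) (vert (j + 1)) z"
    using z vside_lorentz by blast
  have "s * lgap (i + 1) (vert j) + t * lgap (i + 1) (vert (j + 1)) = 0"
    using lgap_comb[OF st(3)] lgap_vside[OF z(1)] by metis
  moreover have "0 \<le> s * lgap (i + 1) (vert j)" "0 \<le> t * lgap (i + 1) (vert (j + 1))"
    using st lgap_vert_sign by (auto intro: mult_nonneg_nonneg)
  ultimately have "s * lgap (i + 1) (vert j) = 0" "t * lgap (i + 1) (vert (j + 1)) = 0" by linarith+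
  then have s: "s = 0 \<or> int p dvd j - i - 1 \<or> int p dvd j - i"
    and t: "t = 0 \<or> int p dvd j - i \<or> int p dvd j - i + 1"
    by (auto simp: lgap_vert_sign algebra_simps)
  have ji: "\<not> int p dvd j - i" using ij by (metis dvd_minus_iff minus_diff_eq)
  have "\<not> (int p dvd j - i - 1 \<and> int p dvd j - i + 1)"
    using dvd_diff[of "int p" "j - i + 1" "j - i - 1"] not_dvd by auto
  then consider "t = 0" "s = 0 \<or> int p dvd j - i - 1" | "s = 0" "t = 0 \<or> int p dvd j - i + 1"
    using s t ji by blast
  then show ?thesis
  proof cases
    case 1
    then have zv: "z = vert j" using lorentz_comb_degenerate[OF vert_in zD st(1), of j] st(3)
      by (simp add: lorentz_comb_def)
    have "s \<noteq> 0" using st(3) 1 hT_ge_1[OF zD] by (auto simp: lorentz_comb_def)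
    then have "vert j = vert (i + 1)" using 1 by (simp add: vert_eq_iff algebra_simps)
    then show ?thesis using zv by simp
  next
    case 2
    then have zv: "z = vert (j + 1)" using lorentz_comb_degenerate[OF vert_in zD st(2), of "j + 1"] st(3)
      by (simp add: lorentz_comb_def)
    have "t \<noteq> 0" using st(3) 2 hT_ge_1[OF zD] by (auto simp: lorentz_comb_def)
    then have "vert (j + 1) = vert i" using 2 by (simp add: vert_eq_iff algebra_simps)
    then show ?thesis using zv by simp
  qed
qed

lemma corner: "vert (i + 1) \<notin> geodesic_segment (vert i) (vert (i + 2))"
proof
  assume "vert (i + 1) \<in> geodesic_segment (vert i) (vert (i + 2))"
  then obtain s t where st: "0 \<le> s" "0 \<le> t" "lorentz_comb s t (vert i) (vert (i + 2)) (vert (i + 1))"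
    using iffD1[OF geodesic_segment_iff_lorentz[OF vert_in vert_in vert_in]] by blast
  have "t * lgap (i + 1) (vert (i + 2)) = 0"
    using lgap_comb[OF st(3), of "i + 1"] lgap_vert_sign(2)[of "i + 1" i]
      lgap_vert_sign(2)[of "i + 1" "i + 1"] by simp
  then have "t = 0" using not_dvd by (simp add: lgap_vert_sign)
  then have "vert (i + 1) = vert i"
    using lorentz_comb_degenerate[OF vert_in vert_in st(1)] st(3) by (simp add: lorentz_comb_def)
  then show False using not_dvd by (simp add: vert_eq_iff)
qed

lemma small_not_dvd: "i < p \<Longrightarrow> j < p \<Longrightarrow> i \<noteq> j \<Longrightarrow> \<not> int p dvd int i - int j"
proof -
  assume *: "i < p" "j < p" "i \<noteq> j"
  then have "\<bar>int i - int j\<bar> < int p" "int i - int j \<noteq> 0" by auto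
  then show ?thesis by (metis dvd_imp_le_int not_le abs_of_nat)
qed

lemma set_verts: "set verts = range vert"
proof -
  have "vert j \<in> set verts" for j
  proof -
    have "0 \<le> j mod int p" "j mod int p < int p" using p3 by auto
    then have "vert j = verts ! nat (j mod int p)" "nat (j mod int p) < p"
      using verts_nth[of "nat (j mod int p)"] vert_mod[of j] by (simp_all add: nat_less_iff)
    then show ?thesis by (metis length_verts nth_mem)
  qed
  then show ?thesis by (auto simp: verts_def)
qed

lemma polygonal_circuit_verts: "polygonal_circuit verts"
  unfolding polygonal_circuit_def length_verts
proof (intro conjI allI impI)
  show "3 \<le> p" by (rule p3)
  show "distinct verts"
    unfolding distinct_conv_nth using verts_nth vert_eq_iff small_not_dvd by simp
  show "set verts \<subseteq> hyp_plane" using set_verts by auto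
next
  fix i j assume ij: "i < p" "j < p" "i \<noteq> j"
  show "side verts i \<inter> side verts j
    \<subseteq> {verts ! i, verts ! (Suc i mod p)} \<inter> {verts ! j, verts ! (Suc j mod p)}"
    using vside_inter[OF small_not_dvd[OF ij]] ij verts_mod[of "Suc i"] verts_mod[of "Suc j"]
    by (simp add: side_verts verts_nth add.commute subset_iff)
next
  fix i assume i: "i < p"
  show "verts ! (Suc i mod p) \<notin> geodesic_segment (verts ! i) (verts ! (Suc (Suc i) mod p))"
    using corner[of "int i"] verts_mod[of "Suc i"] verts_mod[of "Suc (Suc i)"] i
    by (simp add: verts_nth algebra_simps)
qed

lemma circuit_points_verts: "circuit_points verts = {z \<in> tile. \<exists>k. gap k z = 0}"
proof -
  have "circuit_points verts = (\<Union>i. vside i)"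
  proof -
    have "vside i \<subseteq> circuit_points verts" for i
    proof -
      have "0 \<le> i mod int p" "i mod int p < int p" using p3 by auto
      then have "vside i = side verts (nat (i mod int p))" "nat (i mod int p) < p"
        using side_verts[of "nat (i mod int p)"] vside_mod[of i] by (simp_all add: nat_less_iff)
      then show ?thesis by (auto simp: circuit_points_def)
    qed
    then show ?thesis by (auto simp: circuit_points_def side_verts)
  qed
  moreover have "z \<in> (\<Union>i. vside i) \<longleftrightarrow> z \<in> tile \<and> (\<exists>k. gap k z = 0)" for z
  proof
    assume "z \<in> (\<Union>i. vside i)"
    then obtain i where "z \<in> vside i" by blast
    then show "z \<in> tile \<and> (\<exists>k. gap k z = 0)"
      using vside_subset_tile lgap_vside gap_sign(2) by (metis (no_types, lifting) mem_Collect_eq subsetD tile_def)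
  next
    assume "z \<in> tile \<and> (\<exists>k. gap k z = 0)"
    then obtain k where "z \<in> tile" "gap k z = 0" by blast
    then have "z \<in> vside (k - 1)" using tile_lgap_0_vside[of z "k - 1"] gap_sign(2) by (simp add: tile_def)
    then show "z \<in> (\<Union>i. vside i)" by blast
  qed
  ultimately show ?thesis by blast
qed

text \<open>The polygon is star-shaped about the centre, with strict inequalities after shrinking.\<close>

lemma gap_shrink:
  assumes "cmod z < 1" "0 \<le> gap k z" "0 \<le> u" "u < 1"
  shows "0 < gap k (of_real u * z)"
proof -
  have "u * (apo * (1 + (cmod z)\<^sup>2) - 2 * Re (z * cis (- (real_of_int (2 * k) * al)))) \<ge> 0"
    using assms by (simp add: gap_def)
  moreover have "u * (cmod z)\<^sup>2 < 1"
  proof -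
    have "(cmod z)\<^sup>2 < 1" using assms by (simp add: power_less_one_iff)
    then have "u * (cmod z)\<^sup>2 \<le> 1 * (cmod z)\<^sup>2" using assms by (intro mult_right_mono) auto
    then show ?thesis using \<open>(cmod z)\<^sup>2 < 1\<close> by linarith
  qed
  then have "0 < apo * ((1 - u) * (1 - u * (cmod z)\<^sup>2))" using apo assms by simp
  moreover have "gap k (of_real u * z) = u * (apo * (1 + (cmod z)\<^sup>2) - 2 * Re (z * cis (- (real_of_int (2 * k) * al))))
      + apo * ((1 - u) * (1 - u * (cmod z)\<^sup>2))"
    using assms(3) by (simp add: gap_def norm_mult power_mult_distrib) (simp add: algebra_simps power2_eq_square)
  ultimately show ?thesis by linarith
qed

text \<open>Some side direction makes an angle of at most \<open>al\<close> with the given point. That side line then bounds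
  the norm of a point of the polygon, so that the polygon is compact in the disc.\<close>

lemma exists_sector_index: "\<exists>k. cmod z * cos al \<le> Re (z * cis (- (real_of_int (2 * k) * al)))"
proof -
  \<comment> \<open>The multiple of \<open>2 al\<close> nearest to the argument.\<close>
  define k where "k = round (Arg z / (2 * al))"
  have "\<bar>real_of_int k - Arg z / (2 * al)\<bar> \<le> 1 / 2" unfolding k_def by (rule of_int_round_abs_le)
  then have "\<bar>real_of_int k - Arg z / (2 * al)\<bar> * (2 * al) \<le> 1 / 2 * (2 * al)"
    using al by (intro mult_right_mono) auto
  then have "\<bar>(real_of_int k - Arg z / (2 * al)) * (2 * al)\<bar> \<le> al" using al by (simp add: abs_mult)
  then have d: "\<bar>Arg z - real_of_int (2 * k) * al\<bar> \<le> al" using al by (simp add: algebra_simps abs_minus_commute)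
  have "cos al \<le> cos \<bar>Arg z - real_of_int (2 * k) * al\<bar>" using d al by (intro cos_monotone_0_pi_le) auto
  then have c: "cos al \<le> cos (Arg z - real_of_int (2 * k) * al)" by simp
  have "z * cis (- (real_of_int (2 * k) * al)) = of_real (cmod z) * cis (Arg z - real_of_int (2 * k) * al)"
    using rcis_cmod_Arg[of z] by (metis cis_mult mult.assoc rcis_def uminus_add_conv_diff add.commute)
  then have "Re (z * cis (- (real_of_int (2 * k) * al))) = cmod z * cos (Arg z - real_of_int (2 * k) * al)"
    by simp
  then show ?thesis using c by (metis mult_left_mono norm_ge_zero)
qed

lemma tile_bounded: 
  assumes "z \<in> tile" shows "cmod z \<le> R"
proof -
  obtain k where k: "cmod z * cos al \<le> Re (z * cis (- (real_of_int (2 * k) * al)))"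
    using exists_sector_index by blast
  have "0 \<le> gap k z" using assms by (simp add: tile_def)
  then have "2 * cmod z * cos al \<le> apo * (1 + (cmod z)\<^sup>2)" using k by (simp add: gap_def)
  also have "\<dots> = (2 * R / (1 + R\<^sup>2) * (1 + (cmod z)\<^sup>2)) * cos al" by (simp add: apo_def mult_ac)
  finally have "2 * cmod z \<le> 2 * R / (1 + R\<^sup>2) * (1 + (cmod z)\<^sup>2)"
    by (rule mult_right_le_imp_le[OF _ cos_al])
  then have "2 * cmod z * (1 + R\<^sup>2) \<le> 2 * R * (1 + (cmod z)\<^sup>2)" using R2 by (simp add: field_simps)
  then have *: "(cmod z - R) * (1 - R * cmod z) \<le> 0" by (simp add: algebra_simps power2_eq_square)
  have "R * cmod z < 1" using R0 R1 assms
    by (metis (no_types, lifting) hyp_plane_iff less_imp_le mem_Collect_eq mult_strict_mono' norm_ge_zero tile_def mult_1)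
  then show ?thesis using * by (simp add: mult_le_0_iff)
qed

lemma continuous_gap: "continuous_on UNIV (gap k)"
  unfolding gap_def by (intro continuous_intros)

lemma closed_tile: "closed tile"
proof -
  have "tile = cball 0 R \<inter> (\<Inter>k. {z. 0 \<le> gap k z})"
    using tile_bounded R1 by (auto simp: tile_def hyp_plane_iff)
  moreover have "closed {z. 0 \<le> gap k z}" for k
    using closed_Collect_le[OF continuous_on_const continuous_gap] .
  ultimately show ?thesis by (auto intro!: closed_Int closed_INT)
qed

lemma all_gap_finite: "(\<forall>k. P (gap k z)) \<longleftrightarrow> (\<forall>k\<in>{0..<int p}. P (gap k z))"
proof -
  have "k mod int p \<in> {0..<int p}" for k using p3 by auto
  then show ?thesis using gap_mod by metis
qed

lemma open_gap_pos: "open {z \<in> hyp_plane. \<forall>k. 0 < gap k z}"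
proof -
  have "{z \<in> hyp_plane. \<forall>k. 0 < gap k z} = hyp_plane \<inter> (\<Inter>k\<in>{0..<int p}. {z. 0 < gap k z})"
    using all_gap_finite[of "\<lambda>x. 0 < x"] by auto
  moreover have "open {z. 0 < gap k z}" for k
    using open_Collect_less[OF continuous_on_const continuous_gap] .
  ultimately show ?thesis using open_hyp_plane by (auto intro!: open_Int open_INT)
qed

lemma zero_in_tile: "0 \<in> tile"
  using apo by (simp add: tile_def gap_def)

text \<open>Points of the polygon that are on no side line cannot leave it without meeting the circuit, while
  from points outside it the radial ray escapes to infinity.\<close>

lemma inside_circuit_verts: "inside (circuit_points verts) = tile - circuit_points verts"
proof -
  let ?S = "circuit_points verts"
  let ?O = "{z \<in> hyp_plane. \<forall>k. 0 < gap k z}"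
  have S: "?S \<subseteq> tile" and O: "tile - ?S = ?O"
    unfolding circuit_points_verts by (auto simp: tile_def less_le)
  have "x \<in> inside ?S" if x: "x \<in> tile - ?S" for x
  proof -
    let ?C = "connected_component_set (- ?S) x"
    have "?C \<subseteq> ?O \<union> - tile" using connected_component_subset[of "- ?S" x] O by blast
    moreover have "?O \<inter> - tile = {}" using O by blast
    moreover have "x \<in> ?O \<inter> ?C" using x O by auto
    ultimately have "- tile \<inter> ?C = {}"
      using connectedD[OF connected_connected_component[of "- ?S" x] open_gap_pos, of "- tile"]
        closed_tile by blast
    then have "?C \<subseteq> hyp_plane" by (auto simp: tile_def)
    then have "bounded ?C" using bounded_subset[OF bounded_ball, of _ 0 1] by (auto simp: hyp_plane_def)
    then show ?thesis using x by (simp add: inside_def)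
  qed
  moreover have "x \<notin> inside ?S" if x: "x \<notin> tile" for x
  proof
    assume xi: "x \<in> inside ?S"
    \<comment> \<open>A point of the tile on the ray would, by star-shapedness, bring \<open>x\<close> into the tile.\<close>
    let ?ray = "(\<lambda>t. of_real t * x) ` {1..}"
    have x0: "x \<noteq> 0" using x zero_in_tile by blast
    have "of_real t * x \<notin> tile" if t: "1 \<le> t" for t
    proof
      assume tx: "of_real t * x \<in> tile"
      have "x \<in> tile"
      proof (cases "t = 1")
        case False
        then have u: "0 \<le> 1 / t" "1 / t < 1" using t by auto
        have tD: "cmod (of_real t * x) < 1" using tx by (simp add: tile_def hyp_plane_iff)
        have xe: "of_real (1 / t) * (of_real t * x) = x" using t by simp
        have "0 < gap k x" for k
          using gap_shrink[OF tD _ u, of k] tx unfolding xe by (simp add: tile_def)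
        moreover have "cmod x \<le> cmod (of_real t * x)" using t by (simp add: norm_mult mult_le_cancel_right1)
        ultimately show ?thesis using tD by (auto simp: tile_def hyp_plane_iff less_imp_le)
      qed (use tx in simp)
      then show False using x by blast
    qed
    then have ray: "?ray \<subseteq> - ?S" using S by blast
    have "connected ?ray" by (intro connected_continuous_image continuous_intros) auto
    moreover have "x \<in> ?ray" by (rule image_eqI[of _ _ 1]) auto
    ultimately have "?ray \<subseteq> connected_component_set (- ?S) x"
      using ray by (intro connected_component_maximal)
    moreover have "bounded (connected_component_set (- ?S) x)" using xi by (simp add: inside_def)
    ultimately have "bounded ?ray" using bounded_subset by blast
    then obtain B where B: "\<And>t. 1 \<le> t \<Longrightarrow> cmod (of_real t * x) \<le> B" unfolding bounded_iff by auto
    have "\<bar>t\<bar> * cmod x \<le> B" if "1 \<le> t" for t using B[OF that] by (simp add: norm_mult)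
    from this[of "max 1 ((B + 1) / cmod x)"] have "max 1 ((B + 1) / cmod x) * cmod x \<le> B" by auto
    moreover have "(B + 1) / cmod x * cmod x \<le> max 1 ((B + 1) / cmod x) * cmod x"
      by (intro mult_right_mono) auto
    ultimately show False using x0 by simp
  qed
  ultimately show ?thesis using inside_no_overlap[of ?S] by blast
qed

lemma polygon_of_verts: "polygon_of verts = tile"
  unfolding polygon_of_def inside_circuit_verts using circuit_points_verts by blast

lemma gap_0_not_interior:
  assumes "gap k x = 0"
  shows "x \<notin> interior tile"
proof
  assume xi: "x \<in> interior tile"
  then obtain e where e: "0 < e" "ball x e \<subseteq> tile" using mem_interior by blast
  have xD: "cmod x < 1" using xi interior_subset by (auto simp: tile_def hyp_plane_iff)
  have x0: "x \<noteq> 0" using assms apo by (auto simp: gap_def)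
  \<comment> \<open>A point slightly further out on the ray would still be in the tile, and shrinking it back to \<open>x\<close>
    would make the inequality strict.\<close>
  define t where "t = 1 + e / 2"
  have "cmod (of_real t * x - x) = e / 2 * cmod x"
    using e by (simp add: t_def algebra_simps norm_mult)
  also have "\<dots> \<le> e / 2 * 1" using e xD by (intro mult_left_mono) auto
  also have "\<dots> < e" using e by simp
  finally have tx: "of_real t * x \<in> tile" using e by (auto simp: subset_iff dist_norm norm_minus_commute)
  have "0 < gap k (of_real (1 / t) * (of_real t * x))"
    using tx e by (intro gap_shrink) (auto simp: tile_def hyp_plane_iff t_def)
  moreover have "t \<noteq> 0" using e by (simp add: t_def)
  then have "complex_of_real (1 / t) * (of_real t * x) = x" by simp
  ultimately show False using assms by simp
qed

lemma verts_equilateral: "hyp_dist (vert i) (vert (i + 1)) = hyp_dist (vert 0) (vert 1)"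
proof -
  let ?u = "cis (real_of_int (2 * i) * al)"
  have "vert (j + i) = ?u * vert j" for j
    unfolding vert_def by (simp add: cis_mult algebra_simps)
  from this[of 0] this[of 1] have "vert i = ?u * vert 0" "vert (i + 1) = ?u * vert 1"
    by (simp_all add: add.commute)
  then show ?thesis
    using hyp_isometry_dist[OF hyp_isometry_rotation[of ?u] vert_in vert_in] by simp
qed

text \<open>The centre of the polygon, the midpoint of a side and an end point of that side form a right
  triangle. This is the relation \<open>cosh c = cot A * cot B\<close> between its hypotenuse, which joins the centre
  to the vertex, and its two acute angles.\<close>

definition half_angle :: real where
  "half_angle = arctan ((1 - R\<^sup>2) / (1 + R\<^sup>2) * cos al / sin al)"

lemma half_angle: "0 < half_angle" "half_angle < pi / 2"
  "sin half_angle * sin al = cos half_angle * ((1 - R\<^sup>2) / (1 + R\<^sup>2) * cos al)"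
proof -
  let ?x = "(1 - R\<^sup>2) / (1 + R\<^sup>2) * cos al / sin al"
  show "0 < half_angle" unfolding half_angle_def using R2 cos_al sin_al by (simp add: zero_less_arctan_iff)
  show lt: "half_angle < pi / 2" unfolding half_angle_def by (rule arctan_ubound)
  have c: "0 < cos half_angle" using \<open>0 < half_angle\<close> lt by (intro cos_gt_zero) auto
  have "tan half_angle = ?x" unfolding half_angle_def by (rule tan_arctan)
  then have "sin half_angle = ?x * cos half_angle" using c by (simp add: tan_def field_simps)
  then show "sin half_angle * sin al = cos half_angle * ((1 - R\<^sup>2) / (1 + R\<^sup>2) * cos al)"
    using sin_al by simp
qed

text \<open>The same triangle, with the hypotenuse eliminated in favour of the apothem. This is the form in
  which the angle between a side and a radius appears as an entry of the Gram matrix of mirrors.\<close>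

lemma cos_half_angle: "(cos half_angle)\<^sup>2 * (1 - apo\<^sup>2) = (sin al)\<^sup>2"
proof -
  define c where "c = (1 - R\<^sup>2) / (1 + R\<^sup>2)"
  have "(sin half_angle)\<^sup>2 * (sin al)\<^sup>2 = (cos half_angle)\<^sup>2 * (c\<^sup>2 * (cos al)\<^sup>2)"
    using half_angle(3) by (simp add: c_def flip: power_mult_distrib)
  then have 1: "(sin al)\<^sup>2 = (cos half_angle)\<^sup>2 * ((sin al)\<^sup>2 + c\<^sup>2 * (cos al)\<^sup>2)"
    by (simp add: sin_squared_eq algebra_simps)
  define k where "k = 2 * R / (1 + R\<^sup>2)"
  have "c\<^sup>2 = 1 - k\<^sup>2"
    unfolding c_def k_def using R2 by (simp add: divide_simps) (simp add: power2_eq_square algebra_simps)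
  then have "c\<^sup>2 * (cos al)\<^sup>2 = (1 - k\<^sup>2) * (cos al)\<^sup>2" by (rule arg_cong)
  then have "(sin al)\<^sup>2 + c\<^sup>2 * (cos al)\<^sup>2 = 1 - apo\<^sup>2"
    unfolding apo_def power_mult_distrib k_def[symmetric] by (simp add: sin_squared_eq algebra_simps)
  then show ?thesis using 1 by simp
qed

text \<open>The vertex on the positive axis is moved to the centre by \<open>Mob R\<close>. The two sides through it, one
  for each sign \<open>\<epsilon>\<close>, become diameters: the constant and the quadratic terms of their equations cancel,
  because these lines contain the vertex.\<close>

lemma active_gap_at_vertex:
  fixes \<epsilon> :: real and w :: complex
  assumes "\<epsilon> = 1 \<or> \<epsilon> = - 1" and w: "w \<in> hyp_plane"
  defines "z \<equiv> Mob (- of_real R) w"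
  shows "0 \<le> apo * (1 + (cmod z)\<^sup>2) - 2 * Re (z * cis (\<epsilon> * al)) \<longleftrightarrow>
    Re w * sin half_angle - \<epsilon> * (Im w * cos half_angle) \<le> 0"
proof -
  have RD: "- complex_of_real R \<in> hyp_plane" using R0 R1 by (simp add: hyp_plane_iff)
  define D where "D = 1 + of_real R * w"
  have D: "D \<noteq> 0" using Mob_denom[OF RD w] by (simp add: D_def)
  then have D2: "0 < (cmod D)\<^sup>2" by simp
  have z: "z = (w + of_real R) / D" by (simp add: z_def Mob_def D_def)
  have 1: "(cmod D)\<^sup>2 * (1 + (cmod z)\<^sup>2) = (1 + R\<^sup>2) * (1 + (cmod w)\<^sup>2) + 4 * R * Re w"
  proof -
    have "(cmod D)\<^sup>2 * (1 + (cmod z)\<^sup>2) = (cmod D)\<^sup>2 + (cmod (w + of_real R))\<^sup>2"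
      unfolding z norm_divide power_divide using D2 by (simp add: algebra_simps)
    also have "\<dots> = (1 + R\<^sup>2) * (1 + (cmod w)\<^sup>2) + 4 * R * Re w"
      by (simp add: D_def cmod_power2) (simp add: power2_eq_square algebra_simps)
    finally show ?thesis .
  qed
  have zD: "z * of_real ((cmod D)\<^sup>2) = (w + of_real R) * cnj D"
    unfolding z using D complex_norm_square[of D] by simp
  have se: "sin (\<epsilon> * al) = \<epsilon> * sin al" "cos (\<epsilon> * al) = cos al" using assms(1) by auto
  have 2: "(cmod D)\<^sup>2 * Re (z * cis (\<epsilon> * al))
     = cos al * (R * (1 + (cmod w)\<^sup>2) + (1 + R\<^sup>2) * Re w) - \<epsilon> * sin al * (1 - R\<^sup>2) * Im w"
  proof -
    have "(cmod D)\<^sup>2 * Re (z * cis (\<epsilon> * al)) = Re (z * of_real ((cmod D)\<^sup>2) * cis (\<epsilon> * al))"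
      by (simp add: algebra_simps)
    also have "\<dots> = Re ((w + of_real R) * cnj D * cis (\<epsilon> * al))" by (simp only: zD)
    also have "\<dots> = cos al * (R * (1 + (cmod w)\<^sup>2) + (1 + R\<^sup>2) * Re w) - \<epsilon> * sin al * (1 - R\<^sup>2) * Im w"
      by (simp add: D_def se cmod_power2) (simp add: power2_eq_square algebra_simps)
    finally show ?thesis .
  qed
  define c where "c = (1 - R\<^sup>2) / (1 + R\<^sup>2)"
  have c: "1 - R\<^sup>2 = c * (1 + R\<^sup>2)" using R2 by (simp add: c_def)
  have ap: "apo * (1 + R\<^sup>2) = 2 * R * cos al" using R2 by (simp add: apo_def)
  have ap2: "4 * R * apo - 2 * (1 + R\<^sup>2) * cos al = - 2 * (1 - R\<^sup>2) * (c * cos al)"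
    unfolding apo_def c_def using R2 by (simp add: divide_simps) (simp add: power2_eq_square algebra_simps)
  have "(cmod D)\<^sup>2 * (apo * (1 + (cmod z)\<^sup>2) - 2 * Re (z * cis (\<epsilon> * al)))
    = apo * ((cmod D)\<^sup>2 * (1 + (cmod z)\<^sup>2)) - 2 * ((cmod D)\<^sup>2 * Re (z * cis (\<epsilon> * al)))"
    by (simp add: algebra_simps)
  also have "\<dots> = (apo * (1 + R\<^sup>2)) * (1 + (cmod w)\<^sup>2) - 2 * R * cos al * (1 + (cmod w)\<^sup>2)
     + (4 * R * apo - 2 * (1 + R\<^sup>2) * cos al) * Re w + 2 * \<epsilon> * sin al * (1 - R\<^sup>2) * Im w"
    unfolding 1 2 by (simp add: algebra_simps)
  also have "\<dots> = - 2 * (1 - R\<^sup>2) * (Re w * (c * cos al) - \<epsilon> * (Im w * sin al))"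
    unfolding ap ap2 by (simp add: algebra_simps)
  finally have main: "(cmod D)\<^sup>2 * (apo * (1 + (cmod z)\<^sup>2) - 2 * Re (z * cis (\<epsilon> * al)))
     = - (2 * (1 - R\<^sup>2)) * (Re w * (c * cos al) - \<epsilon> * (Im w * sin al))" by simp
  have cb: "0 < cos half_angle" using half_angle by (intro cos_gt_zero) auto
  have hb: "cos half_angle * (c * cos al) = sin half_angle * sin al" using half_angle(3) by (simp add: c_def)
  have "0 \<le> apo * (1 + (cmod z)\<^sup>2) - 2 * Re (z * cis (\<epsilon> * al)) \<longleftrightarrow>
    0 \<le> - (2 * (1 - R\<^sup>2)) * (Re w * (c * cos al) - \<epsilon> * (Im w * sin al))"
    unfolding main[symmetric] using D2 by (simp add: zero_le_mult_iff)
  also have "\<dots> \<longleftrightarrow> Re w * (c * cos al) - \<epsilon> * (Im w * sin al) \<le> 0"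
    using R2 by (simp only: zero_le_mult_iff) auto
  also have "\<dots> \<longleftrightarrow> cos half_angle * (Re w * (c * cos al) - \<epsilon> * (Im w * sin al)) \<le> 0"
    using cb by (simp add: mult_le_0_iff)
  also have "cos half_angle * (Re w * (c * cos al) - \<epsilon> * (Im w * sin al))
     = Re w * (cos half_angle * (c * cos al)) - \<epsilon> * (Im w * cos half_angle) * sin al"
    by (simp add: algebra_simps)
  also have "\<dots> = sin al * (Re w * sin half_angle - \<epsilon> * (Im w * cos half_angle))"
    unfolding hb by (simp add: algebra_simps)
  also have "\<dots> \<le> 0 \<longleftrightarrow> Re w * sin half_angle - \<epsilon> * (Im w * cos half_angle) \<le> 0"
    using sin_al by (simp add: mult_le_0_iff)
  finally show ?thesis .
qed

text \<open>Near a vertex only the inequalities of the two adjacent sides are active, since the others are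
  strict at the vertex and persist nearby.\<close>

lemma tile_inner_angle: "has_inner_angle tile (vert j) (2 * half_angle)"
proof -
  \<comment> \<open>Rotating by \<open>u\<close> puts the vertex on the positive axis, where \<open>h 0\<close> and \<open>h 1\<close> belong to its two sides.\<close>
  define u where "u = cis (- (real_of_int (2 * j + 1) * al))"
  define h where "h k z = apo * (1 + (cmod z)\<^sup>2) - 2 * Re (z * cis (- (real_of_int (2 * k - 1) * al)))" for k z
  have uu: "cmod u = 1" "u * cnj u = 1" "cnj u * u = 1" by (simp_all add: u_def cis_cnj cis_mult)
  have RD: "complex_of_real R \<in> hyp_plane" "- complex_of_real R \<in> hyp_plane" using R0 R1 by (simp_all add: hyp_plane_iff)
  have uv: "u * vert j = of_real R"
    by (simp add: u_def vert_def mult.left_commute cis_mult)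
  have gh: "gap (k + j) (cnj u * z) = h k z" for k z
  proof -
    have "cnj u * z * cis (- (real_of_int (2 * (k + j)) * al)) = z * cis (- (real_of_int (2 * k - 1) * al))"
      by (simp add: u_def cis_cnj mult.assoc mult.left_commute cis_mult) (simp add: algebra_simps)
    then show ?thesis using uu by (simp only: gap_def h_def norm_mult complex_mod_cnj mult_1)
  qed
  have tile_h: "cnj u * z \<in> tile \<longleftrightarrow> z \<in> hyp_plane \<and> (\<forall>k\<in>{0..<int p}. 0 \<le> h k z)" for z
  proof -
    have "cnj u * z \<in> hyp_plane \<longleftrightarrow> z \<in> hyp_plane" using uu by (simp add: hyp_plane_iff norm_mult)
    moreover have "(\<forall>k. 0 \<le> gap k (cnj u * z)) \<longleftrightarrow> (\<forall>k. 0 \<le> h k z)"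
      unfolding gh[symmetric] by (metis diff_add_cancel)
    moreover have "(\<forall>k. 0 \<le> h k z) \<longleftrightarrow> (\<forall>k\<in>{0..<int p}. 0 \<le> h k z)"
    proof -
      have "h (k mod int p) z = h k z" for k
        unfolding gh[symmetric] by (metis gap_mod mod_add_left_eq)
      moreover have "k mod int p \<in> {0..<int p}" for k using p3 by auto
      ultimately show ?thesis by metis
    qed
    ultimately show ?thesis by (simp add: tile_def)
  qed
  have inactive: "0 < h k (of_real R)" if k: "2 \<le> k" "k < int p" for k
  proof -
    have "\<not> int p dvd - k" "\<not> int p dvd - k + 1"
      using k zdvd_imp_le[of "int p" k] zdvd_imp_le[of "int p" "k - 1"]
      by (auto simp: dvd_minus_iff) (metis dvd_minus_iff minus_diff_eq uminus_add_conv_diff zdvd_imp_le zle_diff1_eq linorder_not_less diff_ge_0_iff_ge)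
    then have "cos (real_of_int (2 * (- k) + 1) * al) \<noteq> cos al" using cos_odd(2)[of "- k"] by blast
    then have lt: "cos (real_of_int (2 * (- k) + 1) * al) < cos al" using cos_odd(1)[of "- k"] by linarith
    have e: "- (real_of_int (2 * k - 1) * al) = real_of_int (2 * (- k) + 1) * al" by (simp add: algebra_simps)
    have "h k (of_real R) = 2 * R * (cos al - cos (real_of_int (2 * (- k) + 1) * al))"
    proof -
      have "apo * (1 + R\<^sup>2) = 2 * R * cos al" using R2 by (simp add: apo_def)
      then show ?thesis unfolding h_def e by (simp add: right_diff_distrib)
    qed
    then show ?thesis using lt R0 by simp
  qed
  let ?M = "Mob (- of_real R)"
  have cont: "continuous_on hyp_plane (\<lambda>w. h k (?M w))" for k
  proof -
    have "continuous_on UNIV (h k)" unfolding h_def by (intro continuous_intros)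
    then show ?thesis using continuous_on_compose2[OF _ continuous_on_Mob[OF RD(2)]] by blast
  qed
  have M0: "?M 0 = of_real R" by (simp add: Mob_at_0)
  let ?U = "\<Inter>k\<in>{2..<int p}. {w \<in> hyp_plane. 0 < h k (?M w)}"
  have "open {w \<in> hyp_plane. 0 < h k (?M w)}" for k
  proof -
    have "open (hyp_plane \<inter> (\<lambda>w. h k (?M w)) -` {0<..})"
      by (rule continuous_open_preimage[OF cont open_hyp_plane open_greaterThan])
    moreover have "hyp_plane \<inter> (\<lambda>w. h k (?M w)) -` {0<..} = {w \<in> hyp_plane. 0 < h k (?M w)}" by auto
    ultimately show ?thesis by simp
  qed
  then have "open (hyp_plane \<inter> ?U)" using open_hyp_plane by (intro open_Int open_INT) auto
  moreover have "0 \<in> hyp_plane \<inter> ?U" using inactive M0 by auto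
  ultimately obtain r0 where r0: "0 < r0" "ball 0 r0 \<subseteq> hyp_plane \<inter> ?U"
    by (rule openE)
  define r where "r = min r0 (1 / 2)"
  have r: "0 < r" "r < 1" "ball 0 r \<subseteq> hyp_plane \<inter> ?U" using r0 by (auto simp: r_def)
  \<comment> \<open>After \<open>Mob R\<close> the tile is symmetric about the negative axis; \<open>v\<close> turns one side to the positive axis.\<close>
  define v where "v = - cis half_angle"
  have vv: "cmod v = 1" "v * cnj v = 1" "cnj v * v = 1" by (simp_all add: v_def cis_cnj cis_mult)
  define g where "g = (\<lambda>z. v * z) \<circ> Mob (of_real R) \<circ> (\<lambda>z. u * z)"
  have giso: "hyp_isometry g" unfolding g_def
    using hyp_isometry_compose hyp_isometry_rotation hyp_isometry_Mob uu vv RD by blast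
  have g0: "g (vert j) = 0" by (simp add: g_def uv)
  have "w \<in> g ` tile \<longleftrightarrow> 0 \<le> Im w \<and> Im (w * cis (- (2 * half_angle))) \<le> 0" if w: "w \<in> ball 0 r" for w
  proof -
    let ?w = "cnj v * w"
    have wr: "?w \<in> ball 0 r" using w vv by (simp add: norm_mult dist_norm)
    then have wD: "?w \<in> hyp_plane" using r by blast
    let ?z = "?M ?w"
    have zD: "?z \<in> hyp_plane" using Mob_in[OF RD(2) wD] .
    have "Mob (of_real R) ?z = ?w" using Mob_inverse[OF RD(2) wD] by simp
    then have gz: "g (cnj u * ?z) = w" using uu vv by (simp add: g_def mult.assoc[symmetric])
    have czD: "cnj u * ?z \<in> hyp_plane" using zD uu by (simp add: hyp_plane_iff norm_mult)
    have "w \<in> g ` tile \<longleftrightarrow> cnj u * ?z \<in> tile"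
    proof
      assume "w \<in> g ` tile"
      then obtain y where y: "y \<in> tile" "g y = w" by blast
      then have "y = cnj u * ?z" using hyp_isometry_eq_iff[OF giso _ czD] gz by (auto simp: tile_def)
      then show "cnj u * ?z \<in> tile" using y by simp
    qed (use gz in force)
    also have "\<dots> \<longleftrightarrow> (\<forall>k\<in>{0..<int p}. 0 \<le> h k ?z)" using tile_h zD by blast
    also have "\<dots> \<longleftrightarrow> 0 \<le> h 0 ?z \<and> 0 \<le> h 1 ?z"
    proof
      assume 01: "0 \<le> h 0 ?z \<and> 0 \<le> h 1 ?z"
      show "\<forall>k\<in>{0..<int p}. 0 \<le> h k ?z"
      proof
        fix k assume k: "k \<in> {0..<int p}"
        show "0 \<le> h k ?z"
        proof (cases "2 \<le> k")
          case True
          then show ?thesis using r(3) wr k by (auto simp: subset_iff less_imp_le)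
        next
          case False
          then have "k = 0 \<or> k = 1" using k by auto
          then show ?thesis using 01 by auto
        qed
      qed
    qed (use p3 in auto)
    also have "0 \<le> h 0 ?z \<longleftrightarrow> Re ?w * sin half_angle - 1 * (Im ?w * cos half_angle) \<le> 0"
      using active_gap_at_vertex[of 1 ?w] wD by (simp add: h_def)
    also have "0 \<le> h 1 ?z \<longleftrightarrow> Re ?w * sin half_angle - (-1) * (Im ?w * cos half_angle) \<le> 0"
      using active_gap_at_vertex[of "-1" ?w] wD by (simp add: h_def)
    also have "Re ?w * sin half_angle - (-1) * (Im ?w * cos half_angle) = - Im w"
    proof -
      have "w = v * ?w" using vv by (simp add: mult.assoc[symmetric])
      then have "Im w = Im (v * ?w)" by (rule arg_cong)
      moreover have "Im (v * y) = - (Re y * sin half_angle + Im y * cos half_angle)" for y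
        by (simp add: v_def algebra_simps)
      ultimately have "Im w = - (Re ?w * sin half_angle + Im ?w * cos half_angle)" by (simp only:)
      then show ?thesis by linarith
    qed
    also have "Re ?w * sin half_angle - 1 * (Im ?w * cos half_angle) = Im (w * cis (- (2 * half_angle)))"
    proof -
      have "w = v * ?w" using vv by (simp add: mult.assoc[symmetric])
      then have "w * cis (- (2 * half_angle)) = v * ?w * cis (- (2 * half_angle))" by (rule arg_cong)
      also have "\<dots> = ?w * (- cis (- half_angle))" by (simp add: v_def mult_ac cis_mult)
      finally have "Im (w * cis (- (2 * half_angle))) = Im (?w * (- cis (- half_angle)))" by (rule arg_cong)
      then show ?thesis by (simp add: algebra_simps)
    qed
    finally show ?thesis by auto
  qed
  note local_form = this
  have "g ` tile \<inter> ball 0 r = {w. cmod w < r \<and> 0 \<le> Im w \<and> Im (w * cis (- (2 * half_angle))) \<le> 0}"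
    (is "?A = ?B")
  proof (rule set_eqI)
    fix w show "w \<in> ?A \<longleftrightarrow> w \<in> ?B"
    proof (cases "w \<in> ball 0 r")
      case True
      then show ?thesis using local_form[OF True] by (simp only: Int_iff mem_Collect_eq mem_ball_0) simp_all
    next
      case False
      then show ?thesis by (simp only: Int_iff mem_Collect_eq mem_ball_0) simp_all
    qed
  qed
  also have "\<dots> = {of_real s * cis t | s t. 0 \<le> s \<and> s < r \<and> 0 \<le> t \<and> t \<le> 2 * half_angle}"
    using half_angle by (intro sector_iff[symmetric]) auto
  finally show ?thesis
    unfolding has_inner_angle_def using giso g0 r half_angle
    by (intro conjI exI[of _ g] exI[of _ r]) auto
qed

lemma regular_tile: "regular_polygon_with p (2 * half_angle) tile"
  unfolding regular_polygon_with_def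
proof (intro exI[of _ verts] conjI ballI)
  show "\<exists>l. \<forall>i<p. hyp_dist (verts ! i) (verts ! (Suc i mod p)) = l"
  proof (intro exI allI impI)
    fix i assume "i < p"
    then show "hyp_dist (verts ! i) (verts ! (Suc i mod p)) = hyp_dist (vert 0) (vert 1)"
      using verts_equilateral[of "int i"] verts_mod[of "Suc i"] by (simp add: verts_nth add.commute)
  qed
qed (use polygonal_circuit_verts polygon_of_verts tile_inner_angle set_verts in auto)

end


section \<open>Local structure of a polygon\<close>

lemma geodesic_segment_commute: "geodesic_segment a b = geodesic_segment b a"
  unfolding geodesic_segment_def using hyp_dist_commute by (auto simp: add.commute)

text \<open>Every frontier point of the region is on the circuit. The converse would be a form of the Jordan
  curve theorem; where it is needed, the assumption on inner angles replaces it.\<close>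

lemma frontier_polygon_of:
  assumes vs: "set vs \<subseteq> hyp_plane"
  shows "frontier (polygon_of vs) \<subseteq> circuit_points vs"
proof -
  let ?S = "circuit_points vs"
  have S: "closed ?S" using compact_circuit_points[OF vs] compact_imp_closed by blast
  have "polygon_of vs = - outside ?S" unfolding polygon_of_def using outside_inside[of ?S] by blast
  then have cl: "closed (polygon_of vs)" using open_outside[OF S] by auto
  have "inside ?S \<subseteq> interior (polygon_of vs)"
    using open_inside[OF S] by (intro interior_maximal) (auto simp: polygon_of_def)
  then show ?thesis
    unfolding frontier_def closure_closed[OF cl] by (auto simp: polygon_of_def)
qed

text \<open>\<open>v\<close> lists the vertices of a circuit periodically, and \<open>sv i\<close> is the side from \<open>v i\<close> to \<open>v (i + 1)\<close>.\<close>

locale circuit =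
  fixes vs :: "complex list" and n :: nat
  assumes circuit: "polygonal_circuit vs" and n: "n = length vs"
begin

lemma n3: "3 \<le> n" and vs_in: "set vs \<subseteq> hyp_plane" and vs_distinct: "distinct vs"
  using circuit by (auto simp: polygonal_circuit_def n)

lemma mod_lt [simp]: "i mod n < n" using n3 by (intro mod_less_divisor) linarith

definition v :: "nat \<Rightarrow> complex" where "v i = vs ! (i mod n)"

lemma v_in [simp]: "v i \<in> hyp_plane"
  using vs_in by (simp add: v_def n[symmetric] nth_mem subset_iff)

lemma v_add_n [simp]: "v (i + n) = v i" by (simp add: v_def)

lemma v_eq_iff: "v i = v j \<longleftrightarrow> i mod n = j mod n"
  using vs_distinct by (simp add: v_def nth_eq_iff_index_eq n[symmetric])

lemma v_Suc_ne: "v (Suc i) \<noteq> v i" "v (Suc (Suc i)) \<noteq> v i"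
proof -
  have "\<not> n dvd 1" "\<not> n dvd 2" using n3 by (auto dest: dvd_imp_le)
  then show "v (Suc i) \<noteq> v i" "v (Suc (Suc i)) \<noteq> v i"
    unfolding v_eq_iff using mod_eq_dvd_iff_nat[of i "Suc i" n] mod_eq_dvd_iff_nat[of i "Suc (Suc i)" n]
    by auto
qed

definition sv :: "nat \<Rightarrow> complex set" where "sv i = geodesic_segment (v i) (v (Suc i))"

lemma side_sv: "i < n \<Longrightarrow> side vs i = sv i"
  by (simp add: side_def sv_def v_def n[symmetric])

lemma sv_mod: "sv (i mod n) = sv i"
  by (simp add: sv_def v_def mod_Suc_eq)

lemma circuit_points_sv: "circuit_points vs = (\<Union>i<n. sv i)"
  unfolding circuit_points_def n[symmetric] using side_sv by auto

lemma sv_inter: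
  assumes "i mod n \<noteq> j mod n"
  shows "sv i \<inter> sv j \<subseteq> {v i, v (Suc i)} \<inter> {v j, v (Suc j)}"
proof -
  have "side vs (i mod n) \<inter> side vs (j mod n) \<subseteq>
    {vs ! (i mod n), vs ! (Suc (i mod n) mod n)} \<inter> {vs ! (j mod n), vs ! (Suc (j mod n) mod n)}"
    using circuit assms mod_lt unfolding polygonal_circuit_def n[symmetric] by blast
  then show ?thesis by (simp add: side_sv sv_mod v_def mod_Suc_eq)
qed

lemma compact_sv: "compact (sv i)"
  unfolding sv_def by (rule compact_geodesic_segment) simp_all

lemma circuit_near_vertex:
  obtains \<epsilon> where "0 < \<epsilon>" "circuit_points vs \<inter> ball (v (Suc i)) \<epsilon> \<subseteq> sv i \<union> sv (Suc i)"
proof -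
  let ?K = "{k. k < n \<and> k \<noteq> i mod n \<and> k \<noteq> Suc i mod n}"
  let ?U = "\<Union>k\<in>?K. sv k"
  have "closed ?U" using compact_sv compact_imp_closed by (intro closed_UN) auto
  moreover have "v (Suc i) \<notin> ?U"
  proof
    assume "v (Suc i) \<in> ?U"
    then obtain k where k: "k < n" "k \<noteq> i mod n" "k \<noteq> Suc i mod n" "v (Suc i) \<in> sv k" by blast
    have "v (Suc i) \<in> sv (Suc i)" unfolding sv_def using geodesic_segment_endpoints by simp
    then have "v (Suc i) \<in> {v k, v (Suc k)}" using sv_inter[of k "Suc i"] k by auto
    then have "Suc i mod n = k mod n \<or> Suc i mod n = Suc k mod n" by (auto simp: v_eq_iff)
    then have "i mod n = k mod n" using k by (auto simp: mod_Suc split: if_splits)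
    then show False using k by simp
  qed
  ultimately have "open (- ?U)" "v (Suc i) \<in> - ?U" by (simp_all only: open_Compl Compl_iff not_False_eq_True)
  then obtain \<epsilon> where e: "0 < \<epsilon>" "ball (v (Suc i)) \<epsilon> \<subseteq> - ?U" by (rule openE)
  have "circuit_points vs \<subseteq> ?U \<union> sv (i mod n) \<union> sv (Suc i mod n)" unfolding circuit_points_sv by auto
  then show ?thesis using that[OF e(1)] e(2) unfolding sv_mod by blast
qed

text \<open>The inner angle is given by some isometry to a sector; the point is that the two bounding rays of
  the sector are the two sides at the vertex. Points on the bounding rays are frontier points, hence
  on the circuit, hence near the vertex on one of the two sides. So the other neighbour \<open>w\<close> is in
  the direction \<open>\<theta>\<close> or \<open>- \<theta>\<close>, and the sign \<open>\<sigma>\<close> also tells on which side of the positive axis the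
  region lies. The lemma is symmetric in the two neighbours, because it is applied at both ends of a
  side.\<close>

lemma corner_sector:
  assumes v0: "v (Suc i) = 0" and \<rho>: "0 < \<rho>"
    and nb: "(v i = of_real \<rho> \<and> v (Suc (Suc i)) = w) \<or> (v (Suc (Suc i)) = of_real \<rho> \<and> v i = w)"
    and w: "cmod w = \<rho>"
    and \<theta>: "0 < \<theta>" "\<theta> < pi" and angle: "has_inner_angle (polygon_of vs) 0 \<theta>"
  obtains \<sigma> \<epsilon> :: real where "\<sigma> = 1 \<or> \<sigma> = -1" "w = of_real \<rho> * cis (\<sigma> * \<theta>)" "0 < \<epsilon>"
    "\<And>x. 0 < x \<Longrightarrow> x < \<epsilon> \<Longrightarrow> \<exists>\<delta>>0. \<forall>z. dist z (of_real x) < \<delta> \<longrightarrow>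
       (0 < \<sigma> * Im z \<longrightarrow> z \<in> polygon_of vs) \<and> (\<sigma> * Im z < 0 \<longrightarrow> z \<notin> polygon_of vs)"
proof -
  let ?P = "polygon_of vs"
  obtain g r where g: "hyp_isometry g" "g 0 = 0" "0 < r" "r < 1"
    "g ` ?P \<inter> ball 0 r = {of_real s * cis t | s t. 0 \<le> s \<and> s < r \<and> 0 \<le> t \<and> t \<le> \<theta>}"
    using angle unfolding has_inner_angle_def by blast
  obtain h where h: "hyp_isometry h" "\<And>z. z \<in> hyp_plane \<Longrightarrow> h (g z) = z"
    "\<And>z. z \<in> hyp_plane \<Longrightarrow> g (h z) = z" using hyp_isometry_inverse[OF g(1)] by metis
  have h0: "h 0 = 0" using h(2)[of 0] g(2) by simp
  obtain u where u: "cmod u = 1"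
    "(\<forall>z\<in>hyp_plane. h z = u * z) \<or> (\<forall>z\<in>hyp_plane. h z = u * cnj z)"
    using isometry_fixing_0[OF h(1) h0] by metis
  have uu: "u * cnj u = 1" "cnj u * u = 1" using u(1) complex_norm_square[of u] by (simp_all add: mult.commute)
  have hn: "cmod (h a - h b) = cmod (a - b)" if "a \<in> hyp_plane" "b \<in> hyp_plane" for a b
  proof -
    have "cmod (u * a - u * b) = cmod (a - b)" "cmod (u * cnj a - u * cnj b) = cmod (a - b)"
      using u(1) by (simp_all add: norm_mult flip: right_diff_distrib complex_cnj_diff)
    then show ?thesis using u(2) that by auto
  qed
  have PD: "?P \<subseteq> hyp_plane" by (rule polygon_of_subset)
  have sect: "h y \<in> ?P \<longleftrightarrow> 0 \<le> Im y \<and> Im (y * cis (- \<theta>)) \<le> 0" if y: "cmod y < r" for y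
  proof -
    have yD: "y \<in> hyp_plane" using y g(4) by (simp add: hyp_plane_iff)
    have "h y \<in> ?P \<longleftrightarrow> y \<in> g ` ?P" using h(2,3) yD PD by (metis (no_types, lifting) image_iff subsetD)
    also have "\<dots> \<longleftrightarrow> y \<in> g ` ?P \<inter> ball 0 r" using y by simp
    also have "\<dots> \<longleftrightarrow> 0 \<le> Im y \<and> Im (y * cis (- \<theta>)) \<le> 0"
      unfolding g(5) sector_iff[OF \<theta>] using y by blast
    finally show ?thesis .
  qed
  obtain e where e: "0 < e" "circuit_points vs \<inter> ball 0 e \<subseteq> sv i \<union> sv (Suc i)"
    using circuit_near_vertex[of i] v0 by metis
  have wD: "w \<in> hyp_plane" "of_real \<rho> \<in> hyp_plane" using nb v_in by metis+
  have "sv i \<union> sv (Suc i) = geodesic_segment 0 (of_real \<rho>) \<union> geodesic_segment 0 w"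
    unfolding sv_def v0 using nb geodesic_segment_commute by auto
  then have segs: "sv i \<union> sv (Suc i) = closed_segment 0 (of_real \<rho>) \<union> closed_segment 0 w"
    using geodesic_segment_0 wD by simp
  define s where "s = min (r / 2) (e / 2)"
  have s: "0 < s" "s < r" "s < e" using g e by (auto simp: s_def)
  \<comment> \<open>Points on the two bounding rays of the sector come from frontier points of the region; at distance
    \<open>s\<close> from the vertex there are only two points of the circuit.\<close>
  have on_side: "h y = of_real s \<or> h y = of_real (s / \<rho>) * w"
    if y: "cmod y = s" and inP: "h y \<in> ?P" and out: "\<And>\<eta>. 0 < \<eta> \<Longrightarrow> \<exists>y'. cmod (y' - y) < \<eta> \<and> cmod y' < r \<and> h y' \<notin> ?P"
    for y
  proof -
    have yD: "y \<in> hyp_plane" using y s g by (simp add: hyp_plane_iff)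
    have "h y \<notin> interior ?P"
    proof
      assume "h y \<in> interior ?P"
      then obtain \<eta> where \<eta>: "0 < \<eta>" "ball (h y) \<eta> \<subseteq> ?P" using mem_interior by blast
      obtain y' where y': "cmod (y' - y) < \<eta>" "cmod y' < r" "h y' \<notin> ?P" using out[OF \<eta>(1)] by blast
      have "y' \<in> hyp_plane" using y' g by (simp add: hyp_plane_iff)
      then have "dist (h y) (h y') < \<eta>" using hn[OF yD, of y'] y'(1) by (simp add: dist_norm norm_minus_commute)
      then show False using \<eta> y'(3) by auto
    qed
    then have "h y \<in> frontier ?P" using inP closure_subset by (auto simp: frontier_def)
    then have hS: "h y \<in> circuit_points vs" using frontier_polygon_of[OF vs_in] by blast
    have hy: "cmod (h y) = s" using hn[OF yD zero_in_hyp_plane] h0 y by simp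
    then have "h y \<in> closed_segment 0 (of_real \<rho>) \<union> closed_segment 0 w"
      using e(2) hS s segs by auto
    then obtain b c where c: "0 \<le> c" "h y = of_real c * b" "b = of_real \<rho> \<or> b = w"
      by (auto simp: in_segment scaleR_conv_of_real)
    then have "c * \<rho> = s" using hy w \<rho> by (auto simp: norm_mult)
    then have "c = s / \<rho>" using \<rho> by (simp add: field_simps)
    then show ?thesis using c(2,3) \<rho> by auto
  qed
  have sDs: "of_real s \<in> hyp_plane" "of_real s * cis \<theta> \<in> hyp_plane"
    using s g by (simp_all add: hyp_plane_iff norm_mult)
  have sin\<theta>: "0 < sin \<theta>" using \<theta> by (intro sin_gt_zero)
  have d1: "h (of_real s) = of_real s \<or> h (of_real s) = of_real (s / \<rho>) * w"
  proof (rule on_side)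
    show "h (of_real s) \<in> ?P" using sect[of "of_real s"] s sin\<theta> by simp
    fix \<eta> :: real assume \<eta>: "0 < \<eta>"
    define c where "c = min (\<eta> / 2) ((r - s) / 2)"
    have c: "0 < c" "c < \<eta>" "s + c < r" unfolding c_def using \<eta> s by (auto simp: min_def field_simps)
    have "cmod (of_real s + of_real (- c) * \<i>) \<le> s + c"
      using norm_triangle_ineq[of "of_real s" "of_real (- c) * \<i>"] s c by (simp add: norm_mult)
    then have "cmod (of_real s + of_real (- c) * \<i>) < r" using c by linarith
    then show "\<exists>y'. cmod (y' - of_real s) < \<eta> \<and> cmod y' < r \<and> h y' \<notin> ?P"
      using c sect[of "of_real s + of_real (- c) * \<i>"]
      by (intro exI[of _ "of_real s + of_real (- c) * \<i>"]) (simp add: norm_mult)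
  qed (use s in simp)
  have d2: "h (of_real s * cis \<theta>) = of_real s \<or> h (of_real s * cis \<theta>) = of_real (s / \<rho>) * w"
  proof (rule on_side)
    have "of_real s * cis \<theta> * cis (- \<theta>) = of_real s" by (simp add: mult.assoc cis_mult)
    then show "h (of_real s * cis \<theta>) \<in> ?P" using sect[of "of_real s * cis \<theta>"] s sin\<theta> by (simp add: norm_mult)
    fix \<eta> :: real assume \<eta>: "0 < \<eta>"
    define c where "c = min (\<eta> / 2) ((r - s) / 2)"
    let ?y = "(of_real s + of_real c * \<i>) * cis \<theta>"
    have c: "0 < c" "c < \<eta>" "s + c < r" unfolding c_def using \<eta> s by (auto simp: min_def field_simps)
    have "cmod (of_real s + of_real c * \<i>) \<le> s + c"
      using norm_triangle_ineq[of "of_real s" "of_real c * \<i>"] s c by (simp add: norm_mult)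
    then have 1: "cmod ?y < r" using c by (simp add: norm_mult)
    have "?y * cis (- \<theta>) = of_real s + of_real c * \<i>" by (simp add: mult.assoc cis_mult)
    then have "Im (?y * cis (- \<theta>)) = c" by (simp only:) simp
    then have 2: "h ?y \<notin> ?P" using sect[OF 1] c(1) by linarith
    have "?y - of_real s * cis \<theta> = of_real c * \<i> * cis \<theta>" by (simp add: algebra_simps)
    then have 3: "cmod (?y - of_real s * cis \<theta>) < \<eta>" using c by (simp add: norm_mult)
    show "\<exists>y'. cmod (y' - of_real s * cis \<theta>) < \<eta> \<and> cmod y' < r \<and> h y' \<notin> ?P" using 1 2 3 by blast
  qed (use s in \<open>simp add: norm_mult\<close>)
  have cis_ne: "cis \<theta> \<noteq> 1" using sin\<theta> by (auto simp: complex_eq_iff)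
  have "h (of_real s) \<noteq> h (of_real s * cis \<theta>)"
    using hyp_isometry_eq_iff[OF h(1) sDs] s cis_ne by simp
  \<comment> \<open>The two rays come from different sides; \<open>F\<close> is the half-plane condition of the ray through \<open>w\<close>,
    which is strict on the positive axis.\<close>
  then consider (A) "h (of_real s) = of_real s" "h (of_real s * cis \<theta>) = of_real (s / \<rho>) * w"
    | (B) "h (of_real s * cis \<theta>) = of_real s" "h (of_real s) = of_real (s / \<rho>) * w"
    using d1 d2 by metis
  moreover have wI: "w = of_real \<rho> * y" if "of_real (s / \<rho>) * w = of_real s * y" for y
    using that s \<rho> by (simp add: field_simps)
  ultimately have "\<exists>(\<sigma>::real) (F::complex \<Rightarrow> real). (\<sigma> = 1 \<or> \<sigma> = -1) \<and> w = of_real \<rho> * cis (\<sigma> * \<theta>) \<and> continuous_on UNIV F \<and>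
     (\<forall>x>0. 0 < F (of_real x)) \<and> (\<forall>z. cmod z < r \<longrightarrow> (z \<in> ?P \<longleftrightarrow> 0 \<le> \<sigma> * Im z \<and> (0::real) \<le> F z))"
  proof cases
    case A
    have "u = 1" using A(1) u(2) sDs s by auto
    show ?thesis using u(2)
    proof
      assume lin: "\<forall>z\<in>hyp_plane. h z = u * z"
      have "w = of_real \<rho> * cis \<theta>" using A(2) lin sDs \<open>u = 1\<close> by (intro wI) simp
      moreover have "z \<in> ?P \<longleftrightarrow> 0 \<le> 1 * Im z \<and> 0 \<le> - Im (z * cis (- \<theta>))" if "cmod z < r" for z
        using sect[OF that] lin \<open>u = 1\<close> that g by (simp add: hyp_plane_iff)
      moreover have "continuous_on UNIV (\<lambda>z. - Im (z * cis (- \<theta>)))" by (intro continuous_intros)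
      ultimately show ?thesis using sin\<theta> 
        by (intro exI[of _ 1] exI[of _ "\<lambda>z. - Im (z * cis (- \<theta>))"]) auto
    next
      assume anti: "\<forall>z\<in>hyp_plane. h z = u * cnj z"
      have "w = of_real \<rho> * cis (- \<theta>)" using A(2) anti sDs \<open>u = 1\<close> by (intro wI) (simp add: cis_cnj)
      moreover have "z \<in> ?P \<longleftrightarrow> 0 \<le> -1 * Im z \<and> 0 \<le> - Im (cnj z * cis (- \<theta>))" if "cmod z < r" for z
        using sect[of "cnj z"] anti \<open>u = 1\<close> that g by (auto simp: hyp_plane_iff)
      moreover have "continuous_on UNIV (\<lambda>z. - Im (cnj z * cis (- \<theta>)))" by (intro continuous_intros)
      ultimately show ?thesis using sin\<theta> 
        by (intro exI[of _ "-1"] exI[of _ "\<lambda>z. - Im (cnj z * cis (- \<theta>))"]) auto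
    qed
  next
    case B
    show ?thesis using u(2)
    proof
      assume lin: "\<forall>z\<in>hyp_plane. h z = u * z"
      have "u * cis \<theta> = 1" using B(1) lin sDs s by simp
      then have ue: "u = cis (- \<theta>)" by (metis cis_inverse inverse_unique mult.commute)
      have "w = of_real \<rho> * cis (- \<theta>)" using B(2) lin sDs ue by (intro wI) (simp add: mult.commute)
      moreover have "z \<in> ?P \<longleftrightarrow> 0 \<le> -1 * Im z \<and> 0 \<le> Im (z * cis \<theta>)" if "cmod z < r" for z
      proof -
        have "h (z * cis \<theta>) = z" using lin ue that g
          by (simp add: hyp_plane_iff norm_mult mult_ac cis_mult)
        moreover have "z * cis \<theta> * cis (- \<theta>) = z" by (simp add: mult.assoc cis_mult)
        ultimately have "z \<in> ?P \<longleftrightarrow> 0 \<le> Im (z * cis \<theta>) \<and> Im z \<le> 0"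
          using sect[of "z * cis \<theta>"] that by (simp only: norm_mult norm_cis mult_1_right)
        then show ?thesis by auto
      qed
      moreover have "continuous_on UNIV (\<lambda>z. Im (z * cis \<theta>))" by (intro continuous_intros)
      ultimately show ?thesis using sin\<theta> 
        by (intro exI[of _ "-1"] exI[of _ "\<lambda>z. Im (z * cis \<theta>)"]) auto
    next
      assume anti: "\<forall>z\<in>hyp_plane. h z = u * cnj z"
      have "u * cis (- \<theta>) = 1" using B(1) anti sDs s by (simp add: cis_cnj)
      then have ue: "u = cis \<theta>" by (metis cis_inverse inverse_unique minus_minus mult.commute)
      have "w = of_real \<rho> * cis \<theta>" using B(2) anti sDs ue by (intro wI) (simp add: mult.commute)
      moreover have "z \<in> ?P \<longleftrightarrow> 0 \<le> 1 * Im z \<and> 0 \<le> Im (cnj z * cis \<theta>)" if "cmod z < r" for z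
      proof -
        have "h (cnj z * cis \<theta>) = z" using anti ue that g
          by (simp add: hyp_plane_iff norm_mult mult_ac cis_mult cis_cnj)
        moreover have "cnj z * cis \<theta> * cis (- \<theta>) = cnj z" by (simp add: mult.assoc cis_mult)
        ultimately have "z \<in> ?P \<longleftrightarrow> 0 \<le> Im (cnj z * cis \<theta>) \<and> Im (cnj z) \<le> 0"
          using sect[of "cnj z * cis \<theta>"] that
          by (simp only: norm_mult norm_cis mult_1_right complex_mod_cnj)
        then show ?thesis by auto
      qed
      moreover have "continuous_on UNIV (\<lambda>z. Im (cnj z * cis \<theta>))" by (intro continuous_intros)
      ultimately show ?thesis using sin\<theta> 
        by (intro exI[of _ 1] exI[of _ "\<lambda>z. Im (cnj z * cis \<theta>)"]) auto
    qed
  qed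
  then obtain \<sigma> :: real and F :: "complex \<Rightarrow> real" where F: "\<sigma> = 1 \<or> \<sigma> = -1" "w = of_real \<rho> * cis (\<sigma> * \<theta>)" "continuous_on UNIV F"
     "\<And>x. x > 0 \<Longrightarrow> 0 < F (of_real x)"
     "\<And>z::complex. cmod z < r \<Longrightarrow> z \<in> ?P \<longleftrightarrow> 0 \<le> \<sigma> * Im z \<and> 0 \<le> F z" by blast
  show ?thesis
  proof (rule that[OF F(1,2) g(3)])
    fix x :: real assume x: "0 < x" "x < r"
    have "open ({z. 0 < F z} \<inter> ball 0 r)"
      using open_Collect_less[OF continuous_on_const F(3)] by blast
    moreover have "of_real x \<in> {z. 0 < F z} \<inter> ball 0 r" using F(4) x by simp
    ultimately obtain \<delta> where d: "0 < \<delta>" "ball (of_real x) \<delta> \<subseteq> {z. 0 < F z} \<inter> ball 0 r"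
      by (rule openE)
    show "\<exists>\<delta>>0. \<forall>z. dist z (of_real x) < \<delta> \<longrightarrow>
       (0 < \<sigma> * Im z \<longrightarrow> z \<in> ?P) \<and> (\<sigma> * Im z < 0 \<longrightarrow> z \<notin> ?P)"
    proof (intro exI[of _ \<delta>] conjI allI impI d(1))
      fix z :: complex assume z: "dist z (of_real x) < \<delta>"
      then have zz: "0 < F z" "cmod z < r" using d(2) by (auto simp: subset_iff dist_commute)
      show "z \<in> ?P" if "0 < \<sigma> * Im z" using F(5)[OF zz(2)] zz(1) that by simp
      show "z \<notin> ?P" if "\<sigma> * Im z < 0" using F(5)[OF zz(2)] that by simp
    qed
  qed
qed

text \<open>A thin convex strip along a compact piece of the open side, on one side of the axis, avoids the
  circuit, so it lies in one component of the complement.\<close>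

lemma same_side:
  assumes v0: "v i = 0" and v1: "v (Suc i) = of_real \<rho>"
    and x: "0 < x1" "x1 < \<rho>" "0 < x2" "x2 < \<rho>" and \<sigma>: "\<sigma> = 1 \<or> \<sigma> = (-1::real)"
  obtains \<delta> where "0 < \<delta>" "\<And>z1 z2. dist z1 (of_real x1) < \<delta> \<Longrightarrow> dist z2 (of_real x2) < \<delta> \<Longrightarrow>
     0 < \<sigma> * Im z1 \<Longrightarrow> 0 < \<sigma> * Im z2 \<Longrightarrow> z1 \<in> polygon_of vs \<longleftrightarrow> z2 \<in> polygon_of vs"
proof -
  let ?S = "circuit_points vs"
  let ?K = "closed_segment (complex_of_real x1) (of_real x2)"
  let ?U = "\<Union>k\<in>{k. k < n \<and> k \<noteq> i mod n}. sv k"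
  have \<rho>D: "of_real \<rho> \<in> hyp_plane" using v_in[of "Suc i"] v1 by simp
  have svi: "sv i = closed_segment 0 (of_real \<rho>)" unfolding sv_def v0 v1 using geodesic_segment_0[OF \<rho>D] .
  have K: "\<exists>y. z = of_real y \<and> 0 < y \<and> y < \<rho>" if z: "z \<in> ?K" for z
  proof -
    obtain t where t: "0 \<le> t" "t \<le> 1" "z = of_real ((1 - t) * x1 + t * x2)"
      using z by (auto simp: in_segment scaleR_conv_of_real)
    have "(1 - t) * x1 + t * x2 \<in> {0<..<\<rho>}"
      using convexD[OF convex_real_interval(8)[of 0 \<rho>], of x1 x2 "1 - t" t] x t by auto
    then show ?thesis using t(3) by (intro exI[of _ "(1 - t) * x1 + t * x2"]) simp
  qed
  have "?K \<inter> ?U = {}"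
  proof (rule ccontr)
    assume "?K \<inter> ?U \<noteq> {}"
    then obtain z k where z: "z \<in> ?K" "k < n" "k \<noteq> i mod n" "z \<in> sv k" by blast
    obtain y where y: "z = of_real y" "0 < y" "y < \<rho>" using K[OF z(1)] by blast
    have "z \<in> sv i" unfolding svi in_segment using y
      by (intro exI[of _ "y / \<rho>"] conjI) (auto simp: scaleR_conv_of_real)
    then have "z \<in> {0, of_real \<rho>}" using sv_inter[of i k] z v0 v1 by auto
    then show False using y by auto
  qed
  moreover have "closed ?U" using compact_sv compact_imp_closed by (intro closed_UN) auto
  ultimately have "\<exists>d>0. \<forall>a\<in>?K. \<forall>b\<in>?U. d \<le> dist a b"
    by (intro separate_compact_closed compact_segment)
  then obtain \<delta> where d: "0 < \<delta>" "\<And>a b. a \<in> ?K \<Longrightarrow> b \<in> ?U \<Longrightarrow> \<delta> \<le> dist a b" by blast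
  let ?N = "\<Union>a\<in>?K. \<Union>b\<in>ball 0 \<delta>. {a + b}"
  let ?H = "{z. 0 < \<sigma> * Im z}"
  have cH: "convex ?H"
  proof -
    have "?H = {z. inner (\<i> * of_real \<sigma>) z > 0}" by (auto simp: inner_complex_def)
    then show ?thesis using convex_halfspace_gt by metis
  qed
  have "convex (?N \<inter> ?H)"
    by (intro convex_Int cH convex_sums convex_closed_segment convex_ball)
  then have conn: "connected (?N \<inter> ?H)" by (rule convex_connected)
  have NS: "?N \<inter> ?H \<subseteq> - ?S"
  proof
    fix z assume z: "z \<in> ?N \<inter> ?H"
    then obtain a b where ab: "z = a + b" "a \<in> ?K" "cmod b < \<delta>" by auto
    then have "dist a z < \<delta>" by (simp add: dist_norm)
    then have "z \<notin> ?U" using d(2)[OF ab(2)] by force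
    moreover have "z \<notin> sv i"
    proof
      assume "z \<in> sv i"
      then have "Im z = 0" unfolding svi by (auto simp: in_segment)
      then show False using z by simp
    qed
    moreover have "?S \<subseteq> ?U \<union> sv i" unfolding circuit_points_sv using sv_mod[of i] by auto
    ultimately show "z \<in> - ?S" by blast
  qed
  show ?thesis
  proof (rule that[OF d(1)])
    fix z1 z2
    assume z: "dist z1 (of_real x1) < \<delta>" "dist z2 (of_real x2) < \<delta>" "0 < \<sigma> * Im z1" "0 < \<sigma> * Im z2"
    have NI: "y \<in> ?N" if "a \<in> ?K" "dist y a < \<delta>" for y a
    proof -
      have "y \<in> (\<Union>b\<in>ball 0 \<delta>. {a + b})" using that(2) by (intro UN_I[of "y - a"]) (simp_all add: dist_norm norm_minus_commute)
      then show ?thesis using that(1) by blast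
    qed
    have zN: "z1 \<in> ?N \<inter> ?H" "z2 \<in> ?N \<inter> ?H"
      using z NI[of "of_real x1" z1] NI[of "of_real x2" z2] ends_in_segment by (simp_all only: Int_iff mem_Collect_eq) simp_all
    then have "connected_component (- ?S) z1 z2"
      unfolding connected_component_def using conn NS by blast
    then have "z1 \<in> inside ?S \<longleftrightarrow> z2 \<in> inside ?S"
      using inside_same_component connected_component_sym by metis
    then show "z1 \<in> polygon_of vs \<longleftrightarrow> z2 \<in> polygon_of vs"
      using zN NS unfolding polygon_of_def by blast
  qed
qed

end


section \<open>Direct isometries\<close>

text \<open>Orientation-preserving isometries, characterised by the fact that they change the directions seen
  from a point by a common rotation. In this form closure under composition is immediate, and so is
  the invariance of turning angles.\<close>

definition direct :: "(complex \<Rightarrow> complex) \<Rightarrow> bool" where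
  "direct g \<longleftrightarrow> hyp_isometry g \<and>
    (\<forall>b\<in>hyp_plane. \<exists>u. cmod u = 1 \<and> (\<forall>z\<in>hyp_plane. Mob (g b) (g z) = u * Mob b z))"

lemma direct_isometry: "direct g \<Longrightarrow> hyp_isometry g" by (simp add: direct_def)

lemma direct_unit:
  assumes "direct g" "b \<in> hyp_plane"
  obtains u where "cmod u = 1" "u \<noteq> 0" "\<And>z. z \<in> hyp_plane \<Longrightarrow> Mob (g b) (g z) = u * Mob b z"
proof -
  obtain u where "cmod u = 1" "\<And>z. z \<in> hyp_plane \<Longrightarrow> Mob (g b) (g z) = u * Mob b z"
    using assms unfolding direct_def by blast
  moreover from this have "u \<noteq> 0" by auto
  ultimately show ?thesis using that by blast
qed

lemma direct_compose:
  assumes "direct g" "direct h" shows "direct (g \<circ> h)"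
  unfolding direct_def
proof (intro conjI ballI)
  show "hyp_isometry (g \<circ> h)" using assms direct_isometry hyp_isometry_compose by blast
  fix b assume b: "b \<in> hyp_plane"
  note hin = hyp_isometry_in[OF direct_isometry[OF assms(2)]]
  obtain u where u: "cmod u = 1" "\<And>z. z \<in> hyp_plane \<Longrightarrow> Mob (h b) (h z) = u * Mob b z"
    using direct_unit[OF assms(2) b] by metis
  obtain u' where u': "cmod u' = 1" "\<And>z. z \<in> hyp_plane \<Longrightarrow> Mob (g (h b)) (g z) = u' * Mob (h b) z"
    using direct_unit[OF assms(1) hin[OF b]] by metis
  show "\<exists>u. cmod u = 1 \<and> (\<forall>z\<in>hyp_plane. Mob ((g \<circ> h) b) ((g \<circ> h) z) = u * Mob b z)"
    using u u' hin by (intro exI[of _ "u' * u"]) (simp add: norm_mult)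
qed

lemma direct_rotation:
  assumes "cmod u = 1" shows "direct (\<lambda>z. u * z)"
  unfolding direct_def
proof (intro conjI ballI)
  show "hyp_isometry (\<lambda>z. u * z)" by (rule hyp_isometry_rotation[OF assms])
  fix b
  have "cnj u * u = 1" using assms complex_norm_square[of u] by (simp add: mult.commute)
  then have "cnj (u * b) * (u * z) = cnj b * z" for z by (simp add: mult_ac)
  then have "Mob (u * b) (u * z) = u * Mob b z" for z
    unfolding Mob_def by (simp add: right_diff_distrib)
  then show "\<exists>w. cmod w = 1 \<and> (\<forall>z\<in>hyp_plane. Mob (u * b) (u * z) = w * Mob b z)"
    using assms by blast
qed

lemma direct_Mob:
  assumes a: "a \<in> hyp_plane" shows "direct (Mob a)"
  unfolding direct_def
proof (intro conjI ballI)
  show "hyp_isometry (Mob a)" by (rule hyp_isometry_Mob[OF a])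
  fix b assume b: "b \<in> hyp_plane"
  define A where "A = 1 - cnj a * b"
  have A0: "A \<noteq> 0" using Mob_denom[OF a b] by (simp add: A_def)
  then have A: "A \<noteq> 0" "cnj A \<noteq> 0" by simp_all
  have D: "1 - a * cnj a \<noteq> 0" using Mob_denom[OF a a] by (simp add: mult.commute)
  have r: "of_real (1 - (cmod a)\<^sup>2) = 1 - a * cnj a" using complex_norm_square[of a] by simp
  have "Mob (Mob a b) (Mob a z) = (cnj A / A) * Mob b z" if z: "z \<in> hyp_plane" for z
  proof -
    define Z where "Z = 1 - cnj a * z"
    have Z: "Z \<noteq> 0" using Mob_denom[OF a z] by (simp add: Z_def)
    have Q: "1 - cnj b * z \<noteq> 0" using Mob_denom[OF b z] .
    have 1: "Mob a z - Mob a b = (z - b) * (1 - a * cnj a) / (Z * A)"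
      using Mob_diff[OF a z b] unfolding r Z_def A_def .
    have 2: "1 - cnj (Mob a b) * Mob a z = (1 - a * cnj a) * (1 - cnj b * z) / (cnj A * Z)"
    proof -
      have "cnj (Mob a b) = (cnj b - cnj a) / cnj A" by (simp add: Mob_def A_def)
      moreover
      have gen: "1 - N / D = (D - N) / D" if "D \<noteq> 0" for N D :: complex
        using that by (simp add: diff_divide_distrib)
      moreover have "Mob a z = (z - a) / Z" by (simp add: Mob_def Z_def)
      ultimately have "1 - cnj (Mob a b) * Mob a z = (cnj A * Z - (cnj b - cnj a) * (z - a)) / (cnj A * Z)"
        using gen[of "cnj A * Z" "(cnj b - cnj a) * (z - a)"] A Z by (simp only: times_divide_times_eq) simp
      also have "cnj A * Z - (cnj b - cnj a) * (z - a) = (1 - a * cnj a) * (1 - cnj b * z)"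
        by (simp add: A_def Z_def algebra_simps)
      finally show ?thesis .
    qed
    show ?thesis
      unfolding Mob_def[of "Mob a b"] 1 2 unfolding Mob_def using A Z D Q by (simp add: divide_simps)
  qed
  moreover have "cmod (cnj A / A) = 1" using A by (simp add: norm_divide)
  ultimately show "\<exists>u. cmod u = 1 \<and> (\<forall>z\<in>hyp_plane. Mob (Mob a b) (Mob a z) = u * Mob b z)" by blast
qed

lemma direct_at_0:
  assumes "direct g" "b \<in> hyp_plane" "g b = 0"
  obtains u where "cmod u = 1" "u \<noteq> 0" "\<And>z. z \<in> hyp_plane \<Longrightarrow> g z = u * Mob b z"
  using direct_unit[OF assms(1,2)] assms(3) by (metis Mob_zero)

lemma Mob_eq_0_iff: "a \<in> hyp_plane \<Longrightarrow> z \<in> hyp_plane \<Longrightarrow> Mob a z = 0 \<longleftrightarrow> z = a"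
  using Mob_denom by (auto simp: Mob_def)

lemma Mob_inj: "a \<in> hyp_plane \<Longrightarrow> z \<in> hyp_plane \<Longrightarrow> w \<in> hyp_plane \<Longrightarrow> Mob a z = Mob a w \<longleftrightarrow> z = w"
  using hyp_isometry_eq_iff[OF hyp_isometry_Mob] by blast

lemma cmod_Mob_eq_iff_dist:
  assumes "a \<in> hyp_plane" "z \<in> hyp_plane" "b \<in> hyp_plane" "w \<in> hyp_plane"
  shows "cmod (Mob a z) = cmod (Mob b w) \<longleftrightarrow> hyp_dist a z = hyp_dist b w"
  using hyp_dist_0_eq_iff[of "Mob a z" "Mob b w"] Mob_dist[OF assms(1,1,2)] Mob_dist[OF assms(3,3,4)]
    Mob_in assms by simp

text \<open>Normal position for a pair of points: one at the centre, the other on the positive axis.\<close>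

lemma frame:
  assumes "a \<in> hyp_plane" "b \<in> hyp_plane" "a \<noteq> b"
  obtains F where "direct F" "F b = 0" "F a = of_real (cmod (Mob b a))" "0 < cmod (Mob b a)"
proof -
  let ?m = "Mob b a"
  define u where "u = cnj ?m / of_real (cmod ?m)"
  have m: "0 < cmod ?m" using assms Mob_eq_0_iff by auto
  then have u: "cmod u = 1" by (simp add: u_def norm_divide)
  have "u * ?m = of_real (cmod ?m)"
    using m complex_norm_square[of ?m] by (simp add: u_def power2_eq_square field_simps)
  then show ?thesis
    using that[of "(\<lambda>z. u * z) \<circ> Mob b"] m direct_compose[OF direct_rotation[OF u] direct_Mob[OF assms(2)]]
    by simp
qed

section \<open>Regular polygons are standard\<close>

lemma circuit_image:
  assumes "circuit vs n" "hyp_isometry g"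
  shows "circuit (map g vs) n" "circuit.v (map g vs) n i = g (circuit.v vs n i)"
proof -
  interpret circuit vs n by (rule assms(1))
  show c: "circuit (map g vs) n"
    using polygonal_circuit_isometry[OF assms(2) circuit] n by (simp add: circuit_def)
  then interpret c: circuit "map g vs" n .
  have "i mod n < length vs" using mod_lt[of i] by (simp only: n)
  then show "c.v i = g (v i)" by (simp add: v_def c.v_def)
qed

context circuit
begin

text \<open>The signed turning of the circuit at the vertex \<open>v (i + 1)\<close>, seen after moving it to the centre:
  for sides of equal length, a complex number of modulus one.\<close>

definition turn :: "nat \<Rightarrow> complex \<Rightarrow> bool" where
  "turn i \<tau> \<longleftrightarrow> Mob (v (Suc i)) (v (Suc (Suc i))) = \<tau> * Mob (v (Suc i)) (v i)"

lemma turn_unique: "turn i \<tau> \<Longrightarrow> turn i \<tau>' \<Longrightarrow> \<tau> = \<tau>'"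
  using Mob_eq_0_iff[of "v (Suc i)" "v i"] v_Suc_ne(1)[of i] by (auto simp: turn_def)

lemma turn_direct:
  assumes "direct F" "F (v (Suc i)) = 0"
  shows "turn i \<tau> \<longleftrightarrow> F (v (Suc (Suc i))) = \<tau> * F (v i)"
proof -
  obtain u where "u \<noteq> 0" "\<And>z. z \<in> hyp_plane \<Longrightarrow> F z = u * Mob (v (Suc i)) z"
    using direct_at_0[OF assms(1) v_in assms(2)] by metis
  then show ?thesis by (simp add: turn_def mult.left_commute[of \<tau>])
qed

lemma corner_sector_ex:
  assumes "v (Suc i) = 0" "0 < \<rho>"
    and "(v i = of_real \<rho> \<and> v (Suc (Suc i)) = w) \<or> (v (Suc (Suc i)) = of_real \<rho> \<and> v i = w)"
    and "cmod w = \<rho>" "0 < \<theta>" "\<theta> < pi" "has_inner_angle (polygon_of vs) 0 \<theta>"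
  shows "\<exists>\<sigma> \<epsilon>. (\<sigma> = 1 \<or> \<sigma> = (-1::real)) \<and> w = of_real \<rho> * cis (\<sigma> * \<theta>) \<and> 0 < \<epsilon> \<and>
    (\<forall>x. 0 < x \<longrightarrow> x < \<epsilon> \<longrightarrow> (\<exists>\<delta>>0. \<forall>z. dist z (of_real x) < \<delta> \<longrightarrow>
       (0 < \<sigma> * Im z \<longrightarrow> z \<in> polygon_of vs) \<and> (\<sigma> * Im z < 0 \<longrightarrow> z \<notin> polygon_of vs)))"
  by (rule corner_sector[OF assms]) blast

text \<open>The side between two consecutive vertices is viewed from both of its ends, in frames \<open>F\<close> and \<open>G\<close> that
  differ by the half turn \<open>H\<close> about its midpoint. In each frame \<open>corner_sector\<close> tells on which side of
  the axis the region lies. The half turn exchanges the two sides of the axis and the region does not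
  change sides along the segment, so the signs in the two frames are opposite; but in one frame the
  next vertex is on the axis and in the other the previous one, so the turns are equal.\<close>

lemma consecutive_turns:
  assumes len: "\<And>i. hyp_dist (v i) (v (Suc i)) = l"
    and \<theta>: "0 < \<theta>" "\<theta> < pi" and angle: "\<And>i. has_inner_angle (polygon_of vs) (v i) \<theta>"
  shows "\<exists>\<tau>. (\<tau> = cis \<theta> \<or> \<tau> = cis (- \<theta>)) \<and> turn i \<tau> \<and> turn (Suc i) \<tau>"
proof -
  let ?P = "polygon_of vs"
  define a b where "a = v (Suc i)" and "b = v (Suc (Suc i))"
  have ab: "a \<in> hyp_plane" "b \<in> hyp_plane" "b \<noteq> a" using v_Suc_ne by (auto simp: a_def b_def)
  define \<rho> where "\<rho> = cmod (Mob a b)"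
  obtain F where F: "direct F" "F a = 0" "F b = of_real \<rho>" and \<rho>: "0 < \<rho>"
    using frame[OF ab(2,1,3)] unfolding \<rho>_def by metis
  have Fiso: "hyp_isometry F" using F direct_isometry by blast
  have \<rho>D: "of_real \<rho> \<in> hyp_plane" using F(3) hyp_isometry_in[OF Fiso ab(2)] by simp
  then have \<rho>1: "\<rho> < 1" using \<rho> by (simp add: hyp_plane_iff)
  define H where "H = Mob (- of_real \<rho>) \<circ> (\<lambda>z. (- 1) * z)"
  have H: "direct H" unfolding H_def
    using \<rho>D by (intro direct_compose direct_rotation direct_Mob) simp_all
  have Hiso: "hyp_isometry H" using H direct_isometry by blast
  have Hz: "H z = (of_real \<rho> - z) / (1 - of_real \<rho> * z)" for z by (simp add: H_def Mob_def)
  have H0: "H (of_real \<rho>) = 0" "H 0 = of_real \<rho>" by (simp_all add: Hz)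
  define G where "G = H \<circ> F"
  have G: "direct G" "G b = 0" "G a = of_real \<rho>"
    using direct_compose[OF H F(1)] F H0 by (simp_all add: G_def)
  have Giso: "hyp_isometry G" using G direct_isometry by blast
  interpret cF: circuit "map F vs" n using circuit_image[OF circuit_axioms Fiso] by simp
  interpret cG: circuit "map G vs" n using circuit_image[OF circuit_axioms Giso] by simp
  have vF: "cF.v j = F (v j)" and vG: "cG.v j = G (v j)" for j
    using circuit_image[OF circuit_axioms Fiso] circuit_image[OF circuit_axioms Giso] by simp_all
  have PF: "polygon_of (map F vs) = F ` ?P" and PG: "polygon_of (map G vs) = G ` ?P"
    using polygon_of_isometry Fiso Giso vs_in by simp_all
  have \<rho>l: "hyp_dist 0 (of_real \<rho>) = l"
    using hyp_isometry_dist[OF Fiso ab(1,2)] F len[of "Suc i"] by (simp add: a_def b_def)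
  have nF: "cmod (F (v i)) = \<rho>"
  proof -
    have "hyp_dist 0 (F (v i)) = hyp_dist 0 (of_real \<rho>)"
      using hyp_isometry_dist[OF Fiso ab(1) v_in, of i] F(2) len[of i] \<rho>l hyp_dist_commute
      by (metis a_def)
    then show ?thesis using hyp_dist_0_eq_iff[OF hyp_isometry_in[OF Fiso v_in] \<rho>D] \<rho> by simp
  qed
  have nG: "cmod (G (v (Suc (Suc (Suc i))))) = \<rho>"
  proof -
    have "hyp_dist 0 (G (v (Suc (Suc (Suc i))))) = hyp_dist 0 (of_real \<rho>)"
      using hyp_isometry_dist[OF Giso ab(2) v_in, of "Suc (Suc (Suc i))"] G(2) len[of "Suc (Suc i)"] \<rho>l
      by (metis b_def)
    then show ?thesis using hyp_dist_0_eq_iff[OF hyp_isometry_in[OF Giso v_in] \<rho>D] \<rho> by simp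
  qed
  have aF: "has_inner_angle (polygon_of (map F vs)) 0 \<theta>"
    using has_inner_angle_isometry[OF Fiso polygon_of_subset angle[of "Suc i"]] F(2) PF by (simp add: a_def)
  have aG: "has_inner_angle (polygon_of (map G vs)) 0 \<theta>"
    using has_inner_angle_isometry[OF Giso polygon_of_subset angle[of "Suc (Suc i)"]] G(2) PG by (simp add: b_def)
  have pF: "cF.v (Suc i) = 0" "(cF.v i = of_real \<rho> \<and> cF.v (Suc (Suc i)) = F (v i)) \<or>
      (cF.v (Suc (Suc i)) = of_real \<rho> \<and> cF.v i = F (v i))"
    using F by (simp_all add: vF a_def b_def)
  have pG: "cG.v (Suc (Suc i)) = 0"
    "(cG.v (Suc i) = of_real \<rho> \<and> cG.v (Suc (Suc (Suc i))) = G (v (Suc (Suc (Suc i))))) \<or>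
      (cG.v (Suc (Suc (Suc i))) = of_real \<rho> \<and> cG.v (Suc i) = G (v (Suc (Suc (Suc i)))))"
    using G by (simp_all add: vG a_def b_def)
  obtain s1 e1 where s1: "s1 = 1 \<or> s1 = -1" "F (v i) = of_real \<rho> * cis (s1 * \<theta>)" "0 < e1"
    "\<And>x. 0 < x \<Longrightarrow> x < e1 \<Longrightarrow> \<exists>\<delta>>0. \<forall>z. dist z (of_real x) < \<delta> \<longrightarrow>
       (0 < s1 * Im z \<longrightarrow> z \<in> F ` ?P) \<and> (s1 * Im z < 0 \<longrightarrow> z \<notin> F ` ?P)"
    using cF.corner_sector_ex[OF pF(1) \<rho> pF(2) nF \<theta> aF] unfolding PF by blast
  obtain s2 e2 where s2: "s2 = 1 \<or> s2 = -1" "G (v (Suc (Suc (Suc i)))) = of_real \<rho> * cis (s2 * \<theta>)" "0 < e2"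
    "\<And>x. 0 < x \<Longrightarrow> x < e2 \<Longrightarrow> \<exists>\<delta>>0. \<forall>z. dist z (of_real x) < \<delta> \<longrightarrow>
       (0 < s2 * Im z \<longrightarrow> z \<in> G ` ?P) \<and> (s2 * Im z < 0 \<longrightarrow> z \<notin> G ` ?P)"
    using cG.corner_sector_ex[OF pG(1) \<rho> pG(2) nG \<theta> aG] unfolding PG by blast
  have t1: "turn i (cis (- (s1 * \<theta>)))"
    using turn_direct[OF F(1), of i] F s1(2) by (simp add: a_def b_def mult.left_commute cis_mult)
  have t2: "turn (Suc i) (cis (s2 * \<theta>))"
    using turn_direct[OF G(1), of "Suc i"] G s2(2) by (simp add: a_def b_def)
  have "s2 = - s1"
  proof (rule ccontr)
    assume "s2 \<noteq> - s1"
    then have eq: "s2 = s1" using s1(1) s2(1) by auto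
    define x where "x = min e1 \<rho> / 2"
    define y where "y = min e2 \<rho> / 2"
    have x: "0 < x" "x < e1" "x < \<rho>" and y: "0 < y" "y < e2" "y < \<rho>"
      using s1(3) s2(3) \<rho> by (auto simp: x_def y_def)
    \<comment> \<open>The half turn maps \<open>x'\<close> to \<open>y\<close>. So \<open>x\<close> and \<open>x'\<close> are near the two ends of the segment, within reach of
      the two local descriptions.\<close>
    define x' where "x' = (\<rho> - y) / (1 - \<rho> * y)"
    have y1: "y < 1" using y \<rho>1 by simp
    have d: "0 < 1 - \<rho> * y" using \<rho> \<rho>1 y y1 mult_strict_mono'[of \<rho> 1 y 1] by simp
    have x': "0 < x'" "x' < \<rho>"
    proof -
      show "0 < x'" unfolding x'_def using d y by simp
      have "\<rho> * \<rho> < 1" using \<rho> \<rho>1 mult_strict_mono'[of \<rho> 1 \<rho> 1] by simp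
      then have "\<rho> * (\<rho> * y) < 1 * y" using y mult_strict_right_mono[of "\<rho> * \<rho>" 1 y] by (simp add: mult.assoc)
      then have "\<rho> - y < \<rho> * (1 - \<rho> * y)" by (simp add: algebra_simps)
      then show "x' < \<rho>" unfolding x'_def using d by (simp add: divide_less_eq)
    qed
    have yD: "of_real y \<in> hyp_plane" using y y1 by (simp add: hyp_plane_iff)
    have x'D: "of_real x' \<in> hyp_plane" using x' \<rho>1 by (simp add: hyp_plane_iff)
    have Hx': "H (of_real x') = of_real y"
    proof -
      have "H (of_real x') = of_real ((\<rho> - x') / (1 - \<rho> * x'))" by (simp add: Hz)
      moreover have "(\<rho> - x') / (1 - \<rho> * x') = y"
      proof -
        have "\<rho> * \<rho> < 1" using \<rho> \<rho>1 mult_strict_mono'[of \<rho> 1 \<rho> 1] by simp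
        then have r: "1 - \<rho> * \<rho> \<noteq> 0" by simp
        have "\<rho> - x' = y * (1 - \<rho> * \<rho>) / (1 - \<rho> * y)" "1 - \<rho> * x' = (1 - \<rho> * \<rho>) / (1 - \<rho> * y)"
          unfolding x'_def using d by (simp_all add: field_simps)
        then show ?thesis using r d by simp
      qed
      ultimately show ?thesis by simp
    qed
    obtain \<delta>1 where d1: "0 < \<delta>1" "\<And>z. dist z (of_real x) < \<delta>1 \<Longrightarrow> 0 < s1 * Im z \<Longrightarrow> z \<in> F ` ?P"
      using s1(4)[OF x(1,2)] by blast
    obtain \<delta>2 where d2: "0 < \<delta>2" "\<And>z. dist z (of_real y) < \<delta>2 \<Longrightarrow> s2 * Im z < 0 \<Longrightarrow> z \<notin> G ` ?P"
      using s2(4)[OF y(1,2)] by blast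
    obtain \<delta>3 where d3: "0 < \<delta>3" "\<And>z1 z2. dist z1 (of_real x) < \<delta>3 \<Longrightarrow> dist z2 (of_real x') < \<delta>3 \<Longrightarrow>
       0 < s1 * Im z1 \<Longrightarrow> 0 < s1 * Im z2 \<Longrightarrow> z1 \<in> F ` ?P \<longleftrightarrow> z2 \<in> F ` ?P"
      using cF.same_side[of "Suc i" \<rho> x x' s1] F x x' s1(1) unfolding vF PF a_def b_def by metis
    have "isCont H (of_real x')"
      using continuous_on_interior[OF hyp_isometry_continuous[OF Hiso]] x'D open_hyp_plane
      by (simp add: interior_open)
    then obtain \<delta>4 where d4: "0 < \<delta>4" "\<And>z. dist z (of_real x') < \<delta>4 \<Longrightarrow> dist (H z) (of_real y) < \<delta>2"
      unfolding continuous_at_eps_delta Hx' using d2(1) by (metis dist_commute)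
    obtain \<delta>5 where d5: "0 < \<delta>5" "ball (of_real x') \<delta>5 \<subseteq> hyp_plane"
      using openE[OF open_hyp_plane x'D] by blast
    define \<eta> where "\<eta> = Min {\<delta>1, \<delta>3, \<delta>4, \<delta>5} / 2"
    have \<eta>: "0 < \<eta>" "\<eta> < \<delta>1" "\<eta> < \<delta>3" "\<eta> < \<delta>4" "\<eta> < \<delta>5"
      using d1(1) d3(1) d4(1) d5(1) unfolding \<eta>_def by auto
    \<comment> \<open>With equal signs, \<open>z2\<close> would be in the region by the first corner and outside by the second.\<close>
    define z1 where "z1 = of_real x + of_real (s1 * \<eta>) * \<i>"
    define z2 where "z2 = of_real x' + of_real (s1 * \<eta>) * \<i>"
    have ss: "s1 * s1 = 1" "\<bar>s1\<bar> = 1" using s1(1) by auto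
    have dz: "dist z1 (of_real x) = \<eta>" "dist z2 (of_real x') = \<eta>"
      using ss \<eta> by (simp_all add: z1_def z2_def dist_norm norm_mult abs_mult)
    have iz: "Im z1 = s1 * \<eta>" "Im z2 = s1 * \<eta>" by (simp_all add: z1_def z2_def)
    have piz: "0 < s1 * Im z1" "0 < s1 * Im z2" unfolding iz using ss \<eta> by (simp_all flip: mult.assoc)
    have "z1 \<in> F ` ?P" using d1(2) dz piz \<eta> by simp
    then have z2P: "z2 \<in> F ` ?P" using d3(2)[OF _ _ piz] dz \<eta> by simp
    have z2D: "z2 \<in> hyp_plane" using d5(2) dz \<eta> by (auto simp: subset_iff dist_commute)
    have "H z2 \<in> G ` ?P" using z2P by (auto simp: G_def)
    moreover have "dist (H z2) (of_real y) < \<delta>2" using d4(2) dz \<eta> by simp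
    moreover have "s2 * Im (H z2) < 0"
    proof -
      define E where "E = 1 - of_real \<rho> * z2"
      have "E \<noteq> 0" using Mob_denom[OF \<rho>D z2D] by (simp add: E_def)
      then have E: "0 < (cmod E)\<^sup>2" by simp
      have "H z2 = (of_real \<rho> - z2) * cnj E / of_real ((cmod E)\<^sup>2)"
        using \<open>E \<noteq> 0\<close> complex_norm_square[of E] by (simp add: Hz E_def[symmetric])
      then have "Im (H z2) = Im ((of_real \<rho> - z2) * cnj E) / (cmod E)\<^sup>2"
        by (simp only: Im_divide_of_real)
      also have "Im ((of_real \<rho> - z2) * cnj E) = - ((1 - \<rho> * \<rho>) * Im z2)"
        by (simp add: E_def algebra_simps)
      finally have im: "Im (H z2) = - ((1 - \<rho> * \<rho>) * Im z2) / (cmod E)\<^sup>2" .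
      have "s2 * Im (H z2) = - ((1 - \<rho> * \<rho>) * (s1 * Im z2) / (cmod E)\<^sup>2)"
        unfolding im eq by (simp only: mult_minus_right minus_divide_left[symmetric] times_divide_eq_right mult.left_commute)
      moreover have "\<rho> * \<rho> < 1" using \<rho> \<rho>1 mult_strict_mono'[of \<rho> 1 \<rho> 1] by simp
      then have "0 < (1 - \<rho> * \<rho>) * (s1 * Im z2) / (cmod E)\<^sup>2" using piz(2) E by simp
      ultimately show ?thesis by linarith
    qed
    ultimately show False using d2(2) by blast
  qed
  then have "turn (Suc i) (cis (- (s1 * \<theta>)))" using t2 by simp
  then show ?thesis using t1 s1(1) by (intro exI[of _ "cis (- (s1 * \<theta>))"]) auto
qed

lemma constant_turn:
  assumes len: "\<And>i. hyp_dist (v i) (v (Suc i)) = l"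
    and \<theta>: "0 < \<theta>" "\<theta> < pi" and angle: "\<And>i. has_inner_angle (polygon_of vs) (v i) \<theta>"
  shows "\<exists>\<tau>. (\<tau> = cis \<theta> \<or> \<tau> = cis (- \<theta>)) \<and> (\<forall>i. turn i \<tau>)"
proof -
  note ct = consecutive_turns[OF len \<theta> angle]
  obtain \<tau> where \<tau>: "\<tau> = cis \<theta> \<or> \<tau> = cis (- \<theta>)" "turn 0 \<tau>" using ct[of 0] by blast
  have "turn i \<tau>" for i
  proof (induction i)
    case (Suc i)
    then show ?case using ct[of i] turn_unique by blast
  qed (use \<tau> in simp)
  then show ?thesis using \<tau> by blast
qed

text \<open>A side, its length and the turn at its end determine the next vertex, so the direct isometry that
  moves the first side to the second one moves every vertex to its successor.\<close>

lemma cyclic_isometry: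
  assumes len: "\<And>i. hyp_dist (v i) (v (Suc i)) = l" and turn: "\<And>i. turn i \<tau>"
  shows "\<exists>g. direct g \<and> (\<forall>i. g (v i) = v (Suc i))"
proof -
  define a0 a1 where "a0 = Mob (v 0) (v 1)" and "a1 = Mob (v 1) (v 2)"
  have n01: "cmod a0 = cmod a1"
    unfolding a0_def a1_def using cmod_Mob_eq_iff_dist[of "v 0" "v 1" "v 1" "v 2"] len[of 0] len[of 1]
    by (simp add: numeral_2_eq_2)
  have a0: "a0 \<noteq> 0" using Mob_eq_0_iff v_Suc_ne(1)[of 0] by (simp add: a0_def)
  define u where "u = a1 / a0"
  have "cmod a1 \<noteq> 0" using n01 a0 by (metis norm_eq_zero)
  then have u: "cmod u = 1" using n01 by (simp add: u_def norm_divide)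
  define g where "g = Mob (- v 1) \<circ> (\<lambda>z. u * z) \<circ> Mob (v 0)"
  have g: "direct g" unfolding g_def by (intro direct_compose direct_rotation[OF u] direct_Mob) simp_all
  note giso = direct_isometry[OF g]
  have g0: "g (v 0) = v 1" by (simp add: g_def Mob_at_0)
  have g1: "g (v 1) = v 2"
  proof -
    have "g (v 1) = Mob (- v 1) a1" unfolding g_def comp_def a0_def[symmetric] u_def using a0 by simp
    then show ?thesis unfolding a1_def by (simp add: Mob_inverse)
  qed
  have "g (v i) = v (Suc i) \<and> g (v (Suc i)) = v (Suc (Suc i))" for i
  proof (induction i)
    case 0 then show ?case using g0 g1 by (simp add: numeral_2_eq_2)
  next
    case (Suc i)
    then have IH: "g (v i) = v (Suc i)" "g (v (Suc i)) = v (Suc (Suc i))" by auto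
    obtain w where w: "\<And>z. z \<in> hyp_plane \<Longrightarrow> Mob (g (v (Suc i))) (g z) = w * Mob (v (Suc i)) z"
      using direct_unit[OF g v_in] by metis
    have "Mob (v (Suc (Suc i))) (g (v (Suc (Suc i)))) = w * (\<tau> * Mob (v (Suc i)) (v i))"
      using w[of "v (Suc (Suc i))"] turn[of i] IH by (simp add: turn_def)
    also have "\<dots> = \<tau> * Mob (v (Suc (Suc i))) (v (Suc i))"
      using w[of "v i"] IH by (simp add: mult.left_commute)
    also have "\<dots> = Mob (v (Suc (Suc i))) (v (Suc (Suc (Suc i))))"
      using turn[of "Suc i"] by (simp add: turn_def)
    finally show ?case using Mob_inj hyp_isometry_in[OF giso] IH by simp
  qed
  then show ?thesis using g by blast
qed

text \<open>The sum of the vertices on the hyperboloid is a timelike vector; its direction is the centre of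
  mass \<open>c\<close>. The sum of \<open>cosh\<close> of the distances from the vertices is a multiple of \<open>cosh\<close> of the distance
  from \<open>c\<close>, so \<open>c\<close> is its only minimum, and an isometry permuting the vertices has to fix it.\<close>

lemma centre:
  assumes g: "hyp_isometry g" and gv: "\<And>i. g (v i) = v (Suc i)"
  obtains c where "c \<in> hyp_plane" "g c = c"
proof -
  define T where "T = (\<Sum>i<n. hT (v i))"
  define Z where "Z = (\<Sum>i<n. hX (v i))"
  have lt: "cmod (hX z) < hT z" if "z \<in> hyp_plane" for z
  proof (rule power2_less_imp_less)
    show "(cmod (hX z))\<^sup>2 < (hT z)\<^sup>2" using hT_hX_unit[OF that] by simp
    show "0 \<le> hT z" using hT_ge_1[OF that] by simp
  qed
  have "cmod Z \<le> (\<Sum>i<n. cmod (hX (v i)))" unfolding Z_def by (rule norm_sum)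
  also have "\<dots> < T" unfolding T_def using n3 lt by (intro sum_strict_mono) (auto simp: lessThan_empty_iff)
  finally obtain c k where c: "c \<in> hyp_plane" "0 < k" "T = k * hT c" "Z = of_real k * hX c"
    by (rule timelike_direction)
  have S: "(\<Sum>i<n. cosh (hyp_dist (v i) z)) = k * cosh (hyp_dist c z)" if z: "z \<in> hyp_plane" for z
  proof -
    have "(\<Sum>i<n. cosh (hyp_dist (v i) z)) = T * hT z - Re (Z * cnj (hX z))"
      unfolding T_def Z_def using z by (simp add: cosh_hyp_dist sum_subtractf sum_distrib_right)
    also have "\<dots> = k * cosh (hyp_dist c z)"
      using c z by (simp add: cosh_hyp_dist algebra_simps)
    finally show ?thesis .
  qed
  have gc: "g c \<in> hyp_plane" using hyp_isometry_in[OF g c(1)] .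
  have vn: "v n = v 0" using v_add_n[of 0] unfolding add_0 .
  have cyc: "(\<Sum>i<n. f (v (Suc i))) = (\<Sum>i<n. f (v i))" for f :: "complex \<Rightarrow> real"
  proof -
    have "(\<Sum>i<n. f (v (Suc i))) + f (v 0) = (\<Sum>i<Suc n. f (v i))" by (simp only: sum.lessThan_Suc_shift add.commute)
    also have "\<dots> = (\<Sum>i<n. f (v i)) + f (v 0)"
      unfolding sum.lessThan_Suc vn ..
    finally show ?thesis by simp
  qed
  have "k * cosh (hyp_dist c (g c)) = (\<Sum>i<n. cosh (hyp_dist (v (Suc i)) (g c)))"
    using S[OF gc] cyc[of "\<lambda>x. cosh (hyp_dist x (g c))"] by simp
  also have "\<dots> = (\<Sum>i<n. cosh (hyp_dist (v i) c))"
    using hyp_isometry_dist[OF g _ c(1)] by (simp flip: gv)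
  also have "\<dots> = k * cosh (hyp_dist c c)" by (rule S[OF c(1)])
  finally have "cosh (hyp_dist c (g c)) = cosh (hyp_dist c c)" using c(2) by simp
  then have "hyp_dist c (g c) = hyp_dist c c"
    using arcosh_cosh_real[OF hyp_dist_nonneg[OF c(1) gc]] arcosh_cosh_real[OF hyp_dist_nonneg[OF c(1) c(1)]]
    by metis
  then have "g c = c" using hyp_dist_eq_0_iff c(1) gc by metis
  then show ?thesis using that c by blast
qed

text \<open>Excluding star polygons. If \<open>u\<close> is the rotation by \<open>2 k \<beta>\<close> with \<open>\<beta> = pi / n\<close> and \<open>2 \<le> k \<le> n - 2\<close>, the
  distinct powers of \<open>u\<close> are all the \<open>n\<close>-th roots of unity, so some vertex \<open>v j\<close> is obtained from \<open>v 0\<close> by the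
  smallest rotation \<open>\<omega>\<close>. The sides starting at \<open>v 0\<close> and at \<open>v j\<close> then cross: they are mirror images of
  each other, and the point with weights \<open>s\<close> and \<open>t\<close> is on the axis of symmetry.\<close>

lemma rotation_orbit_turn:
  assumes orb: "\<And>i. v i = w0 * u ^ i"
  shows "u = cis (2 * pi / n) \<or> u = cis (- (2 * pi / n))"
proof -
  have w0: "w0 \<in> hyp_plane" using orb[of 0] v_in[of 0] by simp
  have w00: "w0 \<noteq> 0" using orb[of 0] orb[of 1] v_Suc_ne(1)[of 0] by auto
  have un: "u ^ n = 1" using orb[of n] orb[of 0] v_add_n[of 0] w00 by simp
  then have "cmod u ^ n = 1" by (metis norm_one norm_power)
  then have u1: "cmod u = 1" using n3 power_eq_imp_eq_base[of "cmod u" n 1] by simp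
  have n0: "0 < n" using n3 by linarith
  define \<beta> where "\<beta> = pi / n"
  have n\<beta>: "real n * \<beta> = pi" using n3 by (simp add: \<beta>_def)
  have \<beta>: "0 < \<beta>" using n3 by (simp add: \<beta>_def)
  have roots: "z \<in> (\<lambda>k. cis (2 * (real k * \<beta>))) ` {..<n}" if "z ^ n = 1" for z
  proof -
    have "z \<in> {z. z ^ n = 1}" using that by simp
    also have "{z. z ^ n = 1} = (\<lambda>k. cis (2 * pi * real k / real n)) ` {..<n}"
      by (rule bij_betw_imp_surj_on[OF Complex.bij_betw_roots_unity[OF n0], symmetric])
    finally show ?thesis by (auto simp: \<beta>_def mult_ac)
  qed
  obtain k where k: "k < n" "u = cis (2 * (real k * \<beta>))" using roots[OF un] by blast
  have inj: "inj_on (\<lambda>i. u ^ i) {..<n}"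
    by (rule inj_onI) (use orb v_eq_iff in \<open>metis lessThan_iff mod_less\<close>)
  have fin: "finite {z::complex. z ^ n = 1}" "card {z::complex. z ^ n = 1} = n"
    using Complex.card_roots_unity_eq[OF n0] card_ge_0_finite[of "{z::complex. z ^ n = 1}"] n0
    by (simp_all only:)
  have "(\<lambda>i. u ^ i) ` {..<n} \<subseteq> {z. z ^ n = 1}"
    using un by (auto simp flip: power_mult) (metis mult.commute power_mult power_one)
  then have all: "(\<lambda>i. u ^ i) ` {..<n} = {z. z ^ n = 1}"
    using card_subset_eq[OF fin(1)] card_image[OF inj] fin(2) by simp
  have le: "real j * \<beta> \<le> pi" if "j \<le> n" for j
    using mult_right_mono[of "real j" "real n" \<beta>] that n\<beta> \<beta> by simp
  have lt: "real j * \<beta> < pi" if "j < n" for j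
    using mult_strict_right_mono[of "real j" "real n" \<beta>] that n\<beta> \<beta> by simp
  consider "k = 0" | "k = 1" | "k = n - 1" | "2 \<le> k" "k + 2 \<le> n" using k(1) by linarith
  then show ?thesis
  proof cases
    case 1
    then have "v 1 = v 0" using orb[of 0] orb[of 1] k by simp
    then show ?thesis using v_Suc_ne(1)[of 0] by simp
  next
    case 2
    then show ?thesis using k by (simp add: \<beta>_def)
  next
    case 3
    have "2 * (real k * \<beta>) = - (2 * \<beta>) + 2 * pi" using 3 n3 n\<beta> by (simp add: of_nat_diff algebra_simps)
    then have "u = cis (- (2 * \<beta>)) * cis (2 * pi)" unfolding k(2) by (simp only: cis_mult)
    then show ?thesis by (simp add: \<beta>_def)
  next
    case 4
    define \<omega> where "\<omega> = cis (2 * \<beta>)"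
    define \<gamma> where "\<gamma> = real k * \<beta>"
    have u\<gamma>: "u = cis (2 * \<gamma>)" using k by (simp add: \<gamma>_def)
    have "real n * (2 * \<beta>) = 2 * pi" by (simp flip: n\<beta>)
    then have "\<omega> ^ n = 1" unfolding \<omega>_def Complex.DeMoivre by (simp only: cis_2pi)
    then obtain j where j: "j < n" "u ^ j = \<omega>" using all by (metis (mono_tags, lifting) imageE lessThan_iff mem_Collect_eq)
    \<comment> \<open>Barycentric weights of the crossing point on the two sides.\<close>
    define s where "s = sin (\<gamma> - \<beta>)"
    define t where "t = sin (\<beta> + \<gamma>)"
    have gb: "\<gamma> - \<beta> = real (k - 1) * \<beta>" "\<beta> + \<gamma> = real (k + 1) * \<beta>"
      using 4 by (simp_all add: \<gamma>_def of_nat_diff algebra_simps)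
    have st: "0 < s" "0 < t"
      unfolding s_def t_def gb using lt[of "k - 1"] lt[of "k + 1"] 4 \<beta> by (auto intro!: sin_gt_zero)
    have key: "of_real s + of_real t * u = of_real s * (\<omega> * u) + of_real t * \<omega>"
    proof -
      have "of_real s * (1 - \<omega> * u) = of_real t * (\<omega> - u)"
      proof (rule complex_eqI)
        have "\<omega> * u = cis (2 * (\<beta> + \<gamma>))" by (simp add: \<omega>_def u\<gamma> cis_mult algebra_simps)
        moreover have "1 - cis (2 * x) = - 2 * \<i> * of_real (sin x) * cis x" for x
          by (simp add: complex_eq_iff cos_double_sin sin_double power2_eq_square)
        ultimately have A: "1 - \<omega> * u = - 2 * \<i> * of_real t * cis (\<beta> + \<gamma>)" by (simp only: t_def)
        have "\<omega> - u = \<omega> * (1 - cis (2 * (\<gamma> - \<beta>)))"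
          by (simp add: \<omega>_def u\<gamma> right_diff_distrib cis_mult algebra_simps)
        also have "1 - cis (2 * (\<gamma> - \<beta>)) = - 2 * \<i> * of_real s * cis (\<gamma> - \<beta>)"
          using \<open>\<And>x. 1 - cis (2 * x) = - 2 * \<i> * of_real (sin x) * cis x\<close> by (simp only: s_def)
        also have "\<omega> * (- 2 * \<i> * of_real s * cis (\<gamma> - \<beta>)) = - 2 * \<i> * of_real s * cis (\<beta> + \<gamma>)"
        proof -
          have "\<omega> * cis (\<gamma> - \<beta>) = cis (\<beta> + \<gamma>)" by (simp add: \<omega>_def cis_mult)
          then show ?thesis by (metis mult.left_commute)
        qed
        finally have B: "\<omega> - u = - 2 * \<i> * of_real s * cis (\<beta> + \<gamma>)" .
        show "Re (of_real s * (1 - \<omega> * u)) = Re (of_real t * (\<omega> - u))" unfolding A B by simp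
        show "Im (of_real s * (1 - \<omega> * u)) = Im (of_real t * (\<omega> - u))" unfolding A B by simp
      qed
      then show ?thesis by (simp add: algebra_simps)
    qed
    have hTv: "hT (v i) = hT w0" for i by (simp add: orb hT_def norm_mult norm_power u1)
    have hXv: "hX (v i) = hX w0 * u ^ i" for i by (simp add: orb hX_def norm_mult norm_power u1)
    have "cmod (of_real (s / (s + t)) * hX (v 0) + of_real (t / (s + t)) * hX (v 1)) \<le> cmod (hX w0)"
    proof -
      have "cmod (of_real (s / (s + t)) * hX (v 0) + of_real (t / (s + t)) * hX (v 1))
         \<le> s / (s + t) * cmod (hX w0) + t / (s + t) * cmod (hX w0)"
        using norm_triangle_ineq[of "of_real (s / (s + t)) * hX (v 0)" "of_real (t / (s + t)) * hX (v 1)"] st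
        unfolding norm_mult norm_of_real hXv by (simp add: u1 norm_mult)
      also have "\<dots> = (s / (s + t) + t / (s + t)) * cmod (hX w0)" by (simp only: distrib_right)
      also have "s / (s + t) + t / (s + t) = 1" using st by (simp flip: add_divide_distrib)
      finally show ?thesis by simp
    qed
    also have "cmod (hX w0) < hT w0"
      by (rule power2_less_imp_less) (use hT_hX_unit[OF w0] hT_ge_1[OF w0] in auto)
    finally obtain x m where x: "x \<in> hyp_plane" "0 < m" "hT w0 = m * hT x"
      "of_real (s / (s + t)) * hX (v 0) + of_real (t / (s + t)) * hX (v 1) = of_real m * hX x"
      by (rule timelike_direction)
    define s' where "s' = s / ((s + t) * m)"
    define t' where "t' = t / ((s + t) * m)"
    have st': "0 \<le> s'" "0 \<le> t'" using st x by (simp_all add: s'_def t'_def)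
    have Tx: "hT x = s' * hT w0 + t' * hT w0"
    proof -
      have "s' + t' = 1 / m" using st x(2) by (simp add: s'_def t'_def divide_simps)
      then have "(s' + t') * hT w0 = hT x" using x(2,3) by simp
      then show ?thesis by (simp add: distrib_right)
    qed
    have Xx: "hX x = of_real s' * hX (v 0) + of_real t' * hX (v 1)"
    proof -
      have "hX x = (of_real (s / (s + t)) * hX (v 0) + of_real (t / (s + t)) * hX (v 1)) / of_real m"
        unfolding x(4) using x(2) by simp
      then show ?thesis by (simp add: s'_def t'_def add_divide_distrib)
    qed
    have Xx': "hX x = of_real t' * hX (v j) + of_real s' * hX (v (Suc j))"
    proof -
      define q where "q = complex_of_real (1 / ((s + t) * m))"
      have c: "of_real s' = of_real s * q" "of_real t' = of_real t * q"
        by (simp_all add: s'_def t'_def q_def)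
      have "hX x = q * hX w0 * (of_real s + of_real t * u)"
        unfolding Xx c hXv by (simp add: algebra_simps)
      also have "\<dots> = of_real t' * hX (v j) + of_real s' * hX (v (Suc j))"
        unfolding key c hXv using j(2) by (simp add: algebra_simps)
      finally show ?thesis .
    qed
    have "x \<in> sv 0" unfolding sv_def geodesic_segment_iff_lorentz[OF v_in v_in x(1)] lorentz_comb_def hTv
      using st' Tx Xx by auto
    moreover have "x \<in> sv j" unfolding sv_def geodesic_segment_iff_lorentz[OF v_in v_in x(1)] lorentz_comb_def hTv
      using st' Tx Xx' by (intro exI[of _ t'] exI[of _ s']) simp
    moreover have "cis (2 * y) \<noteq> 1" if "0 < y" "y < pi" for y
    proof
      assume "cis (2 * y) = 1"
      then have "1 - 2 * (sin y)\<^sup>2 = 1" using cos_double_sin[of y] by (metis cis.sel(1) one_complex.sel(1))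
      then have "sin y = 0" by simp
      then show False using sin_gt_zero[OF that] by simp
    qed
    note ne = this
    have b1: "\<omega> \<noteq> 1" using ne[of \<beta>] \<beta> lt[of 1] n3 by (simp add: \<omega>_def)
    have b2: "\<omega> * u \<noteq> 1"
    proof -
      have "\<omega> * u = cis (2 * (\<beta> + \<gamma>))" by (simp add: \<omega>_def u\<gamma> cis_mult algebra_simps)
      moreover have "0 < \<beta> + \<gamma>" "\<beta> + \<gamma> < pi" unfolding gb using lt[of "k + 1"] 4 \<beta> by auto
      ultimately show ?thesis using ne by metis
    qed
    have b3: "\<omega> \<noteq> u"
    proof
      assume "\<omega> = u"
      then have "cis (2 * (\<gamma> - \<beta>)) = 1"
        by (simp add: \<omega>_def u\<gamma> right_diff_distrib flip: cis_divide)
      then show False using ne[of "\<gamma> - \<beta>"] lt[of "k - 1"] 4 \<beta> gb by auto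
    qed
    have u0: "u \<noteq> 0" using u1 by auto
    have "j \<noteq> 0" using b1 j(2) by (metis power_0)
    then have "sv 0 \<inter> sv j \<subseteq> {v 0, v (Suc 0)} \<inter> {v j, v (Suc j)}" using sv_inter[of 0 j] j by simp
    moreover have "{v 0, v (Suc 0)} \<inter> {v j, v (Suc j)} = {}"
      using b1 b2 b3 w00 u0 j(2) by (auto simp: orb mult.commute)
    ultimately show ?thesis using \<open>x \<in> sv 0\<close> by blast
  qed
qed

end

lemma (in standard_polygon) circuit_verts: "circuit verts p" "circuit.v verts p i = vert (int i)"
proof -
  show c: "circuit verts p" by (simp add: circuit_def polygonal_circuit_verts)
  show "circuit.v verts p i = vert (int i)" unfolding circuit.v_def[OF c] by (rule verts_mod)
qed

text \<open>Both angles determine the same turn at a vertex.\<close>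

lemma (in standard_polygon) inner_angle_unique:
  assumes \<theta>: "0 < \<theta>" "\<theta> < pi" and angle: "\<And>j. has_inner_angle tile (vert j) \<theta>"
  shows "\<theta> = 2 * half_angle"
proof -
  interpret c: circuit verts p by (rule circuit_verts)
  have len: "hyp_dist (c.v i) (c.v (Suc i)) = hyp_dist (vert 0) (vert 1)" for i
    using verts_equilateral[of "int i"] by (simp add: circuit_verts add.commute)
  define \<psi> where "\<psi> = 2 * half_angle"
  have h: "0 < \<psi>" "\<psi> < pi" using half_angle(1,2) by (simp_all add: \<psi>_def)
  have a: "has_inner_angle (polygon_of verts) (c.v i) \<theta>"
    "has_inner_angle (polygon_of verts) (c.v i) \<psi>" for i
    using angle tile_inner_angle by (simp_all add: circuit_verts polygon_of_verts \<psi>_def)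
  obtain \<tau> where \<tau>: "\<tau> = cis \<theta> \<or> \<tau> = cis (- \<theta>)" "\<And>i. c.turn i \<tau>"
    using c.constant_turn[OF len \<theta> a(1)] by blast
  obtain \<tau>' where \<tau>': "\<tau>' = cis \<psi> \<or> \<tau>' = cis (- \<psi>)" "\<And>i. c.turn i \<tau>'"
    using c.constant_turn[OF len h a(2)] by blast
  have "\<tau> = \<tau>'" by (rule c.turn_unique[of 0]) (simp_all only: \<tau>(2) \<tau>'(2))
  moreover have "Re \<tau> = cos \<theta>" using \<tau>(1) by (rule disjE) simp_all
  moreover have "Re \<tau>' = cos \<psi>" using \<tau>'(1) by (rule disjE) simp_all
  ultimately have "cos \<theta> = cos \<psi>" by (simp only:)
  then have "\<theta> = \<psi>" using cos_inj_pi[of \<theta> \<psi>] \<theta> h by linarith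
  then show ?thesis by (simp only: \<psi>_def)
qed

theorem regular_polygon_is_standard:
  assumes P: "regular_polygon_with p \<theta> P" and \<theta>: "0 < \<theta>" "\<theta> < pi"
  obtains R h where "standard_polygon p R" "hyp_isometry h" "h ` P = standard_polygon.tile p R"
    "\<theta> = 2 * standard_polygon.half_angle p R"
proof -
  obtain vs l where vs: "polygonal_circuit vs" "length vs = p" "P = polygon_of vs"
    and len: "\<And>i. i < p \<Longrightarrow> hyp_dist (vs ! i) (vs ! (Suc i mod p)) = l"
    and angle: "\<And>v. v \<in> set vs \<Longrightarrow> has_inner_angle P v \<theta>"
    using P unfolding regular_polygon_with_def by blast
  interpret circuit vs p using vs by (simp add: circuit_def)
  have vset: "v i \<in> set vs" for i using mod_lt[of i] vs(2) by (simp add: v_def)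
  have len': "hyp_dist (v i) (v (Suc i)) = l" for i
    using len[OF mod_lt[of i]] by (simp add: v_def mod_Suc_eq)
  have angle': "has_inner_angle (polygon_of vs) (v i) \<theta>" for i using angle[OF vset] vs(3) by simp
  obtain \<tau> where \<tau>: "\<And>i. turn i \<tau>" using constant_turn[OF len' \<theta> angle'] by blast
  obtain g where g: "direct g" "\<And>i. g (v i) = v (Suc i)" using cyclic_isometry[OF len' \<tau>] by blast
  obtain c where c: "c \<in> hyp_plane" "g c = c" by (rule centre[OF direct_isometry[OF g(1)] g(2)])
  define G where "G = Mob c \<circ> g \<circ> Mob (- c)"
  have G: "direct G" unfolding G_def using c by (intro direct_compose direct_Mob g(1)) simp_all
  have "G 0 = 0" by (simp add: G_def Mob_at_0 c)
  then obtain u where u: "\<And>z. z \<in> hyp_plane \<Longrightarrow> G z = u * z"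
    using direct_at_0[OF G zero_in_hyp_plane] by (metis Mob_zero)
  note ci = circuit_image[OF circuit_axioms hyp_isometry_Mob[OF c(1)]]
  interpret c1: circuit "map (Mob c) vs" p by (rule ci(1))
  define w0 where "w0 = Mob c (v 0)"
  have orb: "Mob c (v i) = w0 * u ^ i" for i
  proof (induction i)
    case (Suc i)
    have "Mob c (v (Suc i)) = G (Mob c (v i))" using g(2) c by (simp add: G_def Mob_inverse)
    also have "\<dots> = u * Mob c (v i)" using u Mob_in[OF c(1)] by simp
    finally show ?case using Suc by simp
  qed (simp add: w0_def)
  have "u = cis (2 * pi / p) \<or> u = cis (- (2 * pi / p))"
    using c1.rotation_orbit_turn[of w0 u] ci(2) orb by simp
  \<comment> \<open>If the vertices run clockwise, complex conjugation reverses their order.\<close>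
  then obtain k where k: "hyp_isometry k" "\<And>i. k (w0 * u ^ i) = k w0 * cis (2 * pi / p) ^ i"
    "cmod (k w0) = cmod w0"
  proof
    assume "u = cis (2 * pi / p)"
    then show ?thesis using that[of id] hyp_isometry_id by simp
  next
    assume "u = cis (- (2 * pi / p))"
    then have "cnj u = cis (2 * pi / p)" by (simp add: cis_cnj)
    then show ?thesis using that[of cnj] hyp_isometry_cnj by simp
  qed
  define R where "R = cmod w0"
  have w00: "w0 \<noteq> 0" using orb[of 0] orb[of 1] v_Suc_ne(1)[of 0] Mob_inj[OF c(1) v_in v_in, of 1 0] by auto
  have "w0 \<in> hyp_plane" unfolding w0_def using Mob_in[OF c(1)] by simp
  then have R: "0 < R" "R < 1" using w00 by (auto simp: R_def hyp_plane_iff)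
  interpret standard_polygon p R using R n3 by unfold_locales
  define e where "e = of_real R * cis al / k w0"
  have kw0: "k w0 \<noteq> 0" using k(3) w00 by auto
  have e: "cmod e = 1" using R k(3) w00 by (simp add: e_def norm_divide norm_mult R_def)
  define h where "h = (\<lambda>z. e * z) \<circ> k \<circ> Mob c"
  have h: "hyp_isometry h" unfolding h_def
    by (intro hyp_isometry_compose hyp_isometry_rotation[OF e] k(1) hyp_isometry_Mob c(1))
  have "h (v i) = vert (int i)" for i
  proof -
    have "h (v i) = of_real R * (cis al * cis (2 * pi / p) ^ i)"
      using kw0 by (simp add: h_def orb k(2) e_def)
    also have "cis al * cis (2 * pi / p) ^ i = cis (real_of_int (2 * int i + 1) * al)"
      unfolding Complex.DeMoivre cis_mult by (simp add: al_def algebra_simps)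
    finally show ?thesis by (simp add: vert_def)
  qed
  then have "h (vs ! i) = vert (int i)" if "i < p" for i
    using that by (metis v_def mod_less)
  then have "map h vs = verts"
    using vs(2) by (intro nth_equalityI) (simp_all add: verts_nth)
  then have tile: "h ` P = tile"
    using polygon_of_isometry[OF h vs_in] vs(3) polygon_of_verts by simp
  have "has_inner_angle tile (vert j) \<theta>" for j
  proof -
    have "vert j \<in> h ` set vs" using \<open>map h vs = verts\<close> set_verts by (metis list.set_map rangeI)
    then obtain x where x: "x \<in> set vs" "vert j = h x" by blast
    then show ?thesis
      using has_inner_angle_isometry[OF h _ angle[OF x(1)]] polygon_of_subset vs(3) tile by simp
  qed
  then have "\<theta> = 2 * half_angle" by (intro inner_angle_unique \<theta>)
  then show ?thesis using that standard_polygon_axioms h tile by blast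
qed


section \<open>The triangle group\<close>

datatype mirror = M1 | M2 | M3

lemma mirror_all: "(\<forall>s. P s) \<longleftrightarrow> P M1 \<and> P M2 \<and> P M3"
  by (metis mirror.exhaust)

text \<open>The chamber is the triangle with vertices at the centre of the polygon, the midpoint of the side
  with direction \<open>0\<close> and the vertex \<open>vert 0\<close>. \<open>M1\<close> is its side on the real axis, \<open>M2\<close> the side on the
  radius through the vertex, and \<open>M3\<close> the side on the edge of the polygon.\<close>

locale triangle = standard_polygon +
  fixes q :: nat
  assumes q3: "3 \<le> q" and angle: "half_angle = pi / real q"
begin

text \<open>\<open>\<kappa>\<close> is the Lorentz length of the normal vector \<open>(apo, 1)\<close> of an edge.\<close>

definition \<kappa> :: real where "\<kappa> = sqrt (1 - apo\<^sup>2)"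

lemma \<kappa>: "0 < \<kappa>" "\<kappa>\<^sup>2 = 1 - apo\<^sup>2" "cos half_angle * \<kappa> = sin al"
proof -
  have c: "0 < cos half_angle" using half_angle by (intro cos_gt_zero) auto
  have "0 < (cos half_angle)\<^sup>2 * (1 - apo\<^sup>2)" unfolding cos_half_angle using sin_al by simp
  then have p: "0 < 1 - apo\<^sup>2" using c by (simp add: zero_less_mult_iff)
  then show k: "0 < \<kappa>" "\<kappa>\<^sup>2 = 1 - apo\<^sup>2" by (simp_all add: \<kappa>_def)
  have "(cos half_angle * \<kappa>)\<^sup>2 = (sin al)\<^sup>2" using cos_half_angle k by (simp add: power_mult_distrib)
  then show "cos half_angle * \<kappa> = sin al" using c k(1) sin_al by (simp add: power2_eq_iff_nonneg)
qed

lemma apo1: "apo < 1"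
proof -
  have "0 < \<kappa>\<^sup>2" using \<kappa>(1) by simp
  then have "apo\<^sup>2 < 1" unfolding \<kappa>(2) by simp
  then show ?thesis using apo by (simp add: power_less_one_iff)
qed

lemma apo_in: "complex_of_real apo \<in> hyp_plane" using apo apo1 by (simp add: hyp_plane_iff)

definition mir :: "mirror \<Rightarrow> complex \<Rightarrow> complex" where
  "mir s z = (if z \<in> hyp_plane then
     (case s of M1 \<Rightarrow> cnj z | M2 \<Rightarrow> cis (2 * al) * cnj z | M3 \<Rightarrow> (- 1) * Mob (of_real apo) (cnj z)) else z)"

text \<open>Time and space parts of the unit normals of the three mirrors, pointing away from the chamber.\<close>

fun nT :: "mirror \<Rightarrow> real" where "nT M1 = 0" | "nT M2 = 0" | "nT M3 = apo / \<kappa>"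
fun nX :: "mirror \<Rightarrow> complex" where "nX M1 = - \<i>" | "nX M2 = Complex (- sin al) (cos al)" | "nX M3 = of_real (1 / \<kappa>)"

text \<open>Minus the Lorentz product with the unit normal, so positive inside the chamber. Outside the disc it
  is zero, which is consistent with the generators being the identity there.\<close>

definition mfun :: "mirror \<Rightarrow> complex \<Rightarrow> real" where
  "mfun s z = (if z \<in> hyp_plane then nT s * hT z - Re (hX z * cnj (nX s)) else 0)"

fun mord :: "mirror \<Rightarrow> mirror \<Rightarrow> nat" where
  "mord M1 M2 = p" | "mord M2 M1 = p" | "mord M1 M3 = 2" | "mord M3 M1 = 2" | "mord M2 M3 = q" | "mord M3 M2 = q"
| "mord _ _ = 1"

lemma mfun_simps:
  assumes "z \<in> hyp_plane"
  shows "mfun M1 z = Im (hX z)" "mfun M2 z = sin al * Re (hX z) - cos al * Im (hX z)"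
    "mfun M3 z = lgap 0 z / \<kappa>"
  using assms by (simp_all add: mfun_def lgap_def algebra_simps diff_divide_distrib)

lemma mir_in: "z \<in> hyp_plane \<Longrightarrow> mir s z \<in> hyp_plane"
  using Mob_in[OF apo_in] by (cases s) (auto simp: mir_def hyp_plane_iff norm_mult)

lemma mir_isometry: "hyp_isometry (mir s)"
proof -
  have "hyp_isometry (\<lambda>z. case s of M1 \<Rightarrow> cnj z | M2 \<Rightarrow> cis (2 * al) * cnj z
     | M3 \<Rightarrow> (- 1) * Mob (of_real apo) (cnj z))"
  proof (cases s)
    case M1
    then show ?thesis using hyp_isometry_cnj by simp
  next
    case M2
    then show ?thesis
      using hyp_isometry_compose[OF hyp_isometry_rotation[of "cis (2 * al)"] hyp_isometry_cnj] by (simp add: o_def)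
  next
    case M3
    then show ?thesis
      using hyp_isometry_compose[OF hyp_isometry_rotation[of "-1"]
        hyp_isometry_compose[OF hyp_isometry_Mob[OF apo_in] hyp_isometry_cnj]] by (simp add: o_def)
  qed
  then show ?thesis by (rule iffD2[OF hyp_isometry_cong, rotated]) (simp add: mir_def)
qed

text \<open>In hyperboloid coordinates each generator is the reflection that adds a multiple of the unit normal.
  The rest of the geometry of the chamber is contained in the Gram matrix of the normals, computed
  next: its entries are the cosines of \<open>pi / p\<close>, \<open>pi / 2\<close> and \<open>pi / q\<close>.\<close>

lemma mir_lorentz:
  assumes z: "z \<in> hyp_plane"
  shows "hT (mir s z) = hT z + 2 * mfun s z * nT s" "hX (mir s z) = hX z + of_real (2 * mfun s z) * nX s"
proof -
  have hTn: "hT w = hT w'" if "cmod w = cmod w'" for w w' using that by (simp add: hT_def)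
  have hXc: "hX (cnj w) = cnj (hX w)" for w by (simp add: hX_def)
  have hXu: "hX (u * w) = u * hX w" if "cmod u = 1" for u w using that by (simp add: hX_def norm_mult)
  have cz: "cnj z \<in> hyp_plane" using z by simp
  have "hT (mir s z) = hT z + 2 * mfun s z * nT s \<and> hX (mir s z) = hX z + of_real (2 * mfun s z) * nX s"
  proof (cases s)
    case M1
    have "hX (mir M1 z) = hX z + of_real (2 * mfun M1 z) * nX M1"
      using z by (simp add: mir_def hXc mfun_simps complex_eq_iff)
    then show ?thesis using M1 z hTn[of "cnj z" z] by (simp add: mir_def)
  next
    case M2
    have "hX (mir M2 z) = hX z + of_real (2 * mfun M2 z) * nX M2"
      using z unfolding mir_def mfun_simps(2)[OF z]
      by (simp add: hXc hXu complex_eq_iff sin_double cos_double_sin)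
        (simp add: algebra_simps power2_eq_square flip: distrib_left) 
    then show ?thesis using M2 z hTn[of "cis (2 * al) * cnj z" z] by (simp add: mir_def norm_mult)
  next
    case M3
    let ?a = "complex_of_real apo"
    define Z T where "Z = hX z" and "T = hT z"
    have k0: "\<kappa> \<noteq> 0" using \<kappa>(1) by simp
    have k2: "1 - apo\<^sup>2 = \<kappa>\<^sup>2" using \<kappa>(2) by simp
    have f: "mfun M3 z = (apo * T - Re Z) / \<kappa>" using z by (simp add: mfun_simps lgap_def Z_def T_def)
    have hTa: "hT ?a = (1 + apo\<^sup>2) / \<kappa>\<^sup>2" by (simp add: hT_def k2)
    have hXa: "hX ?a = of_real (2 * apo / \<kappa>\<^sup>2)" using k2 by (simp add: hX_def flip: of_real_power)
    have Tc: "hT (cnj z) = T" using hTn[of "cnj z" z] by (simp add: T_def)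
    have Xc: "hX (cnj z) = cnj Z" by (simp add: hXc Z_def)
    have r: "mir M3 z = (- 1) * Mob ?a (cnj z)" using z by (simp add: mir_def)
    have "hT (mir M3 z) = hT ?a * T - Re (hX ?a * Z)"
      unfolding r using hTn[of "(- 1) * Mob ?a (cnj z)" "Mob ?a (cnj z)"] hT_Mob[OF apo_in cz] Tc Xc by (simp add: norm_mult)
    also have "\<dots> = T + 2 * mfun M3 z * nT M3"
    proof -
      have "hT ?a * T - Re (hX ?a * Z) = ((1 + apo\<^sup>2) * T - 2 * apo * Re Z) / \<kappa>\<^sup>2"
        unfolding hTa hXa by (simp add: diff_divide_distrib)
      also have "(1 + apo\<^sup>2) * T - 2 * apo * Re Z = \<kappa>\<^sup>2 * T + 2 * apo * (apo * T - Re Z)"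
        unfolding \<kappa>(2) by (simp add: algebra_simps power2_eq_square)
      also have "\<dots> / \<kappa>\<^sup>2 = T + 2 * mfun M3 z * nT M3"
        unfolding f using k0 by (simp add: add_divide_distrib power2_eq_square)
      finally show ?thesis .
    qed
    finally have 1: "hT (mir M3 z) = T + 2 * mfun M3 z * nT M3" .
    have "hX (mir M3 z) = - hX (Mob ?a (cnj z))" unfolding r by (subst hXu) simp_all
    also have "\<dots> = - ((cnj Z + ?a\<^sup>2 * Z - 2 * ?a * of_real T) / of_real (\<kappa>\<^sup>2))"
      unfolding hX_Mob[OF apo_in cz] Tc Xc using k2 by simp
    also have "\<dots> = Z + of_real (2 * mfun M3 z) * nX M3"
    proof (rule complex_eqI)
      have nRe: "Re (cnj Z + ?a\<^sup>2 * Z - 2 * ?a * of_real T) = (1 + apo\<^sup>2) * Re Z - 2 * apo * T"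
        and nIm: "Im (cnj Z + ?a\<^sup>2 * Z - 2 * ?a * of_real T) = (apo\<^sup>2 - 1) * Im Z"
        by (simp_all add: power2_eq_square algebra_simps)
      have "Re (- ((cnj Z + ?a\<^sup>2 * Z - 2 * ?a * of_real T) / of_real (\<kappa>\<^sup>2)))
         = (2 * apo * T - (1 + apo\<^sup>2) * Re Z) / \<kappa>\<^sup>2"
        by (simp only: uminus_complex.sel Re_divide_of_real nRe minus_divide_left) (simp add: algebra_simps)
      also have "2 * apo * T - (1 + apo\<^sup>2) * Re Z = \<kappa>\<^sup>2 * Re Z + 2 * (apo * T - Re Z)"
        unfolding \<kappa>(2) by (simp add: algebra_simps)
      also have "\<dots> / \<kappa>\<^sup>2 = Re Z + 2 * mfun M3 z * (1 / \<kappa>)"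
        unfolding f using k0 by (simp add: add_divide_distrib power2_eq_square)
      finally show "Re (- ((cnj Z + ?a\<^sup>2 * Z - 2 * ?a * of_real T) / of_real (\<kappa>\<^sup>2)))
         = Re (Z + of_real (2 * mfun M3 z) * nX M3)" by simp
      have "Im (- ((cnj Z + ?a\<^sup>2 * Z - 2 * ?a * of_real T) / of_real (\<kappa>\<^sup>2))) = (1 - apo\<^sup>2) * Im Z / \<kappa>\<^sup>2"
        by (simp only: uminus_complex.sel Im_divide_of_real nIm minus_divide_left) (simp add: algebra_simps)
      also have "\<dots> = Im Z" unfolding k2 using k0 by simp
      finally show "Im (- ((cnj Z + ?a\<^sup>2 * Z - 2 * ?a * of_real T) / of_real (\<kappa>\<^sup>2)))
         = Im (Z + of_real (2 * mfun M3 z) * nX M3)" by simp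
    qed
    finally have "hX (mir M3 z) = Z + of_real (2 * mfun M3 z) * nX M3" .
    then show ?thesis using 1 M3 by (simp add: Z_def T_def)
  qed
  then show "hT (mir s z) = hT z + 2 * mfun s z * nT s" "hX (mir s z) = hX z + of_real (2 * mfun s z) * nX s" by auto
qed

lemma gram:
  "nT s * nT s - Re (nX s * cnj (nX s)) = -1"
  "s \<noteq> t \<Longrightarrow> nT s * nT t - Re (nX t * cnj (nX s)) = cos (pi / mord s t)"
proof -
  have k: "\<kappa> \<noteq> 0" using \<kappa>(1) by simp
  have "apo * apo - 1 = - (\<kappa> * \<kappa>)" using \<kappa>(2) by (simp add: power2_eq_square)
  then have "apo / \<kappa> * (apo / \<kappa>) - 1 / \<kappa> * (1 / \<kappa>) = - 1"
    using k by (simp flip: diff_divide_distrib)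
  then show "nT s * nT s - Re (nX s * cnj (nX s)) = -1"
    using sin_cos_squared_add[of al] by (cases s) (simp_all add: power2_eq_square)
  have c: "cos (pi / q) = sin al / \<kappa>" using \<kappa>(3) k angle by (simp add: field_simps)
  show "nT s * nT t - Re (nX t * cnj (nX s)) = cos (pi / mord s t)" if "s \<noteq> t"
    using that c by (cases s; cases t) (simp_all add: al_def[symmetric])
qed

lemma mfun_mir:
  assumes z: "z \<in> hyp_plane"
  shows "mfun s (mir t z) = mfun s z + 2 * mfun t z * (nT s * nT t - Re (nX t * cnj (nX s)))"
proof -
  define c where "c = mfun t z"
  have "mfun s (mir t z) = nT s * (hT z + 2 * c * nT t) - Re ((hX z + of_real (2 * c) * nX t) * cnj (nX s))"
    unfolding mfun_def[of s] using mir_in[OF z, of t] mir_lorentz[OF z, of t] by (simp add: c_def)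
  also have "\<dots> = mfun s z + 2 * c * (nT s * nT t - Re (nX t * cnj (nX s)))"
    unfolding mfun_def[of s] using z by (simp add: algebra_simps)
  finally show ?thesis by (simp add: c_def)
qed

sublocale reflection_system mir mfun mord hyp_plane
proof
  fix s t :: mirror and x y :: complex
  show "x \<in> hyp_plane \<Longrightarrow> mir s x \<in> hyp_plane" by (rule mir_in)
  show "x \<notin> hyp_plane \<Longrightarrow> mir s x = x" by (simp add: mir_def)
  show "mfun s (mir s x) = - mfun s x"
    using mfun_mir[of x s s] gram(1)[of s] by (cases "x \<in> hyp_plane") (simp_all add: mfun_def mir_def)
  show "s \<noteq> t \<Longrightarrow> mfun s (mir t x) = mfun s x + 2 * cos (pi / mord s t) * mfun t x"
    using mfun_mir[of x s t] gram(2)[of s t] by (cases "x \<in> hyp_plane") (simp_all add: mfun_def mir_def)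
  show "s \<noteq> t \<Longrightarrow> 2 \<le> mord s t" using p3 q3 by (cases s; cases t) simp_all
  show "mord s t = mord t s" by (cases s; cases t) simp_all
next
  fix x y assume D: "x \<in> hyp_plane" "y \<in> hyp_plane" and eq: "\<And>s. mfun s x = mfun s y"
  have i: "Im (hX x) = Im (hX y)" using eq[of M1] D by (simp add: mfun_simps)
  then have "Re (hX x) = Re (hX y)" using eq[of M2] D sin_al by (simp add: mfun_simps)
  then show "x = y" using hX_inj[OF D] i by (simp add: complex_eq_iff)
qed

lemma W_isometry: "w \<in> W \<Longrightarrow> hyp_isometry w"
proof (erule W_cases)
  fix ws assume "w = act mir ws"
  moreover have "hyp_isometry (act mir ws)"
  proof (induction ws)
    case Nil
    show ?case unfolding act.simps by (rule hyp_isometry_id)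
  next
    case (Cons s ws)
    show ?case unfolding act.simps by (rule hyp_isometry_compose[OF mir_isometry Cons.IH])
  qed
  ultimately show "hyp_isometry w" by simp
qed

text \<open>The dihedral symmetry group of the tile, generated by the two mirrors through the centre.\<close>

definition Dih :: "(complex \<Rightarrow> complex) set" where "Dih = {act mir ws | ws. set ws \<subseteq> {M1, M2}}"

lemma Dih_W: "u \<in> Dih \<Longrightarrow> u \<in> W" by (auto simp: Dih_def W_act)

lemma Dih_induct [consumes 1]:
  assumes "u \<in> Dih" "P id" "\<And>u. P u \<Longrightarrow> P (mir M1 \<circ> u)" "\<And>u. P u \<Longrightarrow> P (mir M2 \<circ> u)"
  shows "P u"
proof -
  obtain ws where ws: "u = act mir ws" "set ws \<subseteq> {M1, M2}" using assms(1) by (auto simp: Dih_def)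
  have "P (act mir ws)" using ws(2)
  proof (induction ws)
    case (Cons s ws)
    then have "P (act mir ws)" "s = M1 \<or> s = M2" by auto
    then show ?case using assms(3,4) by (metis act.simps(2))
  qed (use assms(2) in simp)
  then show ?thesis using ws by simp
qed

lemma gap_mir:
  assumes "z \<in> hyp_plane"
  shows "gap (- k) (mir M1 z) = gap k z" "gap (1 - k) (mir M2 z) = gap k z"
proof -
  have Re: "Re w = Re w'" if "w = cnj w'" for w w' using that by simp
  have "mir M1 z * cis (- (real_of_int (2 * (- k)) * al)) = cnj (z * cis (- (real_of_int (2 * k) * al)))"
    using assms by (simp add: mir_def cis_cnj)
  then show "gap (- k) (mir M1 z) = gap k z"
    unfolding gap_def using Re assms by (simp only:) (simp add: mir_def)
  have "mir M2 z * cis (- (real_of_int (2 * (1 - k)) * al)) = cnj (z * cis (- (real_of_int (2 * k) * al)))"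
    using assms by (simp add: mir_def cis_cnj mult_ac cis_mult) (simp add: algebra_simps)
  then show "gap (1 - k) (mir M2 z) = gap k z"
    unfolding gap_def using Re assms by (simp only:) (simp add: mir_def norm_mult)
qed

lemma Dih_gap:
  assumes "u \<in> Dih" shows "\<forall>k. \<exists>k'. \<forall>z\<in>hyp_plane. gap k' (u z) = gap k z" "\<forall>z. z \<in> hyp_plane \<longrightarrow> u z \<in> hyp_plane"
proof -
  have "(\<forall>k. \<exists>k'. \<forall>z\<in>hyp_plane. gap k' (u z) = gap k z) \<and> (\<forall>z. z \<in> hyp_plane \<longrightarrow> u z \<in> hyp_plane)"
    using assms
  proof (induction rule: Dih_induct)
    case (2 u)
    have "\<exists>k'. \<forall>z\<in>hyp_plane. gap k' ((mir M1 \<circ> u) z) = gap k z" for k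
    proof -
      obtain k' where "\<forall>z\<in>hyp_plane. gap k' (u z) = gap k z" using 2 by blast
      then show ?thesis using gap_mir(1) 2 by (intro exI[of _ "- k'"]) simp
    qed
    then show ?case using 2 mir_in by simp
  next
    case (3 u)
    have "\<exists>k'. \<forall>z\<in>hyp_plane. gap k' ((mir M2 \<circ> u) z) = gap k z" for k
    proof -
      obtain k' where "\<forall>z\<in>hyp_plane. gap k' (u z) = gap k z" using 3 by blast
      then show ?thesis using gap_mir(2) 3 by (intro exI[of _ "1 - k'"]) simp
    qed
    then show ?case using 3 mir_in by simp
  qed auto
  then show "\<forall>k. \<exists>k'. \<forall>z\<in>hyp_plane. gap k' (u z) = gap k z" "\<forall>z. z \<in> hyp_plane \<longrightarrow> u z \<in> hyp_plane" by auto
qed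

lemma mir_tile: "s = M1 \<or> s = M2 \<Longrightarrow> mir s ` tile = tile"
proof -
  assume s: "s = M1 \<or> s = M2"
  have "mir s z \<in> tile" if z: "z \<in> tile" for z
  proof -
    have zD: "z \<in> hyp_plane" using z by (simp add: tile_def)
    have "0 \<le> gap k (mir s z)" for k
      using s gap_mir(1)[OF zD, of "- k"] gap_mir(2)[OF zD, of "1 - k"] z by (auto simp: tile_def)
    then show ?thesis using mir_in[OF zD] by (simp add: tile_def)
  qed
  then show ?thesis using invol by (metis image_eqI image_subset_iff subsetI subset_antisym)
qed

lemma Dih_tile: "u \<in> Dih \<Longrightarrow> u ` tile = tile"
proof (induction rule: Dih_induct)
  case (2 u)
  then show ?case by (simp only: image_comp[symmetric]) (rule mir_tile, simp)
next
  case (3 u)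
  then show ?case by (simp only: image_comp[symmetric]) (rule mir_tile, simp)
qed simp

lemma Dih_vert: "u \<in> Dih \<Longrightarrow> \<exists>j. u (vert 0) = vert j"
proof (induction rule: Dih_induct)
  case (2 u)
  then obtain j where j: "u (vert 0) = vert j" by blast
  have "mir M1 (vert j) = vert (- j - 1)"
  proof -
    have "- (real_of_int (2 * j + 1) * al) = real_of_int (2 * (- j - 1) + 1) * al" by (simp add: algebra_simps)
    then show ?thesis by (simp only: mir_def vert_in if_True mirror.case) (simp add: vert_def cis_cnj)
  qed
  then show ?case using j by auto
next
  case (3 u)
  then obtain j where j: "u (vert 0) = vert j" by blast
  have "mir M2 (vert j) = vert (- j)"
  proof -
    have "2 * al + - (real_of_int (2 * j + 1) * al) = real_of_int (2 * (- j) + 1) * al" by (simp add: algebra_simps)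
    then have "cis (2 * al) * cis (- (real_of_int (2 * j + 1) * al)) = cis (real_of_int (2 * (- j) + 1) * al)"
      by (simp only: cis_mult)
    then show ?thesis by (simp only: mir_def vert_in if_True mirror.case) (simp add: vert_def cis_cnj mult.left_commute)
  qed
  then show ?case using j by auto
qed auto

text \<open>The closed chamber. The disc is required, since the functionals vanish outside it.\<close>

definition chamber :: "complex set" where "chamber = {z \<in> hyp_plane. \<forall>s. 0 \<le> mfun s z}"

text \<open>For a point of the chamber the inequality of the edge on \<open>M3\<close> implies those of the other edges,
  because its direction is nearest to that of the first edge. In coordinates the difference of the two
  inequalities is a combination of the two sector functionals with coefficients \<open>sin\<^sup>2\<close> and a product
  of consecutive sines, nonnegative by \<open>cos_odd\<close>.\<close>

lemma chamber_subset_tile: "chamber \<subseteq> tile"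
proof
  fix z assume z: "z \<in> chamber"
  then have zD: "z \<in> hyp_plane" and f: "\<And>s. 0 \<le> mfun s z" by (auto simp: chamber_def)
  define X Y where "X = Re (hX z)" and "Y = Im (hX z)"
  have f1: "0 \<le> Y" and f2: "0 \<le> sin al * X - cos al * Y" using f[of M1] f[of M2] zD by (simp_all add: mfun_simps X_def Y_def)
  have f3: "0 \<le> lgap 0 z" using f[of M3] zD \<kappa>(1) by (simp add: mfun_simps zero_le_divide_iff)
  have "0 \<le> lgap k z" for k
  proof -
    define a where "a = real_of_int k * al"
    have sk: "sin (real_of_int (k - 1) * al) = sin a * cos al - cos a * sin al"
      by (simp add: a_def left_diff_distrib sin_diff)
    have "0 \<le> 2 * sin (real_of_int (k - 1 + 1) * al) * sin (real_of_int (k - 1) * al)"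
      using cos_diff_sin[of "k - 1"] cos_odd(1)[of "k - 1"] by linarith
    then have "0 \<le> sin a * (sin a * cos al - cos a * sin al)" unfolding sk by (simp add: a_def)
    then have "0 \<le> 2 * ((sin a)\<^sup>2 * (sin al * X - cos al * Y) + sin a * (sin a * cos al - cos a * sin al) * Y)"
      using f1 f2 by (simp add: mult_nonneg_nonneg)
    also have "\<dots> = (X - Re (hX z * cis (- (real_of_int (2 * k) * al)))) * sin al"
    proof -
      have e: "real_of_int (2 * k) * al = 2 * a" by (simp add: a_def)
      have r: "Re (hX z * cis (- (2 * a))) = X * (1 - 2 * (sin a)\<^sup>2) + Y * (2 * sin a * cos a)"
        by (simp add: X_def Y_def cos_double_sin sin_double)
      show ?thesis unfolding e r by (simp add: algebra_simps power2_eq_square)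
    qed
    finally have "0 \<le> X - Re (hX z * cis (- (real_of_int (2 * k) * al)))" using sin_al by (simp add: zero_le_mult_iff)
    then show ?thesis using f3 by (simp add: lgap_def X_def)
  qed
  then show "z \<in> tile" using zD gap_sign(1) by (simp add: tile_def)
qed

lemma rotation_Dih: "\<exists>u\<in>Dih. \<forall>z\<in>hyp_plane. u z = cis (real_of_int (2 * k) * al) * z"
proof -
  have nat: "\<exists>u\<in>Dih. \<forall>z\<in>hyp_plane. u z = cis (2 * real j * al) * z" for j
  proof (induction j)
    case 0
    have "id \<in> Dih" unfolding Dih_def by (rule CollectI, rule exI[of _ "[]"]) simp
    then show ?case by (intro bexI[of _ id]) simp_all
  next
    case (Suc j)
    then obtain u where u: "u \<in> Dih" "\<And>z. z \<in> hyp_plane \<Longrightarrow> u z = cis (2 * real j * al) * z" by blast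
    then obtain ws where ws: "u = act mir ws" "set ws \<subseteq> {M1, M2}" by (auto simp: Dih_def)
    have "act mir (M2 # M1 # ws) \<in> Dih" unfolding Dih_def using ws(2) by (intro CollectI exI[of _ "M2 # M1 # ws"]) simp
    moreover have "act mir (M2 # M1 # ws) z = cis (2 * real (Suc j) * al) * z" if z: "z \<in> hyp_plane" for z
    proof -
      define w where "w = cis (2 * real j * al) * z"
      have D: "w \<in> hyp_plane" using z by (simp add: w_def hyp_plane_iff norm_mult)
      then have "mir M2 (mir M1 w) = cis (2 * al) * w" by (simp add: mir_def)
      then have "act mir (M2 # M1 # ws) z = cis (2 * al) * (cis (2 * real j * al) * z)"
        using u(2)[OF z] ws(1) by (simp add: w_def)
      also have "\<dots> = cis (2 * al + 2 * real j * al) * z" by (simp only: mult.assoc[symmetric] cis_mult)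
      finally show ?thesis by (simp add: algebra_simps)
    qed
    ultimately show ?case by blast
  qed
  define j where "j = nat (k mod int p)"
  have "int j = k mod int p" using p3 by (simp add: j_def)
  then have "k = int j + int p * (k div int p)" using mult_div_mod_eq[of "int p" k] by linarith
  then have "real_of_int (2 * k) * al = 2 * real j * al + real_of_int (2 * (int p * (k div int p))) * al"
    by (metis (no_types, opaque_lifting) distrib_left distrib_right of_int_add of_int_mult of_int_numeral of_int_of_nat_eq)
  then have "cis (real_of_int (2 * k) * al) = cis (2 * real j * al)" by (simp only: cis_period)
  then show ?thesis using nat[of j] by simp
qed

lemma Dih_comp: "u \<in> Dih \<Longrightarrow> v \<in> Dih \<Longrightarrow> u \<circ> v \<in> Dih"
proof -
  assume "u \<in> Dih" "v \<in> Dih"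
  then obtain xs ys where "u = act mir xs" "v = act mir ys" "set xs \<subseteq> {M1, M2}" "set ys \<subseteq> {M1, M2}"
    by (auto simp: Dih_def)
  then show ?thesis unfolding Dih_def by (intro CollectI exI[of _ "xs @ ys"]) (simp add: act_append)
qed

lemma Dih_generator: "s = M1 \<or> s = M2 \<Longrightarrow> mir s \<in> Dih"
  unfolding Dih_def by (intro CollectI exI[of _ "[s]"]) auto

lemma Dih_inverse:
  assumes "u \<in> Dih" shows "\<exists>v\<in>Dih. \<forall>x. v (u x) = x \<and> u (v x) = x"
proof -
  obtain ws where "u = act mir ws" "set ws \<subseteq> {M1, M2}" using assms by (auto simp: Dih_def)
  moreover from this have "act mir (rev ws) \<in> Dih"
    unfolding Dih_def by (intro CollectI exI[of _ "rev ws"]) simp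
  ultimately show ?thesis using act_rev by (intro bexI[of _ "act mir (rev ws)"]) simp_all
qed

text \<open>A rotation brings a point of the tile to within the angle \<open>al\<close> of the real axis, and a reflection
  then brings it to the chamber.\<close>

lemma tile_to_chamber:
  assumes z: "z \<in> tile" obtains u y where "u \<in> Dih" "y \<in> chamber" "z = u y"
proof -
  have zD: "z \<in> hyp_plane" using z by (simp add: tile_def)
  obtain k where k: "cmod z * cos al \<le> Re (z * cis (- (real_of_int (2 * k) * al)))"
    using exists_sector_index by blast
  obtain u where u: "u \<in> Dih" "\<And>z. z \<in> hyp_plane \<Longrightarrow> u z = cis (real_of_int (2 * (- k)) * al) * z"
    using rotation_Dih[of "- k"] by blast
  define w where "w = u z"
  have w: "w = z * cis (- (real_of_int (2 * k) * al))" using u(2)[OF zD] by (simp add: w_def mult.commute)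
  have "cmod w = cmod z" by (simp add: w norm_mult)
  then have wk: "cmod w * cos al \<le> Re w" using k by (simp add: w)
  have wD: "w \<in> hyp_plane" using Dih_gap(2)[OF u(1)] zD by (simp add: w_def)
  obtain u' where u': "u' \<in> Dih" "0 \<le> Im (u' w)" "Re (u' w) = Re w" "cmod (u' w) = cmod w"
  proof (cases "0 \<le> Im w")
    case True
    have "id \<in> Dih" unfolding Dih_def by (rule CollectI, rule exI[of _ "[]"]) simp
    then show ?thesis using that[of id] True by simp
  next
    case False
    then show ?thesis using that[of "mir M1"] Dih_generator wD by (simp add: mir_def)
  qed
  define y where "y = u' w"
  have uu: "u' \<circ> u \<in> Dih" using Dih_comp u u' by blast
  have yt: "y \<in> tile" using Dih_tile[OF uu] z by (auto simp: y_def w_def)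
  then have yD: "y \<in> hyp_plane" by (simp add: tile_def)
  have yk: "cmod y * cos al \<le> Re y" "0 \<le> Im y" using wk u' by (simp_all add: y_def)
  have "(Im y)\<^sup>2 \<le> (cmod y * sin al)\<^sup>2"
  proof -
    have "(cmod y * cos al)\<^sup>2 \<le> (Re y)\<^sup>2" using yk(1) cos_al by (intro power_mono) simp_all
    then show ?thesis by (simp add: cmod_power2 power_mult_distrib sin_squared_eq algebra_simps)
  qed
  then have "Im y \<le> cmod y * sin al" by (rule power2_le_imp_le) (use sin_al in simp)
  then have "cos al * Im y \<le> cos al * (cmod y * sin al)" using cos_al by simp
  also have "\<dots> = sin al * (cmod y * cos al)" by simp
  also have "\<dots> \<le> sin al * Re y" using yk(1) sin_al by simp
  finally have s2: "cos al * Im y \<le> sin al * Re y" .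
  have d: "0 < 1 - (cmod y)\<^sup>2" using one_minus_cmod2_pos[OF yD] .
  have "0 \<le> mfun M1 y" using yk d by (simp add: mfun_simps[OF yD] hX_Im)
  moreover have "mfun M2 y = 2 * (sin al * Re y - cos al * Im y) / (1 - (cmod y)\<^sup>2)"
    by (simp add: mfun_simps[OF yD] hX_Re hX_Im right_diff_distrib diff_divide_distrib mult.left_commute)
  then have "0 \<le> mfun M2 y" using s2 d by simp
  moreover have "0 \<le> mfun M3 y" using yt gap_sign(1)[OF yD, of 0] \<kappa>(1) by (simp add: mfun_simps[OF yD] tile_def)
  ultimately have "\<forall>s. 0 \<le> mfun s y" by (simp only: mirror_all)
  then have "y \<in> chamber" using yD by (simp add: chamber_def)
  moreover obtain v where v: "v \<in> Dih" "\<And>x. v ((u' \<circ> u) x) = x" using Dih_inverse[OF uu] by auto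
  have "z = v y" using v(2)[of z] by (simp add: y_def w_def)
  ultimately show ?thesis using that v(1) by blast
qed

end


context triangle
begin

lemma W_inverse_ex: "w \<in> W \<Longrightarrow> \<exists>v\<in>W. \<forall>x. v (w x) = x \<and> w (v x) = x"
  by (erule W_inverse) blast

section \<open>Chambers cover the plane\<close>

text \<open>Reflecting \<open>z\<close> brings it nearer to \<open>a\<close> precisely when the mirror separates the two points. This
  is what makes a nearest translate lie in the chamber.\<close>

lemma cosh_dist_mir:
  assumes "a \<in> hyp_plane" "z \<in> hyp_plane"
  shows "cosh (hyp_dist a (mir s z)) = cosh (hyp_dist a z) + 2 * mfun s z * mfun s a"
proof -
  define c where "c = mfun s z"
  have "cosh (hyp_dist a (mir s z)) = hT a * (hT z + 2 * c * nT s) - Re (hX a * cnj (hX z + of_real (2 * c) * nX s))"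
    using cosh_hyp_dist[OF assms(1) mir_in[OF assms(2)], of s] mir_lorentz[OF assms(2), of s] by (simp add: c_def)
  also have "\<dots> = cosh (hyp_dist a z) + 2 * c * (nT s * hT a - Re (hX a * cnj (nX s)))"
    unfolding cosh_hyp_dist[OF assms] by (simp add: algebra_simps)
  finally show ?thesis using assms by (simp add: mfun_def c_def)
qed

lemma chamber_point: obtains a where "a \<in> hyp_plane" "\<And>s. 0 < mfun s a"
proof -
  \<comment> \<open>On the bisector of the sector, near enough to the centre to be on the inner side of \<open>M3\<close>.\<close>
  define a where "a = of_real (apo / 2) * cis (al / 2)"
  have c: "cmod a = apo / 2" using apo by (simp add: a_def norm_mult)
  have aD: "a \<in> hyp_plane" using c apo1 by (simp add: hyp_plane_iff)
  have d: "0 < 1 - (cmod a)\<^sup>2" using one_minus_cmod2_pos[OF aD] .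
  have s: "0 < sin (al / 2)" using al by (intro sin_gt_zero) auto
  have "Re a = apo / 2 * cos (al / 2)" "Im a = apo / 2 * sin (al / 2)" by (simp_all add: a_def)
  note ri = this
  have 1: "0 < mfun M1 a" unfolding mfun_simps(1)[OF aD] hX_Im ri using d s apo by simp
  have "mfun M2 a = apo * (sin al * cos (al / 2) - cos al * sin (al / 2)) / (1 - (cmod a)\<^sup>2)"
    unfolding mfun_simps(2)[OF aD] hX_Re hX_Im ri by (simp add: right_diff_distrib diff_divide_distrib mult.left_commute)
  also have "sin al * cos (al / 2) - cos al * sin (al / 2) = sin (al / 2)"
    using sin_diff[of al "al / 2"] by simp
  finally have 2: "0 < mfun M2 a" using d s apo by simp
  have "0 < gap 0 a"
  proof -
    have "gap 0 a = apo * (1 - cos (al / 2) + (cmod a)\<^sup>2)" by (simp add: gap_def ri algebra_simps)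
    moreover have "0 < (cmod a)\<^sup>2" unfolding c using apo by simp
    then have "0 < 1 - cos (al / 2) + (cmod a)\<^sup>2" using cos_le_one[of "al / 2"] by linarith
    ultimately show ?thesis using apo by simp
  qed
  then have "0 < lgap 0 a" using gap_lgap[OF aD] d by (simp add: zero_less_mult_iff)
  then have 3: "0 < mfun M3 a" using \<kappa>(1) by (simp add: mfun_simps(3)[OF aD])
  have "\<forall>s. 0 < mfun s a" unfolding mirror_all using 1 2 3 by (intro conjI)
  then show ?thesis using that aD by blast
qed

lemma open_chamber: "open {z \<in> hyp_plane. \<forall>s. 0 < mfun s z}"
proof -
  have "continuous_on hyp_plane (\<lambda>z. nT s * hT z - Re (hX z * cnj (nX s)))" for s
    unfolding hT_def hX_def using one_minus_cmod2_pos
    by (intro continuous_intros) (force simp flip: of_real_power)+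
  then have "open {z \<in> hyp_plane. 0 < nT s * hT z - Re (hX z * cnj (nX s))}" for s
  proof -
    have "open (hyp_plane \<inter> (\<lambda>z. nT s * hT z - Re (hX z * cnj (nX s))) -` {0<..})"
      by (rule continuous_open_preimage[OF _ open_hyp_plane open_greaterThan]) fact
    moreover have "hyp_plane \<inter> (\<lambda>z. nT s * hT z - Re (hX z * cnj (nX s))) -` {0<..}
       = {z \<in> hyp_plane. 0 < nT s * hT z - Re (hX z * cnj (nX s))}" by auto
    ultimately show ?thesis by simp
  qed
  then have o: "open {z \<in> hyp_plane. 0 < mfun s z}" for s
    by (simp add: mfun_def cong: conj_cong)
  have "{z \<in> hyp_plane. \<forall>s. 0 < mfun s z} = {z \<in> hyp_plane. 0 < mfun M1 z} \<inter> {z \<in> hyp_plane. 0 < mfun M2 z} \<inter> {z \<in> hyp_plane. 0 < mfun M3 z}"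
    unfolding mirror_all by blast
  then show ?thesis by (simp only: open_Int o)
qed

lemma bounded_uniformly_discrete_finite:
  fixes E :: "complex set"
  assumes "bounded E" "0 < d" and sep: "\<And>x y. x \<in> E \<Longrightarrow> y \<in> E \<Longrightarrow> x \<noteq> y \<Longrightarrow> d \<le> dist x y"
  shows "finite E"
proof (rule ccontr)
  assume inf: "infinite E"
  obtain l where "l islimpt E" using bounded_infinite_imp_islimpt[OF order_refl assms(1) inf] by blast
  then obtain x where x: "x \<in> E" "x \<noteq> l" "dist x l < d / 2"
    using assms(2) unfolding islimpt_approachable by (meson half_gt_zero)
  then obtain y where y: "y \<in> E" "y \<noteq> l" "dist y l < min (d / 2) (dist x l)"
    using \<open>l islimpt E\<close> assms(2) unfolding islimpt_approachable
    by (meson half_gt_zero min_less_iff_conj zero_less_dist_iff)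
  then have "x \<noteq> y" by auto
  moreover have "dist x y < d" using x(3) y(3) dist_triangle2[of x y l] by linarith
  ultimately show False using sep x y by force
qed

text \<open>A Euclidean ball about the chamber point \<open>a\<close> lies in the open chamber, so by \<open>chamber_disjoint\<close>
  distinct points of the orbit of \<open>a\<close> keep a fixed hyperbolic distance. In a compact part of the disc
  hyperbolic and Euclidean distances are comparable.\<close>

lemma orbit_finite:
  assumes a: "a \<in> hyp_plane" "\<And>s. 0 < mfun s a" and z: "z \<in> hyp_plane"
  shows "finite {w a | w. w \<in> W \<and> hyp_dist (w a) z \<le> B}" (is "finite ?E")
proof -
  have win: "w a \<in> hyp_plane" if "w \<in> W" for w using hyp_isometry_in[OF W_isometry[OF that] a(1)] .
  obtain \<epsilon> where e: "0 < \<epsilon>" "ball a \<epsilon> \<subseteq> {z \<in> hyp_plane. \<forall>s. 0 < mfun s z}"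
    using openE[OF open_chamber] a by blast
  \<comment> \<open>The orbit points considered lie in the closed hyperbolic ball of radius \<open>B\<close> about \<open>z\<close>, the image of a
    Euclidean disc of radius \<open>\<rho>\<close>.\<close>
  define C where "C = max 1 (cosh B)"
  define \<rho> where "\<rho> = sqrt ((C - 1) / (C + 1))"
  have C: "1 \<le> C" by (simp add: C_def)
  have \<rho>: "\<rho> < 1" "0 \<le> \<rho>" using C by (simp_all add: \<rho>_def real_sqrt_lt_1_iff divide_less_eq)
  let ?K = "Mob (- z) ` cball 0 \<rho>"
  have mz: "- z \<in> hyp_plane" using z by simp
  have sub: "cball 0 \<rho> \<subseteq> hyp_plane" using \<rho> by (auto simp: hyp_plane_iff)
  have "compact ?K"
    using continuous_on_subset[OF continuous_on_Mob[OF mz] sub] by (intro compact_continuous_image) auto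
  moreover have "?K \<subseteq> hyp_plane" using Mob_in[OF mz] sub by blast
  ultimately obtain r where r: "r < 1" "?K \<subseteq> cball 0 r" by (rule compact_in_smaller_disc)
  have EK: "?E \<subseteq> ?K"
  proof
    fix x assume "x \<in> ?E"
    then obtain w where w: "x = w a" "w \<in> W" "hyp_dist x z \<le> B" by blast
    have xD: "x \<in> hyp_plane" using win w by simp
    let ?y = "Mob z x"
    have yD: "?y \<in> hyp_plane" using Mob_in[OF z xD] .
    have "hT ?y = cosh (hyp_dist z x)" using hT_Mob[OF z xD] cosh_hyp_dist[OF z xD] by simp
    also have "\<dots> \<le> cosh B"
      using w(3) hyp_dist_nonneg[OF z xD] hyp_dist_commute[of x z] by (simp add: cosh_real_nonneg_le_iff)
    also have "\<dots> \<le> C" by (simp add: C_def)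
    finally have "hT ?y \<le> C" .
    then have "(cmod ?y)\<^sup>2 \<le> (C - 1) / (C + 1)"
      using one_minus_cmod2_pos[OF yD] C by (simp add: hT_def field_simps)
    then have "cmod ?y \<le> \<rho>" unfolding \<rho>_def by (rule real_le_rsqrt)
    moreover have "x = Mob (- z) ?y" using Mob_inverse[OF z xD] by simp
    ultimately show "x \<in> ?K" by auto
  qed
  have r0: "0 \<le> r"
  proof -
    have "Mob (- z) 0 \<in> ?K" using \<rho> by (intro imageI) simp
    then have "cmod (Mob (- z) 0) \<le> r" using r(2) by auto
    then show ?thesis using norm_ge_zero order_trans by blast
  qed
  then have r2: "0 < 1 - r\<^sup>2" using r(1) by (simp add: abs_square_less_1)
  show ?thesis
  proof (rule bounded_uniformly_discrete_finite)
    show "bounded ?E" using EK r(2) bounded_subset[OF bounded_cball] by (meson subset_trans)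
    show "0 < \<epsilon> * (1 - r\<^sup>2)" using e r2 by simp
    fix x y assume xy: "x \<in> ?E" "y \<in> ?E" "x \<noteq> y"
    then obtain v w where vw: "x = v a" "v \<in> W" "y = w a" "w \<in> W" by blast
    have D: "x \<in> hyp_plane" "y \<in> hyp_plane" using vw win by auto
    obtain v' where v': "v' \<in> W" "\<And>x. v' (v x) = x" "\<And>x. v (v' x) = x" using W_inverse_ex[OF vw(2)] by blast
    let ?b = "v' (w a)"
    have bD: "?b \<in> hyp_plane" using hyp_isometry_in[OF W_isometry[OF v'(1)]] D vw by simp
    have "?b \<notin> ball a \<epsilon>"
    proof
      assume "?b \<in> ball a \<epsilon>"
      then have "\<And>s. 0 < mfun s ((v' \<circ> w) a)" using e by auto
      then have "v' \<circ> w = id" using chamber_disjoint[OF W_comp[OF v'(1) vw(4)] a(2)] by blast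
      then have "v' (w a) = a" by (metis comp_apply id_apply)
      then have "w a = v a" using v'(3) by metis
      then show False using xy vw by simp
    qed
    then have far: "\<epsilon> \<le> cmod (a - ?b)" by (simp add: dist_norm)
    have le1: "0 < 1 - (cmod x)\<^sup>2" "1 - (cmod x)\<^sup>2 \<le> 1" if "x \<in> hyp_plane" for x
      using one_minus_cmod2_pos[OF that] by simp_all
    have "\<epsilon>\<^sup>2 \<le> (cmod (a - ?b))\<^sup>2" using far e by (intro power_mono) simp_all
    also have "\<dots> \<le> (cmod (a - ?b))\<^sup>2 / ((1 - (cmod a)\<^sup>2) * (1 - (cmod ?b)\<^sup>2))"
    proof -
      have "(1 - (cmod a)\<^sup>2) * (1 - (cmod ?b)\<^sup>2) \<le> 1"
        using mult_mono[OF le1(2)[OF a(1)] le1(2)[OF bD]] le1(1)[OF bD] by simp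
      moreover have "0 < (1 - (cmod a)\<^sup>2) * (1 - (cmod ?b)\<^sup>2)" using le1(1)[OF a(1)] le1(1)[OF bD] by simp
      ultimately show ?thesis by (simp add: le_divide_eq mult_left_le)
    qed
    also have "\<dots> = (cmod (x - y))\<^sup>2 / ((1 - (cmod x)\<^sup>2) * (1 - (cmod y)\<^sup>2))"
    proof -
      have "hyp_dist a ?b = hyp_dist x y"
        using hyp_isometry_dist[OF W_isometry[OF vw(2)] a(1) bD] v'(3) vw by simp
      then show ?thesis unfolding hyp_dist_eq_iff[OF a(1) bD D] .
    qed
    also have "\<dots> \<le> (cmod (x - y))\<^sup>2 / (1 - r\<^sup>2)\<^sup>2"
    proof (rule divide_left_mono)
      have "1 - r\<^sup>2 \<le> 1 - (cmod x')\<^sup>2" if "x' \<in> ?E" for x'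
      proof -
        have "x' \<in> cball 0 r" by (rule subsetD[OF r(2) subsetD[OF EK that]])
        then have "cmod x' \<le> r" by simp
        then show ?thesis by (simp add: power_mono)
      qed
      then show "(1 - r\<^sup>2)\<^sup>2 \<le> (1 - (cmod x)\<^sup>2) * (1 - (cmod y)\<^sup>2)"
        unfolding power2_eq_square[of "1 - r\<^sup>2"] using xy(1,2) r2 le1(1)[OF D(1)] by (intro mult_mono) simp_all
      then show "0 < (1 - (cmod x)\<^sup>2) * (1 - (cmod y)\<^sup>2) * (1 - r\<^sup>2)\<^sup>2" using le1(1)[OF D(1)] le1(1)[OF D(2)] r2 by simp
    qed simp
    finally have "(\<epsilon> * (1 - r\<^sup>2))\<^sup>2 \<le> (dist x y)\<^sup>2"
      using r2 by (simp add: power_mult_distrib dist_norm le_divide_eq)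
    then show "\<epsilon> * (1 - r\<^sup>2) \<le> dist x y" by (rule power2_le_imp_le) simp
  qed
qed

lemma chambers_cover:
  assumes z: "z \<in> hyp_plane" obtains w where "w \<in> W" "w z \<in> chamber"
proof -
  obtain a where a: "a \<in> hyp_plane" "\<And>s. 0 < mfun s a" by (rule chamber_point) blast
  \<comment> \<open>Minimising over the finitely many orbit points at least as near to \<open>z\<close> as \<open>a\<close> itself.\<close>
  let ?E = "{w a | w. w \<in> W \<and> hyp_dist (w a) z \<le> hyp_dist a z}"
  have fin: "finite ?E" by (rule orbit_finite[OF a z])
  have "a \<in> ?E" using W_id by (intro CollectI exI[of _ id]) simp
  then have "Min ((\<lambda>x. hyp_dist x z) ` ?E) \<in> (\<lambda>x. hyp_dist x z) ` ?E" using fin by (intro Min_in) auto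
  then obtain x where x: "x \<in> ?E" "hyp_dist x z = Min ((\<lambda>x. hyp_dist x z) ` ?E)" by (metis (no_types, lifting) imageE)
  then obtain v where v: "v \<in> W" "x = v a" "hyp_dist (v a) z \<le> hyp_dist a z" by blast
  have minimal: "hyp_dist (v a) z \<le> hyp_dist (u a) z" if "u \<in> W" for u
  proof (cases "u a \<in> ?E")
    case True
    then show ?thesis using x(2) fin v(2) by simp
  next
    case False
    then have "hyp_dist a z < hyp_dist (u a) z" using that by auto
    then show ?thesis using v(3) by simp
  qed
  obtain w where w: "w \<in> W" "\<And>x. w (v x) = x" "\<And>x. v (w x) = x" using W_inverse_ex[OF v(1)] by blast
  have wD: "w z \<in> hyp_plane" using hyp_isometry_in[OF W_isometry[OF w(1)] z] .
  have "0 \<le> mfun s (w z)" for s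
  proof -
    have rD: "mir s a \<in> hyp_plane" using mir_in a by blast
    have "hyp_dist a (w z) = hyp_dist (v a) z"
      using hyp_isometry_dist[OF W_isometry[OF v(1)] a(1) wD] w(3) by simp
    also have "\<dots> \<le> hyp_dist ((v \<circ> mir s) a) z" by (rule minimal[OF W_comp[OF v(1) W_generator]])
    also have "\<dots> = hyp_dist (mir s a) (w z)"
      using hyp_isometry_dist[OF W_isometry[OF v(1)] rD wD] w(3) by simp
    also have "\<dots> = hyp_dist a (mir s (w z))"
      using hyp_isometry_dist[OF mir_isometry rD wD, of s] invol by simp
    finally have "cosh (hyp_dist a (w z)) \<le> cosh (hyp_dist a (mir s (w z)))"
      using hyp_dist_nonneg[OF a(1) wD] hyp_dist_nonneg[OF a(1) mir_in[OF wD]] by (simp add: cosh_real_nonneg_le_iff)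
    then have "0 \<le> 2 * mfun s (w z) * mfun s a" using cosh_dist_mir[OF a(1) wD, of s] by simp
    then show ?thesis using a(2)[of s] by (simp add: zero_le_mult_iff)
  qed
  then show ?thesis using that w(1) wD by (simp add: chamber_def)
qed

section \<open>How two tiles meet\<close>

lemma chamber_gap_0:
  assumes "y \<in> chamber" "mfun M3 y = 0"
  shows "y \<in> vside (- 1)"
proof -
  have y: "y \<in> tile" "y \<in> hyp_plane" using assms chamber_subset_tile by (auto simp: chamber_def)
  then have "lgap (- 1 + 1) y = 0" using assms(2) \<kappa>(1) by (simp add: mfun_simps)
  then show ?thesis using tile_lgap_0_vside y by blast
qed

text \<open>Such a point is fixed by \<open>M2\<close>, which exchanges the two edge lines at \<open>vert 0\<close>; so it is on both edges.\<close>

lemma chamber_corner: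
  assumes y: "y \<in> chamber" and 0: "mfun M3 y = 0" "mfun M2 y = 0"
  shows "y = vert 0"
proof -
  have yD: "y \<in> hyp_plane" "y \<in> tile" using y chamber_subset_tile by (auto simp: chamber_def)
  have 1: "y \<in> vside (- 1)" by (rule chamber_gap_0[OF y 0(1)])
  then have "gap 0 y = 0" using lgap_vside[of y "- 1"] gap_sign(2)[OF yD(1)] by simp
  then have "gap 1 y = 0" using gap_mir(2)[OF yD(1), of 0] mirror_fixed[OF 0(2)] by simp
  then have "y \<in> vside 0" using tile_lgap_0_vside[OF yD(2), of 0] gap_sign(2)[OF yD(1)] by simp
  then have "y \<in> {vert (- 1), vert 0} \<inter> {vert 0, vert 1}"
    using vside_inter[of "- 1" 0 y] 1 not_dvd by simp
  then show ?thesis using vert_eq_iff[of "- 1" 1] vert_eq_iff[of "-1" 0] not_dvd by auto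
qed

lemma vside_fixed: "z \<in> vside (- 1) \<Longrightarrow> mir M3 z = z"
proof -
  assume z: "z \<in> vside (- 1)"
  then have "z \<in> hyp_plane" using vside_lorentz by blast
  then have "mfun M3 z = 0" using lgap_vside[OF z] by (simp add: mfun_simps)
  then show ?thesis by (rule mirror_fixed)
qed

lemma tile_meets_reflection: "tile \<inter> mir M3 ` tile = vside (- 1)"
proof (intro equalityI subsetI)
  fix z assume "z \<in> tile \<inter> mir M3 ` tile"
  then obtain z' where z: "z \<in> tile" "z' \<in> tile" "z = mir M3 z'" by blast
  have D: "z \<in> hyp_plane" "z' \<in> hyp_plane" using z by (auto simp: tile_def)
  have nn: "0 \<le> mfun M3 x" if "x \<in> tile" for x
  proof -
    have "x \<in> hyp_plane" "0 \<le> gap 0 x" using that by (auto simp: tile_def)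
    then show ?thesis using gap_sign(1) \<kappa>(1) by (simp add: mfun_simps)
  qed
  have "mfun M3 z = - mfun M3 z'" unfolding z(3) by (rule f_self)
  then have "mfun M3 z = 0" using nn[OF z(1)] nn[OF z(2)] by linarith
  then have "lgap (- 1 + 1) z = 0" using D \<kappa>(1) by (simp add: mfun_simps)
  then show "z \<in> vside (- 1)" using tile_lgap_0_vside z by blast
next
  fix z assume z: "z \<in> vside (- 1)"
  then show "z \<in> tile \<inter> mir M3 ` tile" using vside_subset_tile vside_fixed[OF z] by (metis IntI image_eqI subsetD)
qed

text \<open>\<open>M1\<close> and \<open>M3\<close> commute, so modulo the symmetries of the tile only the reflection in \<open>M3\<close> remains.\<close>

lemma edge_stabiliser:
  assumes "set ws \<subseteq> {M1, M3}"
  shows "act mir ws ` tile = tile \<or> act mir ws ` tile = mir M3 ` tile"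
  using assms
proof (induction ws)
  case (Cons s ws)
  have img: "act mir (s # ws) ` tile = mir s ` (act mir ws ` tile)" by (simp add: image_comp)
  have comm: "mir M1 (mir M3 x) = mir M3 (mir M1 x)" for x
    using braid[of M1 M3] by (simp add: numeral_2_eq_2 fun_eq_iff)
  have 1: "mir M1 ` (mir M3 ` tile) = mir M3 ` tile"
  proof -
    have "mir M1 ` (mir M3 ` tile) = mir M3 ` (mir M1 ` tile)" using comm by (simp add: image_image)
    then show ?thesis using mir_tile[of M1] by simp
  qed
  have 2: "mir M3 ` (mir M3 ` tile) = tile" by (simp add: image_image invol)
  have "s = M1 \<or> s = M3" "act mir ws ` tile = tile \<or> act mir ws ` tile = mir M3 ` tile" using Cons by auto
  moreover have "mir M1 ` tile = tile" by (rule mir_tile) simp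
  ultimately show ?case unfolding img using 1 2 by (elim disjE) (simp_all only: simp_thms)
qed simp

text \<open>The tile of \<open>g\<close> is the mirror image of the tile in one of its edges.\<close>

definition edge_contact :: "(complex \<Rightarrow> complex) \<Rightarrow> bool" where
  "edge_contact g \<longleftrightarrow> (\<exists>u\<in>Dih. g ` tile = u ` mir M3 ` tile \<and> tile \<inter> g ` tile = u ` vside (- 1))"

text \<open>Moving a common point \<open>x\<close> to the chamber in both tiles gives the same point \<open>y\<close>, and the element
  \<open>h\<close> comparing the two ways is a product of reflections in mirrors through \<open>y\<close>. If \<open>M3\<close> were not
  among these, \<open>h\<close> would be a symmetry of the tile. If \<open>M2\<close> is not among them, the tiles share an edge;
  and if it is, then \<open>y\<close> is the vertex of the chamber.\<close>

lemma contact: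
  assumes g: "g \<in> W" and ne: "g ` tile \<noteq> tile" and x: "x \<in> tile" "x \<in> g ` tile"
  shows "(\<exists>k. gap k x = 0) \<and> (edge_contact g \<or> (\<exists>i j. x = vert i \<and> x = g (vert j)))"
proof -
  obtain x' where x': "x' \<in> tile" "x = g x'" using x by blast
  obtain u y where u: "u \<in> Dih" "y \<in> chamber" "x = u y" using tile_to_chamber[OF x(1)] by metis
  obtain u' y' where u': "u' \<in> Dih" "y' \<in> chamber" "x' = u' y'" using tile_to_chamber[OF x'(1)] by metis
  obtain v where v: "v \<in> Dih" "\<And>x. v (u x) = x" "\<And>x. u (v x) = x" using Dih_inverse[OF u(1)] by blast
  obtain v' where v': "v' \<in> Dih" "\<And>x. v' (u' x) = x" "\<And>x. u' (v' x) = x" using Dih_inverse[OF u'(1)] by blast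
  \<comment> \<open>\<open>h\<close> maps the chamber point \<open>y'\<close> to the chamber point \<open>y\<close>, so they coincide.\<close>
  define h where "h = v \<circ> (g \<circ> u')"
  have hW: "h \<in> W" unfolding h_def using W_comp Dih_W u'(1) v(1) g by blast
  have hy: "h y' = y" using v(2)[of y] u(3) x'(2) u'(3) by (simp add: h_def)
  have inC: "0 \<le> mfun s y'" "0 \<le> mfun s (h y')" for s using u'(2) u(2) hy by (simp_all add: chamber_def)
  obtain ws where ws: "y = y'" "set ws \<subseteq> {s. mfun s y = 0}" "h = act mir ws"
    using closed_chamber_strict[OF hW inC] hy by auto
  have gh: "g ` tile = u ` (h ` tile)"
  proof -
    have "g z = u (h (v' z))" for z using v(3) v'(3) by (simp add: h_def)
    then have "g ` tile = u ` (h ` (v' ` tile))" by (auto simp: image_image)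
    then show ?thesis using Dih_tile[OF v'(1)] by simp
  qed
  have Dne: "h ` tile \<noteq> tile"
  proof
    assume "h ` tile = tile"
    then have "g ` tile = u ` tile" using gh by (simp only:)
    then show False using ne Dih_tile[OF u(1)] by (simp only:)
  qed
  have f3: "mfun M3 y = 0"
  proof (rule ccontr)
    assume "mfun M3 y \<noteq> 0"
    then have "s \<in> {M1, M2}" if "mfun s y = 0" for s using that by (cases s) simp_all
    then have "set ws \<subseteq> {M1, M2}" using ws(2) by blast
    then have "h \<in> Dih" using ws(3) by (auto simp: Dih_def)
    then show False using Dih_tile Dne by blast
  qed
  have yD: "y \<in> hyp_plane" using u(2) by (simp add: chamber_def)
  have "gap 0 y = 0" using gap_sign(2)[OF yD, of 0] f3 \<kappa>(1) yD by (simp add: mfun_simps)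
  then have "\<exists>k. gap k x = 0" using Dih_gap(1)[OF u(1)] yD u(3) by metis
  moreover have "edge_contact g \<or> (\<exists>i j. x = vert i \<and> x = g (vert j))"
  proof (cases "mfun M2 y = 0")
    case True
    then have y0: "y = vert 0" using chamber_corner u(2) f3 by blast
    obtain i where "u (vert 0) = vert i" using Dih_vert[OF u(1)] by blast
    moreover obtain j where "u' (vert 0) = vert j" using Dih_vert[OF u'(1)] by blast
    ultimately have "x = vert i" "x = g (vert j)" using y0 ws(1) u(3) u'(3) x'(2) by auto
    then show ?thesis by blast
  next
    case False
    then have "s \<in> {M1, M3}" if "mfun s y = 0" for s using that by (cases s) simp_all
    then have "set ws \<subseteq> {M1, M3}" using ws(2) by blast
    then have "h ` tile = mir M3 ` tile" using edge_stabiliser ws(3) Dne by blast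
    then have g3: "g ` tile = u ` mir M3 ` tile" using gh by simp
    moreover have "tile \<inter> g ` tile = u ` vside (- 1)"
    proof -
      have "inj u" using v(2) by (metis injI)
      then have "u ` tile \<inter> u ` (mir M3 ` tile) = u ` (tile \<inter> mir M3 ` tile)" by (simp add: image_Int)
      then show ?thesis using g3 Dih_tile[OF u(1)] tile_meets_reflection by simp
    qed
    ultimately show ?thesis unfolding edge_contact_def using u(1) by blast
  qed
  ultimately show ?thesis by blast
qed

lemma tile_polygon: "hyp_polygon tile"
  unfolding hyp_polygon_def using polygonal_circuit_verts polygon_of_verts by metis

lemma vert_polygon_vertices: "vert i \<in> polygon_vertices tile"
  unfolding polygon_vertices_def using polygonal_circuit_verts polygon_of_verts set_verts by auto

lemma vside_polygon_edges: "vside i \<in> polygon_edges tile"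
proof -
  have "0 \<le> i mod int p" "i mod int p < int p" using p3 by auto
  then have "vside i = side verts (nat (i mod int p))" "nat (i mod int p) < length verts"
    using side_verts[of "nat (i mod int p)"] vside_mod[of i] by (simp_all add: nat_less_iff)
  then show ?thesis unfolding polygon_edges_def using polygonal_circuit_verts polygon_of_verts by blast
qed

lemma edge_contact_edge:
  assumes "edge_contact g"
  shows "tile \<inter> g ` tile \<in> polygon_edges tile \<inter> polygon_edges (g ` tile)"
proof -
  obtain u where u: "u \<in> Dih" "g ` tile = u ` mir M3 ` tile" "tile \<inter> g ` tile = u ` vside (- 1)"
    using assms by (auto simp: edge_contact_def)
  have ui: "hyp_isometry u" using W_isometry Dih_W u(1) by blast
  have "u ` vside (- 1) \<in> polygon_edges (u ` tile)" by (rule polygon_edges_isometry[OF ui vside_polygon_edges])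
  moreover have "mir M3 ` vside (- 1) \<in> polygon_edges (mir M3 ` tile)"
    by (rule polygon_edges_isometry[OF mir_isometry vside_polygon_edges])
  then have "u ` (mir M3 ` vside (- 1)) \<in> polygon_edges (u ` (mir M3 ` tile))"
    by (rule polygon_edges_isometry[OF ui])
  moreover have "mir M3 ` vside (- 1) = vside (- 1)" using vside_fixed by (auto simp: image_iff)
  ultimately show ?thesis using u Dih_tile[OF u(1)] by simp
qed

text \<open>The midpoint of two vertices is nearer to the centre than the vertices, by strict convexity of the
  Euclidean norm (the parallelogram law).\<close>

lemma two_vertices_segment:
  assumes "vert i \<noteq> vert j"
  obtains z where "z \<in> geodesic_segment (vert i) (vert j)" "z \<notin> range vert"
proof -
  have "cmod (hX (vert i) + hX (vert j)) < hT (vert i) + hT (vert j)"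
  proof -
    have "cmod (hX x) < hT x" if "x \<in> hyp_plane" for x
      by (rule power2_less_imp_less) (use hT_hX_unit[OF that] hT_ge_1[OF that] in auto)
    then have "cmod (hX (vert i)) + cmod (hX (vert j)) < hT (vert i) + hT (vert j)"
      by (intro add_strict_mono) simp_all
    then show ?thesis using norm_triangle_ineq le_less_trans by blast
  qed
  then obtain z k where z: "z \<in> hyp_plane" "0 < k" "hT (vert i) + hT (vert j) = k * hT z"
    "hX (vert i) + hX (vert j) = of_real k * hX z" by (rule timelike_direction)
  have "lorentz_comb (1 / k) (1 / k) (vert i) (vert j) z"
    unfolding lorentz_comb_def
  proof
    have "hT z = (hT (vert i) + hT (vert j)) / k" using z by simp
    then show "hT z = 1 / k * hT (vert i) + 1 / k * hT (vert j)" by (simp add: add_divide_distrib)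
    have "hX z = (hX (vert i) + hX (vert j)) / of_real k" using z by simp
    then show "hX z = of_real (1 / k) * hX (vert i) + of_real (1 / k) * hX (vert j)" by (simp add: add_divide_distrib)
  qed
  then have seg: "z \<in> geodesic_segment (vert i) (vert j)"
    unfolding geodesic_segment_iff_lorentz[OF vert_in vert_in z(1)] using z(2) by (intro exI[of _ "1 / k"]) simp
  have "z \<noteq> vert l" for l
  proof
    assume zl: "z = vert l"
    have T: "hT (vert a) = hT (vert b)" for a b by (simp add: hT_vert)
    have Tp: "hT z \<noteq> 0" using hT_ge_1[OF z(1)] by simp
    have "k * hT z = 2 * hT z" using z(3) T zl by (metis mult_2)
    then have k: "k = 2" using Tp by simp
    define A B where "A = hX (vert i)" and "B = hX (vert j)"
    have nX: "(cmod (hX (vert a)))\<^sup>2 = (cmod (hX (vert b)))\<^sup>2" for a b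
      using hT_hX_unit[OF vert_in, of a] hT_hX_unit[OF vert_in, of b] T by (metis add_left_cancel)
    have "(cmod (A + B))\<^sup>2 = 4 * (cmod A)\<^sup>2"
      using z(4) nX[of l i] by (simp add: A_def B_def k zl norm_mult power_mult_distrib)
    moreover have "(cmod (A + B))\<^sup>2 + (cmod (A - B))\<^sup>2 = 2 * (cmod A)\<^sup>2 + 2 * (cmod B)\<^sup>2"
      by (simp add: cmod_power2) (simp add: power2_eq_square algebra_simps)
    ultimately have "(cmod (A - B))\<^sup>2 = 0" using nX[of i j] by (simp add: A_def B_def)
    then have "hX (vert i) = hX (vert j)" by (simp add: A_def B_def)
    then show False using hX_inj assms by simp
  qed
  then show ?thesis using that[OF seg] by blast
qed

text \<open>If the tiles share no edge, every common point is a vertex. There is at most one, because the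
  segment between two common points would consist of common points, by convexity.\<close>

lemma tiles_meet:
  assumes g: "g \<in> W" and ne: "g ` tile \<noteq> tile"
  shows "tile \<inter> g ` tile = {} \<or>
    (\<exists>v \<in> polygon_vertices tile \<inter> polygon_vertices (g ` tile). tile \<inter> g ` tile = {v}) \<or>
    (\<exists>e \<in> polygon_edges tile \<inter> polygon_edges (g ` tile). tile \<inter> g ` tile = e)"
proof (cases "edge_contact g \<or> tile \<inter> g ` tile = {}")
  case True
  then show ?thesis using edge_contact_edge by blast
next
  case False
  note gi = W_isometry[OF g]
  have pts: "\<exists>i j. x = vert i \<and> x = g (vert j)" if "x \<in> tile \<inter> g ` tile" for x
    using contact[OF g ne] that False by blast
  obtain x where x: "x \<in> tile \<inter> g ` tile" using False by blast
  have "y = x" if y: "y \<in> tile \<inter> g ` tile" for y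
  proof (rule ccontr)
    assume "y \<noteq> x"
    obtain i j where i: "x = vert i" "x = g (vert j)" using pts[OF x] by blast
    obtain i' j' where i': "y = vert i'" "y = g (vert j')" using pts[OF y] by blast
    obtain z where z: "z \<in> geodesic_segment x y" "z \<notin> range vert"
      using two_vertices_segment[of i i'] \<open>y \<noteq> x\<close> i i' by metis
    have "z \<in> tile" using tile_convex x y z by blast
    moreover have "z \<in> g ` tile"
    proof -
      have "geodesic_segment x y = g ` geodesic_segment (vert j) (vert j')"
        unfolding i(2) i'(2) by (rule geodesic_segment_isometry[OF gi]) simp_all
      then show ?thesis using z(1) tile_convex[OF vert_in_tile vert_in_tile] by blast
    qed
    ultimately show False using pts z(2) by blast
  qed
  then have "tile \<inter> g ` tile = {x}" using x by blast
  moreover have "x \<in> polygon_vertices tile \<inter> polygon_vertices (g ` tile)"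
  proof -
    obtain i j where "x = vert i" "x = g (vert j)" using pts[OF x] by blast
    then show ?thesis
      using vert_polygon_vertices[of i] polygon_vertices_isometry[OF gi vert_polygon_vertices[of j]]
      by (metis IntI)
  qed
  ultimately show ?thesis by blast
qed

lemma tiles_interior_disjoint:
  assumes "g \<in> W" "g ` tile \<noteq> tile" "open V" "V \<subseteq> tile" "V \<subseteq> g ` tile"
  shows "V = {}"
proof (rule ccontr)
  assume "V \<noteq> {}"
  then obtain x where x: "x \<in> V" by blast
  then have "x \<in> interior tile" using assms(3,4) by (meson interiorI)
  moreover obtain k where "gap k x = 0" using contact[OF assms(1,2)] x assms(4,5) by blast
  ultimately show False using gap_0_not_interior by blast
qed

section \<open>The tiling\<close>

text \<open>The tiling is transported by an isometry \<open>k\<close>, so that a polygon which is only isometric to a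
  standard one can be a tile itself.\<close>

definition tiles :: "(complex \<Rightarrow> complex) \<Rightarrow> complex set set" where
  "tiles k = {k ` w ` tile | w. w \<in> W}"

context
  fixes k :: "complex \<Rightarrow> complex"
  assumes k: "hyp_isometry k"
begin

lemma tile_subset: "tile \<subseteq> hyp_plane" by (auto simp: tile_def)

lemma W_tile_subset: "w \<in> W \<Longrightarrow> w ` tile \<subseteq> hyp_plane"
  using W_isometry hyp_isometry_in tile_subset by blast

text \<open>Two tiles are in the same relative position as the standard tile and one of its translates.\<close>

lemma two_tiles:
  assumes "a \<in> W" "b \<in> W"
  obtains g where "g \<in> W" "k ` b ` tile = (k \<circ> a) ` g ` tile" "g ` tile = tile \<longleftrightarrow> k ` b ` tile = k ` a ` tile"
    "k ` a ` tile \<inter> k ` b ` tile = (k \<circ> a) ` (tile \<inter> g ` tile)"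
proof -
  obtain a' where a': "a' \<in> W" "\<And>x. a' (a x) = x" "\<And>x. a (a' x) = x" using W_inverse_ex[OF assms(1)] by blast
  define g where "g = a' \<circ> b"
  have g: "g \<in> W" unfolding g_def by (rule W_comp[OF a'(1) assms(2)])
  have ka: "hyp_isometry (k \<circ> a)" by (rule hyp_isometry_compose[OF k W_isometry[OF assms(1)]])
  then have inj: "inj_on (k \<circ> a) hyp_plane" by (simp add: hyp_isometry_def bij_betw_def)
  have "k (b x) = k (a (g x))" for x using a'(3) by (simp add: g_def)
  then have 1: "k ` b ` tile = (k \<circ> a) ` g ` tile" by (simp add: image_image)
  have 2: "k ` a ` tile = (k \<circ> a) ` tile" by (simp add: image_image)
  have "g ` tile = tile \<longleftrightarrow> k ` b ` tile = k ` a ` tile"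
    unfolding 1 2 using inj_on_image_eq_iff[OF inj W_tile_subset[OF g] tile_subset] by blast
  moreover have "k ` a ` tile \<inter> k ` b ` tile = (k \<circ> a) ` (tile \<inter> g ` tile)"
    unfolding 1 2 using inj_on_image_Int[OF inj tile_subset W_tile_subset[OF g]] by blast
  ultimately show ?thesis by (rule that[OF g 1])
qed

lemma tiles_tiling: "tiling (tiles k)"
  unfolding tiling_def
proof (intro conjI ballI impI)
  fix t assume "t \<in> tiles k"
  then obtain w where "w \<in> W" "t = k ` w ` tile" by (auto simp: tiles_def)
  then show "hyp_polygon t" using hyp_polygon_isometry k W_isometry tile_polygon by blast
next
  have "\<Union> (tiles k) \<subseteq> hyp_plane"
    using W_tile_subset hyp_isometry_in[OF k] by (fastforce simp: tiles_def)
  moreover have "z \<in> \<Union> (tiles k)" if z: "z \<in> hyp_plane" for z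
  proof -
    have "k ` hyp_plane = hyp_plane" using k by (simp add: hyp_isometry_def bij_betw_def)
    then obtain z' where z': "z' \<in> hyp_plane" "z = k z'" using z by blast
    obtain w where w: "w \<in> W" "w z' \<in> chamber" by (rule chambers_cover[OF z'(1)])
    obtain w' where w': "w' \<in> W" "\<And>x. w' (w x) = x" using W_inverse_ex[OF w(1)] by blast
    have "z = k (w' (w z'))" using w'(2) z'(2) by simp
    then have "z \<in> k ` w' ` tile" using w(2) chamber_subset_tile by blast
    then show ?thesis using w'(1) by (auto simp: tiles_def)
  qed
  ultimately show "\<Union> (tiles k) = hyp_plane" by blast
next
  fix t u assume "t \<in> tiles k" "u \<in> tiles k" "t \<noteq> u"
  then obtain a b where ab: "a \<in> W" "b \<in> W" "t = k ` a ` tile" "u = k ` b ` tile" by (auto simp: tiles_def)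
  obtain g where g: "g \<in> W" "k ` b ` tile = (k \<circ> a) ` g ` tile" "g ` tile = tile \<longleftrightarrow> k ` b ` tile = k ` a ` tile"
    "k ` a ` tile \<inter> k ` b ` tile = (k \<circ> a) ` (tile \<inter> g ` tile)" by (rule two_tiles[OF ab(1,2)])
  have ne: "g ` tile \<noteq> tile" using g(3) ab \<open>t \<noteq> u\<close> by auto
  have ka: "hyp_isometry (k \<circ> a)" by (rule hyp_isometry_compose[OF k W_isometry[OF ab(1)]])
  then have inj: "inj_on (k \<circ> a) hyp_plane" by (simp add: hyp_isometry_def bij_betw_def)
  \<comment> \<open>A common interior point would give an open set of common points of the standard tile and a
    translate of it, but these are boundary points.\<close>
  let ?V = "hyp_plane \<inter> (k \<circ> a) -` (interior t \<inter> interior u)"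
  have "open ?V"
    by (intro continuous_open_preimage hyp_isometry_continuous ka open_hyp_plane open_Int open_interior)
  moreover have "?V \<subseteq> tile \<inter> g ` tile"
  proof
    fix x assume x: "x \<in> ?V"
    then have "(k \<circ> a) x \<in> t \<inter> u" using interior_subset by auto
    then have "(k \<circ> a) x \<in> (k \<circ> a) ` (tile \<inter> g ` tile)" using g(4) ab by simp
    then show "x \<in> tile \<inter> g ` tile"
      using x inj_on_image_mem_iff[OF inj, of x "tile \<inter> g ` tile"] tile_subset by blast
  qed
  ultimately have "?V = {}" using tiles_interior_disjoint[OF g(1) ne] by blast
  moreover have "interior t \<inter> interior u \<subseteq> (k \<circ> a) ` hyp_plane"
  proof -
    have "t = (k \<circ> a) ` tile" using ab by (simp add: image_image)
    then have "t \<subseteq> (k \<circ> a) ` hyp_plane" using tile_subset by blast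
    then show ?thesis using interior_subset by blast
  qed
  ultimately show "interior t \<inter> interior u = {}" by blast
next
  show "edge_to_edge (tiles k)"
    unfolding edge_to_edge_def
  proof (intro ballI impI)
    fix t u assume "t \<in> tiles k" "u \<in> tiles k" "t \<noteq> u"
    then obtain a b where ab: "a \<in> W" "b \<in> W" "t = k ` a ` tile" "u = k ` b ` tile" by (auto simp: tiles_def)
    obtain g where g: "g \<in> W" "k ` b ` tile = (k \<circ> a) ` g ` tile" "g ` tile = tile \<longleftrightarrow> k ` b ` tile = k ` a ` tile"
      "k ` a ` tile \<inter> k ` b ` tile = (k \<circ> a) ` (tile \<inter> g ` tile)" by (rule two_tiles[OF ab(1,2)])
    have ne: "g ` tile \<noteq> tile" using g(3) ab \<open>t \<noteq> u\<close> by auto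
    have ka: "hyp_isometry (k \<circ> a)" by (rule hyp_isometry_compose[OF k W_isometry[OF ab(1)]])
    have t: "t = (k \<circ> a) ` tile" using ab by (simp add: image_image)
    have u: "u = (k \<circ> a) ` g ` tile" using ab g(2) by simp
    have tu: "t \<inter> u = (k \<circ> a) ` (tile \<inter> g ` tile)" using g(4) ab by simp
    note V = polygon_vertices_isometry[OF ka] and E = polygon_edges_isometry[OF ka]
    from tiles_meet[OF g(1) ne] consider "tile \<inter> g ` tile = {}"
      | v where "v \<in> polygon_vertices tile" "v \<in> polygon_vertices (g ` tile)" "tile \<inter> g ` tile = {v}"
      | "tile \<inter> g ` tile \<in> polygon_edges tile" "tile \<inter> g ` tile \<in> polygon_edges (g ` tile)"
      by blast
    then show "t \<inter> u = {} \<or> (\<exists>v \<in> polygon_vertices t \<inter> polygon_vertices u. t \<inter> u = {v}) \<or>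
       (\<exists>e \<in> polygon_edges t \<inter> polygon_edges u. t \<inter> u = e)"
    proof cases
      case 1
      then show ?thesis using tu by simp
    next
      case (2 v)
      have "(k \<circ> a) v \<in> polygon_vertices t \<inter> polygon_vertices u"
        unfolding t u using V[OF 2(1)] V[OF 2(2)] by (rule IntI)
      moreover have "t \<inter> u = {(k \<circ> a) v}" unfolding tu 2(3) by simp
      ultimately show ?thesis by blast
    next
      case 3
      have "t \<inter> u \<in> polygon_edges t \<inter> polygon_edges u"
        unfolding tu unfolding t u using E[OF 3(1)] E[OF 3(2)] by (rule IntI)
      then show ?thesis by blast
    qed
  qed
qed

lemma tiles_symmetric: "symmetric_tiling (tiles k)"
  unfolding symmetric_tiling_def
proof (intro conjI ballI tiles_tiling)
  fix t u assume "t \<in> tiles k" "u \<in> tiles k"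
  then obtain a b where ab: "a \<in> W" "b \<in> W" "t = k ` a ` tile" "u = k ` b ` tile" by (auto simp: tiles_def)
  obtain k' where k': "hyp_isometry k'" "\<And>z. z \<in> hyp_plane \<Longrightarrow> k' (k z) = z"
    using hyp_isometry_inverse[OF k] by metis
  have conj: "(k \<circ> v \<circ> k') ` k ` w ` tile = k ` (v \<circ> w) ` tile" if "w \<in> W" for v w
  proof -
    have "k (v (k' (k (w x)))) = k (v (w x))" if "x \<in> tile" for x
    proof -
      have "w x \<in> hyp_plane" using that W_tile_subset[OF \<open>w \<in> W\<close>] by blast
      then show ?thesis by (simp only: k'(2))
    qed
    then show ?thesis by (simp add: image_image cong: image_cong)
  qed
  obtain a' where a': "a' \<in> W" "\<And>x. a' (a x) = x" "\<And>x. a (a' x) = x" using W_inverse_ex[OF ab(1)] by blast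
  define v where "v = b \<circ> a'"
  have v: "v \<in> W" unfolding v_def by (rule W_comp[OF ab(2) a'(1)])
  obtain v' where v': "v' \<in> W" "\<And>x. v (v' x) = x" using W_inverse_ex[OF v] by blast
  let ?g = "k \<circ> v \<circ> k'"
  have "hyp_isometry ?g" by (intro hyp_isometry_compose k k'(1) W_isometry v)
  moreover have "(\<lambda>s. ?g ` s) ` tiles k = tiles k"
  proof (intro equalityI subsetI)
    fix s assume "s \<in> (\<lambda>s. ?g ` s) ` tiles k"
    then obtain w where "w \<in> W" "s = ?g ` k ` w ` tile" by (auto simp: tiles_def)
    then have "s = k ` (v \<circ> w) ` tile" "v \<circ> w \<in> W" using conj[of w v] W_comp[OF v] by simp_all
    then show "s \<in> tiles k" unfolding tiles_def by blast
  next
    fix s assume "s \<in> tiles k"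
    then obtain w where w: "w \<in> W" "s = k ` w ` tile" by (auto simp: tiles_def)
    have v'w: "v' \<circ> w \<in> W" by (rule W_comp[OF v'(1) w(1)])
    have "v \<circ> (v' \<circ> w) = w" using v'(2) by (simp add: fun_eq_iff)
    then have "s = ?g ` k ` (v' \<circ> w) ` tile" unfolding conj[OF v'w] w(2) by (simp only:)
    moreover have "k ` (v' \<circ> w) ` tile \<in> tiles k" unfolding tiles_def using v'w by blast
    ultimately show "s \<in> (\<lambda>s. ?g ` s) ` tiles k" by blast
  qed
  moreover have "?g ` t = u"
  proof -
    have "v \<circ> a = b" using a'(2) by (simp add: v_def fun_eq_iff)
    then show ?thesis unfolding ab(3) conj[OF ab(1)] ab(4) by (simp only:)
  qed
  ultimately show "\<exists>g. hyp_isometry g \<and> (\<lambda>s. g ` s) ` tiles k = tiles k \<and> g ` t = u"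
    by (intro exI[of _ ?g] conjI)
qed

lemma tiles_prototile: "prototile (k ` tile) (tiles k)"
  unfolding prototile_def
proof (intro conjI ballI)
  show "hyp_polygon (k ` tile)" by (rule hyp_polygon_isometry[OF k tile_polygon])
  fix t assume "t \<in> tiles k"
  then obtain w where w: "w \<in> W" "t = k ` w ` tile" by (auto simp: tiles_def)
  obtain k' where k': "hyp_isometry k'" "\<And>z. z \<in> hyp_plane \<Longrightarrow> k' (k z) = z"
    using hyp_isometry_inverse[OF k] by metis
  have "(k \<circ> w \<circ> k') ` k ` tile = t"
  proof -
    have "k (w (k' (k x))) = k (w x)" if "x \<in> tile" for x
      using k'(2)[OF subsetD[OF tile_subset that]] by simp
    then show ?thesis unfolding w(2) by (simp add: image_image cong: image_cong)
  qed
  moreover have "hyp_isometry (k \<circ> w \<circ> k')" by (intro hyp_isometry_compose k k'(1) W_isometry w(1))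
  ultimately show "\<exists>g. hyp_isometry g \<and> g ` k ` tile = t" by (intro exI[of _ "k \<circ> w \<circ> k'"] conjI)
qed

end

end

section \<open>Existence of the polygon\<close>

text \<open>Solving for \<open>R\<close>: the half angle is \<open>pi / q\<close> if \<open>(1 - R\<^sup>2) / (1 + R\<^sup>2)\<close> equals
  \<open>c = tan (pi / q) * tan (pi / p)\<close>, and \<open>c < 1\<close> is equivalent to the hypothesis.\<close>

lemma exists_standard_triangle:
  assumes "0 < p" "0 < q" "1 / real p + 1 / real q < 1 / 2"
  obtains R where "triangle p R q"
proof -
  have gt: "3 \<le> n" if "0 < n" "1 / real n < 1 / 2" for n :: nat
  proof -
    have "2 < real n" using that by (simp add: field_simps)
    then show ?thesis by linarith
  qed
  have "0 < 1 / real p" "0 < 1 / real q" using assms by simp_all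
  then have p3: "3 \<le> p" and q3: "3 \<le> q" using gt[of p] gt[of q] assms by linarith+
  define a b where "a = pi / real p" and "b = pi / real q"
  have a: "0 < a" "a < pi / 2" and b: "0 < b" "b < pi / 2"
    using p3 q3 by (simp_all add: a_def b_def divide_simps)
  have "pi * (1 / real p + 1 / real q) < pi * (1 / 2)" using assms(3) by (intro mult_strict_left_mono) simp_all
  then have ab: "b < pi / 2 - a" by (simp add: a_def b_def algebra_simps)
  have ca: "0 < cos a" "0 < sin a" "0 < cos b" "0 < sin b" using a b by (auto intro!: cos_gt_zero sin_gt_zero)
  define c where "c = tan b * (sin a / cos a)"
  have "0 < tan b" using ca by (simp add: tan_def)
  then have c0: "0 < c" using ca by (simp add: c_def)
  have "tan b < tan (pi / 2 - a)" using ab a b by (intro tan_monotone) auto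
  also have "tan (pi / 2 - a) = cos a / sin a" by (simp add: tan_def cos_diff sin_diff)
  finally have c1: "c < 1" using ca by (simp add: c_def field_simps)
  define R where "R = sqrt ((1 - c) / (1 + c))"
  have Rsq: "R\<^sup>2 = (1 - c) / (1 + c)" using c0 c1 by (simp add: R_def)
  have "0 < R" using c0 c1 by (simp add: R_def)
  moreover have "R < 1" using c0 c1 by (simp add: R_def real_sqrt_lt_1_iff)
  ultimately interpret standard_polygon p R using p3 by unfold_locales
  have "(1 - R\<^sup>2) / (1 + R\<^sup>2) = c" unfolding Rsq using c0 c1 by (simp add: field_simps)
  then have "half_angle = arctan (c * cos a / sin a)" unfolding half_angle_def al_def a_def by simp
  also have "c * cos a / sin a = tan b" using ca by (simp add: c_def)
  also have "arctan (tan b) = b" using b by (intro arctan_tan) auto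
  finally have "triangle p R q" using q3 by unfold_locales (simp_all add: b_def)
  then show ?thesis by (rule that)
qed

theorem proposition2p10:
  fixes p q :: nat
  assumes "0 < p" and "0 < q"
    and "1 / real p + 1 / real q < 1 / 2"
  shows "(\<exists>P. q_regular_p_gon q p P) \<and>
         (\<forall>P. q_regular_p_gon q p P \<longrightarrow> (\<exists>T. regular_tiling T \<and> prototile P T))"
proof (intro conjI allI impI)
  obtain R where "triangle p R q" by (rule exists_standard_triangle[OF assms])
  then interpret triangle p R q .
  have "q_regular_p_gon q p tile"
    unfolding q_regular_p_gon_def using regular_tile angle by simp
  then show "\<exists>P. q_regular_p_gon q p P" by blast
next
  fix P assume P: "q_regular_p_gon q p P"
  have "3 \<le> q"
  proof -
    have "0 < 1 / real p" using assms by simp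
    then have "1 / real q < 1 / 2" using assms(3) by linarith
    then have "2 < real q" using assms(2) by (simp add: field_simps)
    then show ?thesis by linarith
  qed
  then have \<theta>: "0 < 2 * pi / real q" "2 * pi / real q < pi" by (simp_all add: divide_simps)
  have PR: "regular_polygon_with p (2 * pi / real q) P" using P by (simp add: q_regular_p_gon_def)
  obtain R h where R: "standard_polygon p R" "hyp_isometry h" "h ` P = standard_polygon.tile p R"
    "2 * pi / real q = 2 * standard_polygon.half_angle p R"
    by (rule regular_polygon_is_standard[OF PR \<theta>])
  interpret standard_polygon p R by (rule R(1))
  interpret triangle p R q using \<open>3 \<le> q\<close> R(4) by unfold_locales simp_all
  obtain k where k: "hyp_isometry k" "\<And>z. z \<in> hyp_plane \<Longrightarrow> k (h z) = z"
    using hyp_isometry_inverse[OF R(2)] by metis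
  have "P \<subseteq> hyp_plane" using PR polygon_of_subset by (auto simp: regular_polygon_with_def)
  then have kP: "k ` tile = P"
  proof -
    have "k (h x) = x" if "x \<in> P" for x by (rule k(2)[OF subsetD[OF \<open>P \<subseteq> hyp_plane\<close> that]])
    then show ?thesis unfolding R(3)[symmetric] by (simp add: image_image cong: image_cong)
  qed
  have "prototile P (tiles k)" using tiles_prototile[OF k(1)] by (simp only: kP)
  moreover have "regular_polygon P" using PR by (auto simp: regular_polygon_def)
  ultimately show "\<exists>T. regular_tiling T \<and> prototile P T"
    unfolding regular_tiling_def using tiles_symmetric[OF k(1)] by blast
qed

end
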